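(* For all $d,m\in\mathbb{N}$ there exists $\beta_0=\beta_0(d,m)>1$, and for each $r>0$ a constant $\mathrm{cst}(m,r)>0$ depending only on $m$ and $r$, such that: for every $n\ge m$, every polynomial map $p:\mathbb{R}^n\to\mathbb{R}^m$ with components of degree at most $d$, every $\Lambda=(\Lambda_1,\dots,\Lambda_m)\in\mathbb{R}^m_+$ and every $i=0,\dots,m$, $$V_i\big(p(C^\Lambda(p)\cap B_{\mathbb{R}^n}(r))\big)\le\mathrm{cst}(m,r)\,n^m\,\beta_0^n\,\Lambda_0\Lambda_1\cdots\Lambda_i,$$ where $\Lambda_0:=1$.
   Context: For a linear map $L:H\to\mathbb{R}^m$ on a Hilbert space with $\dim H\ge m$, the singular values are $\sigma_k(L)=\lambda_k(LL^\top)^{1/2}$, $k=1,\dots,m$, where $\lambda_1\ge\dots\ge\lambda_m$ are the eigenvalues of $LL^\top$. For a $C^1$ map $F:\mathbb{R}^n\to\mathbb{R}^m$, $n\ge m$, and $\Lambda\in\mathbb{R}^m_+$, $C^\Lambda(F)=\{x\in\mathbb{R}^n:\sigma_i(D_xF)\le\Lambda_i\ \forall i=1,\dots,m\}$. $B_{\mathbb{R}^n}(r)$ is the closed ball. Vitushkin variations of a bounded semialgebraic $A\subset\mathbb{R}^N$: $V_0(A)=b_0(A)$ is the number of connected components, and for $i=1,\dots,N$, $V_i(A)=c(N,i)\int_{G_i(\mathbb{R}^N)}\int_Z b_0(A\cap\pi_Z^{-1}(x))\,\mathcal{H}^i(dx)\,\gamma_{i,N}(dZ)$, where $G_i(\mathbb{R}^N)$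 is the Grassmannian of $i$-planes with its orthogonally invariant probability measure $\gamma_{i,N}$, $\pi_Z$ is orthogonal projection onto $Z$, $\mathcal{H}^i$ is $i$-dimensional Hausdorff measure, and $c(N,i)=\frac{\Gamma(1/2)\Gamma((N+1)/2)}{\Gamma((i+1)/2)\Gamma((N-i+1)/2)}$. *)

theory Defs
  imports "HOL-Analysis.Analysis" "HOL-Computational_Algebra.Polynomial"
begin

definition Rn :: "nat \<Rightarrow> (nat \<Rightarrow> real) set" where
  "Rn n = {x. \<forall>k\<ge>n. x k = 0}"

definition ballRn :: "nat \<Rightarrow> real \<Rightarrow> (nat \<Rightarrow> real) set" where
  "ballRn n r = {x \<in> Rn n. (\<Sum>k<n. (x k)^2) \<le> r^2}"

definition monomials_le :: "nat \<Rightarrow> nat \<Rightarrow> (nat \<Rightarrow> nat) set" where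
  "monomials_le n d = {\<alpha>. (\<forall>k\<ge>n. \<alpha> k = 0) \<and> (\<Sum>k<n. \<alpha> k) \<le> d}"

definition peval :: "nat \<Rightarrow> nat \<Rightarrow> ((nat \<Rightarrow> nat) \<Rightarrow> real) \<Rightarrow> (nat \<Rightarrow> real) \<Rightarrow> real" where
  "peval n d c x = (\<Sum>\<alpha>\<in>monomials_le n d. c \<alpha> * (\<Prod>k<n. x k ^ \<alpha> k))"

definition pmap :: "nat \<Rightarrow> nat \<Rightarrow> ('m::finite \<Rightarrow> (nat \<Rightarrow> nat) \<Rightarrow> real) \<Rightarrow> (nat \<Rightarrow> real) \<Rightarrow> real ^ 'm" where
  "pmap n d c x = (\<chi> j. peval n d (c j) x)"

definition jac :: "nat \<Rightarrow> nat \<Rightarrow> ('m::finite \<Rightarrow> (nat \<Rightarrow> nat) \<Rightarrow> real) \<Rightarrow> (nat \<Rightarrow> real) \<Rightarrow> 'm \<Rightarrow> nat \<Rightarrow> real" where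
  "jac n d c x j k = deriv (\<lambda>t. peval n d (c j) (x(k := x k + t))) 0"

definition gram :: "nat \<Rightarrow> nat \<Rightarrow> ('m::finite \<Rightarrow> (nat \<Rightarrow> nat) \<Rightarrow> real) \<Rightarrow> (nat \<Rightarrow> real) \<Rightarrow> real ^ 'm ^ 'm" where
  "gram n d c x = (\<chi> a b. \<Sum>k<n. jac n d c x a k * jac n d c x b k)"

definition charpoly :: "real ^ 'm ^ 'm \<Rightarrow> real poly" where
  "charpoly M = det (\<chi> i j. (if i = j then [:0, 1:] else 0) - [:M $ i $ j:])"

definition eigs_desc :: "real ^ 'm ^ 'm \<Rightarrow> real list" where
  "eigs_desc M = rev (sorted_list_of_multiset (proots (charpoly M)))"

text \<open>k-th singular value (k = 1..m) of D_x p: sigma_k = lambda_k(L L^T)^(1/2).\<close>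
definition sing_val :: "nat \<Rightarrow> nat \<Rightarrow> ('m::finite \<Rightarrow> (nat \<Rightarrow> nat) \<Rightarrow> real) \<Rightarrow> (nat \<Rightarrow> real) \<Rightarrow> nat \<Rightarrow> real" where
  "sing_val n d c x k = sqrt (eigs_desc (gram n d c x) ! (k - 1))"

definition CLam :: "nat \<Rightarrow> nat \<Rightarrow> ('m::finite \<Rightarrow> (nat \<Rightarrow> nat) \<Rightarrow> real) \<Rightarrow> (nat \<Rightarrow> real) \<Rightarrow> (nat \<Rightarrow> real) set" where
  "CLam n d c \<Lambda> = {x \<in> Rn n. \<forall>k\<in>{1..CARD('m)}. sing_val n d c x k \<le> \<Lambda> k}"

definition hausdorff_outer :: "nat \<Rightarrow> 'a::euclidean_space set \<Rightarrow> ennreal" where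
  "hausdorff_outer s A =
     (SUP \<delta>\<in>{0<..}. INF C\<in>{C :: nat \<Rightarrow> 'a set. A \<subseteq> (\<Union>j. C j) \<and> (\<forall>j. bounded (C j) \<and> diameter (C j) \<le> \<delta>)}.
        (\<Sum>j. ennreal (pi powr (real s / 2) / Gamma (real s / 2 + 1) * (diameter (C j) / 2) ^ s)))"

definition hausdorff_measure :: "nat \<Rightarrow> 'a::euclidean_space measure" where
  "hausdorff_measure s = measure_of UNIV (sets borel) (hausdorff_outer s)"

definition b0 :: "'a::euclidean_space set \<Rightarrow> ennreal" where
  "b0 A = (if finite (components A) then of_nat (card (components A)) else \<infinity>)"

definition cNi :: "nat \<Rightarrow> nat \<Rightarrow> real" where
  "cNi N i = Gamma (1/2) * Gamma ((real N + 1) / 2) / (Gamma ((real i + 1) / 2) * Gamma ((real N - real i + 1) / 2))"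

definition std_gauss :: "(real ^ 'm::finite) measure" where
  "std_gauss = density lborel (\<lambda>x. ennreal ((2 * pi) powr (- real CARD('m) / 2) * exp (- ((norm x)^2) / 2)))"

text \<open>Integral over the Grassmannian G_i(R^m) with respect to its orthogonally invariant
  probability measure, realised as the law of the span of i independent standard Gaussian vectors.\<close>
definition grass_integral :: "nat \<Rightarrow> ((real ^ 'm::finite) set \<Rightarrow> ennreal) \<Rightarrow> ennreal" where
  "grass_integral i G = (\<integral>\<^sup>+ v. G (span (v ` {..<i})) \<partial>(PiM {..<i} (\<lambda>_. std_gauss)))"

definition proj_fibre :: "(real ^ 'm::finite) set \<Rightarrow> real ^ 'm \<Rightarrow> (real ^ 'm) set" where
  "proj_fibre Z x = {y. \<forall>z\<in>Z. (y - x) \<bullet> z = 0}"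

definition vitushkin :: "nat \<Rightarrow> (real ^ 'm::finite) set \<Rightarrow> ennreal" where
  "vitushkin i A =
     (if i = 0 then b0 A
      else ennreal (cNi CARD('m) i) *
        grass_integral i (\<lambda>Z. \<integral>\<^sup>+ x. indicator Z x * b0 (A \<inter> proj_fibre Z x) \<partial>(hausdorff_measure i)))"

end

theory Submission
  imports Defs "HOL-Probability.Distributions"
begin

text \<open>For a polynomial map of degree \<open>D\<close> in \<open>N\<close> variables, counting dimensions of spaces of monomials yields
  algebraic relations, and these show that its generic fibres have at most \<open>D ^ N\<close> points. This
  replaces Bezout's theorem and Sard's theorem throughout.

  Diagonalizing \<open>gram\<close> by additional orthogonal variables and turning the inequalities into
  equations by slack variables, one writes the set \<open>C\<^sup>\<Lambda>(p) \<inter> B(r)\<close> as a projection of the compact zero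
  set of a nonnegative polynomial \<open>H\<close> of degree \<open>4 d + 4\<close> in \<open>n + O(m\<^sup>2)\<close> variables. The sections of
  the image by affine subspaces are images of zero sets of the same kind. Every component of such
  a set contains the image of a critical point of a generic linear perturbation of the polynomial,
  so the number of components is at most exponential in \<open>n\<close>.

  It remains to bound the measure of the projection of the image to an \<open>i\<close>-plane. Up to a small error
  it is the image of an algebraic set that is finite over the target and whose coordinates are locally
  functions of the target. By Cauchy-Binet, the Gram determinant of the map, which is at most
  \<open>(\<Lambda> 1 \<cdots> \<Lambda> i)\<^sup>2\<close>, bounds all the minors, so some coordinate projection contracts volume by at most
  \<open>\<Lambda> 1 \<cdots> \<Lambda> i\<close> times the number of minors; the coordinates are bounded by \<open>r\<close> and the
  multiplicity of each coordinate projection is at most exponential in \<open>n\<close>.\<close>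

section \<open>Polynomial functions\<close>

text \<open>A sum of squares has vanishing gradient on its zero set, so the lifted set carries no
  regular equations, and both estimates work with critical points of perturbed functions instead.
  For volumes the perturbed function contains the penalty \<open>|F x - y|^2\<close>, so that every
  target \<open>y\<close> is reached. The minimum misses \<open>y\<close> by a small residual, which
  becomes the error variables after rescaling by 1/\<epsilon>. There are then m more unknowns than
  critical equations, and adding either the target or m chosen coordinates gives a square system, to
  which the count \<open>D ^ N\<close> applies. Minima must exist, hence the slack variables that
  keep everything compact. The constants come from this. The count enters once for components of
  slices and once for multiplicities of projections, hence the exponent 2 in \<open>betaG\<close>.
  The factor n^m counts the maps that choose m among at most n + 2 m relevant coordinates. The
  degree d enters only through \<open>D\<close>, so that the remaining constant depends on m and r
  alone.\<close>

inductive polyf :: "'v set \<Rightarrow> nat \<Rightarrow> (('v \<Rightarrow> real) \<Rightarrow> real) \<Rightarrow> bool" for V where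
  polyf_const: "polyf V D (\<lambda>_. c)"
| polyf_var: "v \<in> V \<Longrightarrow> polyf V (Suc D) (\<lambda>x. x v)"
| polyf_add: "polyf V D f \<Longrightarrow> polyf V D g \<Longrightarrow> polyf V D (\<lambda>x. f x + g x)"
| polyf_mult: "polyf V D f \<Longrightarrow> polyf V E g \<Longrightarrow> polyf V (D + E) (\<lambda>x. f x * g x)"

text \<open>\<open>D\<close> is an upper bound for the degree: constants carry any bound and a
  variable any positive one, which is what lets the bound be raised by induction.\<close>

lemma polyf_mono: "polyf V D f \<Longrightarrow> D \<le> E \<Longrightarrow> V \<subseteq> W \<Longrightarrow> polyf W E f"
proof (induction arbitrary: E rule: polyf.induct)
  case (polyf_const D c)
  then show ?case by (simp add: polyf.polyf_const)
next
  case (polyf_var v D)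
  then obtain E' where "E = Suc E'" by (metis Suc_le_D)
  then show ?case using polyf_var by (auto intro: polyf.polyf_var)
next
  case (polyf_add D f g)
  then show ?case by (auto intro: polyf.polyf_add)
next
  case (polyf_mult D f D' g)
  have "polyf W D f" "polyf W (E - D) g"
    using polyf_mult by auto
  from polyf.polyf_mult[OF this] show ?case using polyf_mult by simp
qed

lemma polyf_var': "v \<in> V \<Longrightarrow> 1 \<le> D \<Longrightarrow> polyf V D (\<lambda>x. x v)"
  using polyf_var[of v V "D - 1"] by simp

lemma polyf_mult': "polyf V D f \<Longrightarrow> polyf V E g \<Longrightarrow> D + E \<le> K \<Longrightarrow> polyf V K (\<lambda>x. f x * g x)"
  using polyf_mult polyf_mono by blast

lemma polyf_cmult: "polyf V D f \<Longrightarrow> polyf V D (\<lambda>x. c * f x)"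
  using polyf_mult[OF polyf_const[of V 0 c]] by simp

lemma polyf_uminus: "polyf V D f \<Longrightarrow> polyf V D (\<lambda>x. - f x)"
  using polyf_cmult[of V D f "-1"] by simp

lemma polyf_diff: "polyf V D f \<Longrightarrow> polyf V D g \<Longrightarrow> polyf V D (\<lambda>x. f x - g x)"
  using polyf_add[OF _ polyf_uminus] by force

lemma polyf_sum: "(\<And>i. i \<in> I \<Longrightarrow> polyf V D (f i)) \<Longrightarrow> polyf V D (\<lambda>x. \<Sum>i\<in>I. f i x)"
  by (induction I rule: infinite_finite_induct) (auto intro: polyf_const polyf_add)

lemma polyf_power: "polyf V D f \<Longrightarrow> polyf V (k * D) (\<lambda>x. f x ^ k)"
  by (induction k) (auto intro: polyf_const polyf_mult)

lemma polyf_power2: "polyf V D f \<Longrightarrow> 2 * D \<le> E \<Longrightarrow> polyf V E (\<lambda>x. (f x)\<^sup>2)"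
  using polyf_power[of V D f 2] polyf_mono by blast

lemma polyf_prod: "finite I \<Longrightarrow> (\<And>i. i \<in> I \<Longrightarrow> polyf V (D i) (f i)) \<Longrightarrow> polyf V (\<Sum>i\<in>I. D i) (\<lambda>x. \<Prod>i\<in>I. f i x)"
  by (induction I rule: finite_induct) (auto intro: polyf_const polyf_mult)

lemma polyf_cong: "polyf V D f \<Longrightarrow> (\<And>v. v \<in> V \<Longrightarrow> x v = y v) \<Longrightarrow> f x = f y"
  by (induction rule: polyf.induct) auto

lemma polyf_continuous: "polyf V D f \<Longrightarrow> continuous_on A f"
proof (induction rule: polyf.induct)
  case (polyf_var v D)
  show ?case by (rule continuous_on_subset[OF continuous_on_product_coordinates]) auto
qed (auto intro: continuous_intros)

section \<open>Partial derivatives\<close>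

definition pd :: "'v \<Rightarrow> (('v \<Rightarrow> real) \<Rightarrow> real) \<Rightarrow> ('v \<Rightarrow> real) \<Rightarrow> real" where
  "pd v f x = deriv (\<lambda>t. f (x(v := t))) (x v)"

text \<open>Both claims go through one induction, since the value of \<open>deriv\<close> in
  \<open>pd\<close> is known only where the derivative is known to exist. The degree bound is kept
  rather than lowered by one, which only affects constants.\<close>

lemma polyf_pd_aux:
  "polyf V D f \<Longrightarrow> polyf V D (pd v f) \<and> (\<forall>x t. ((\<lambda>t. f (x(v := t))) has_real_derivative pd v f (x(v := t))) (at t))"
proof (induction rule: polyf.induct)
  case (polyf_const D c)
  have "pd v (\<lambda>_. c) = (\<lambda>_. 0)" by (auto simp: pd_def)
  then show ?case by (auto intro: polyf.intros)
next
  case (polyf_var w D)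
  have *: "((\<lambda>t. (x(v := t)) w) has_real_derivative (if v = w then 1 else 0)) (at t)" for t x
    by auto
  have "pd v (\<lambda>x. x w) = (\<lambda>_. if v = w then 1 else 0)"
    unfolding pd_def by (rule ext, rule DERIV_imp_deriv, rule *)
  then show ?case using * by (auto intro: polyf.intros)
next
  case (polyf_add D f g)
  have *: "((\<lambda>t. f (x(v := t)) + g (x(v := t))) has_real_derivative pd v f (x(v := t)) + pd v g (x(v := t))) (at t)" for t x
    using polyf_add.IH by (intro DERIV_add) blast+
  have eq: "pd v (\<lambda>x. f x + g x) = (\<lambda>x. pd v f x + pd v g x)"
    using *[of x "x v" for x] unfolding pd_def by (auto intro!: ext DERIV_imp_deriv)
  have "polyf V D (pd v (\<lambda>x. f x + g x))"
    unfolding eq using polyf_add.IH polyf_add.hyps by (intro polyf.intros) blast+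
  then show ?case unfolding eq using * by blast
next
  case (polyf_mult D f E g)
  have *: "((\<lambda>t. f (x(v := t)) * g (x(v := t))) has_real_derivative pd v f (x(v := t)) * g (x(v := t)) + f (x(v := t)) * pd v g (x(v := t))) (at t)" for t x
  proof -
    have "((\<lambda>t. f (x(v := t))) has_real_derivative pd v f (x(v := t))) (at t)"
      "((\<lambda>t. g (x(v := t))) has_real_derivative pd v g (x(v := t))) (at t)"
      using polyf_mult.IH by blast+
    from DERIV_mult[OF this] show ?thesis by (simp add: mult.commute)
  qed
  have eq: "pd v (\<lambda>x. f x * g x) = (\<lambda>x. pd v f x * g x + f x * pd v g x)"
    using *[of x "x v" for x] unfolding pd_def by (auto intro!: ext DERIV_imp_deriv)
  have "polyf V (D + E) (pd v (\<lambda>x. f x * g x))"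
    unfolding eq using polyf_mult.IH polyf_mult.hyps by (intro polyf.intros) blast+
  then show ?case unfolding eq using * by blast
qed

lemma polyf_pd: "polyf V D f \<Longrightarrow> polyf V D (pd v f)"
  using polyf_pd_aux[of V D f v] by blast

lemma has_derivative_pd:
  "polyf V D f \<Longrightarrow> ((\<lambda>t. f (x(v := t))) has_real_derivative pd v f (x(v := t))) (at t)"
  using polyf_pd_aux[of V D f v] by blast

lemma pd_const: "pd v (\<lambda>_. c) = (\<lambda>_. 0)"
  by (auto simp: pd_def)

lemma pd_var: "pd v (\<lambda>x. x w) = (\<lambda>_. if v = w then 1 else 0)"
proof -
  have *: "((\<lambda>t. (x(v := t)) w) has_real_derivative (if v = w then 1 else 0)) (at t)" for t x
    by auto
  show ?thesis unfolding pd_def by (rule ext, rule DERIV_imp_deriv, rule *)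
qed

lemma pd_add: "polyf V D f \<Longrightarrow> polyf V E g \<Longrightarrow> pd v (\<lambda>x. f x + g x) = (\<lambda>x. pd v f x + pd v g x)"
proof
  fix x assume "polyf V D f" "polyf V E g"
  then have "((\<lambda>t. f (x(v := t)) + g (x(v := t))) has_real_derivative pd v f (x(v := x v)) + pd v g (x(v := x v))) (at (x v))"
    by (intro derivative_intros has_derivative_pd)
  then show "pd v (\<lambda>x. f x + g x) x = pd v f x + pd v g x"
    using DERIV_imp_deriv by (fastforce simp: pd_def[of _ "\<lambda>x. f x + g x"])
qed

lemma pd_mult: "polyf V D f \<Longrightarrow> polyf V E g \<Longrightarrow> pd v (\<lambda>x. f x * g x) = (\<lambda>x. pd v f x * g x + f x * pd v g x)"
proof
  fix x assume *: "polyf V D f" "polyf V E g"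
  have "((\<lambda>t. f (x(v := t)) * g (x(v := t))) has_real_derivative pd v f (x(v := x v)) * g (x(v := x v)) + f (x(v := x v)) * pd v g (x(v := x v))) (at (x v))"
    using has_derivative_pd[OF *(1), of x v "x v"] has_derivative_pd[OF *(2), of x v "x v"]
    by (auto intro!: derivative_eq_intros)
  then show "pd v (\<lambda>x. f x * g x) x = pd v f x * g x + f x * pd v g x"
    using DERIV_imp_deriv by (fastforce simp: pd_def[of _ "\<lambda>x. f x * g x"])
qed

lemma pd_sum: "(\<And>i. i \<in> I \<Longrightarrow> polyf V D (f i)) \<Longrightarrow> pd v (\<lambda>x. \<Sum>i\<in>I. f i x) = (\<lambda>x. \<Sum>i\<in>I. pd v (f i) x)"
proof (induction I rule: infinite_finite_induct)
  case (insert i I)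
  then show ?case by (simp add: pd_add[of V D _ D] polyf_sum)
qed (auto simp: pd_const)

lemma pd_cmult: "polyf V D f \<Longrightarrow> pd v (\<lambda>x. c * f x) = (\<lambda>x. c * pd v f x)"
  using pd_mult[OF polyf_const[of V 0 c], of D f v] by (simp add: pd_const)

text \<open>Points are functions, not vectors of a normed space, so the chain rule is stated along a
  map \<open>\<xi>\<close> whose coordinates in \<open>V\<close> are differentiable. Derivatives are
  relative to \<open>E\<close> because the sections in \<open>curve_image_bound\<close> are
  differentiable only within pieces.\<close>

lemma has_derivative_polyf:
  fixes \<xi> :: "'a::real_normed_vector \<Rightarrow> 'v \<Rightarrow> real"
  assumes "polyf V D f" "finite V"
    and "\<And>v. v \<in> V \<Longrightarrow> ((\<lambda>y. \<xi> y v) has_derivative \<xi>' v) (at y within E)"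
  shows "((\<lambda>y. f (\<xi> y)) has_derivative (\<lambda>\<eta>. \<Sum>v\<in>V. pd v f (\<xi> y) * \<xi>' v \<eta>)) (at y within E)"
  using assms(1)
proof (induction rule: polyf.induct)
  case (polyf_const D c)
  then show ?case by (simp add: pd_const)
next
  case (polyf_var v D)
  have "(\<lambda>\<eta>. \<Sum>w\<in>V. pd w (\<lambda>x. x v) (\<xi> y) * \<xi>' w \<eta>) = \<xi>' v"
    using polyf_var assms(2) by (auto simp: pd_var if_distrib[of "\<lambda>t. t * _"] sum.delta cong: if_cong)
  then show ?case using assms(3)[OF polyf_var] by simp
next
  case (polyf_add D f g)
  show ?case
    unfolding pd_add[OF polyf_add.hyps] distrib_right sum.distrib
    by (intro has_derivative_add polyf_add.IH)
next
  case (polyf_mult D f E' g)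
  have "(\<lambda>\<eta>. \<Sum>v\<in>V. pd v (\<lambda>x. f x * g x) (\<xi> y) * \<xi>' v \<eta>) =
     (\<lambda>\<eta>. f (\<xi> y) * (\<Sum>v\<in>V. pd v g (\<xi> y) * \<xi>' v \<eta>) + (\<Sum>v\<in>V. pd v f (\<xi> y) * \<xi>' v \<eta>) * g (\<xi> y))"
    by (auto simp: pd_mult[OF polyf_mult.hyps] sum_distrib_left sum_distrib_right sum.distrib[symmetric] algebra_simps intro!: sum.cong)
  then show ?case
    using has_derivative_mult[OF polyf_mult.IH] by simp
qed

section \<open>Generic fibres of polynomial maps\<close>

definition exps :: "'v set \<Rightarrow> nat \<Rightarrow> ('v \<Rightarrow> nat) set" where
  "exps V K = {\<alpha>. (\<forall>v. v \<notin> V \<longrightarrow> \<alpha> v = 0) \<and> sum \<alpha> V \<le> K}"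

definition pwr :: "'v set \<Rightarrow> ('v \<Rightarrow> nat) \<Rightarrow> ('v \<Rightarrow> real) \<Rightarrow> real" where
  "pwr V \<alpha> x = (\<Prod>v\<in>V. x v ^ \<alpha> v)"

lemma exps_le: "finite V \<Longrightarrow> \<alpha> \<in> exps V K \<Longrightarrow> \<alpha> v \<le> K"
  unfolding exps_def using member_le_sum[of v V \<alpha>]
  by (cases "v \<in> V") (auto intro: order_trans)

lemma finite_exps [simp]: "finite V \<Longrightarrow> finite (exps V K)"
proof (rule finite_subset)
  assume V: "finite V"
  show "exps V K \<subseteq> {f. \<forall>x. (x \<in> V \<longrightarrow> f x \<in> {..K}) \<and> (x \<notin> V \<longrightarrow> f x = 0)}"
    using exps_le[OF V] by (auto simp: exps_def)
  show "finite {f. \<forall>x. (x \<in> V \<longrightarrow> f x \<in> {..K}) \<and> (x \<notin> V \<longrightarrow> f x = (0::nat))}"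
    by (rule finite_set_of_finite_funs) (use V in auto)
qed

lemma zero_in_exps: "(\<lambda>_. 0) \<in> exps V K"
  by (auto simp: exps_def)

lemma card_exps_pos: "finite V \<Longrightarrow> 0 < card (exps V K)"
  using zero_in_exps[of V K] by (auto simp: card_gt_0_iff)

lemma card_exps_le: "finite V \<Longrightarrow> card (exps V K) \<le> (K + 1) ^ card V"
proof -
  assume V: "finite V"
  have "card (exps V K) \<le> card (V \<rightarrow>\<^sub>E {..K})"
  proof (rule card_inj_on_le[where f = "\<lambda>\<alpha>. restrict \<alpha> V"])
    show "inj_on (\<lambda>\<alpha>. restrict \<alpha> V) (exps V K)"
    proof (rule inj_onI, rule ext)
      fix \<alpha> \<beta> v
      assume "\<alpha> \<in> exps V K" "\<beta> \<in> exps V K" "restrict \<alpha> V = restrict \<beta> V"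
      then show "\<alpha> v = \<beta> v"
        by (cases "v \<in> V") (metis restrict_apply', auto simp: exps_def)
    qed
    show "(\<lambda>\<alpha>. restrict \<alpha> V) ` exps V K \<subseteq> V \<rightarrow>\<^sub>E {..K}"
      using exps_le[OF V] by auto
  qed (use V in \<open>auto intro: finite_PiE\<close>)
  also have "\<dots> = (K + 1) ^ card V" using V by (simp add: card_PiE)
  finally show ?thesis .
qed

lemma pwr_add: "pwr V (\<lambda>v. \<alpha> v + \<beta> v) x = pwr V \<alpha> x * pwr V \<beta> x"
  by (simp add: pwr_def power_add prod.distrib)

lemma polyf_pwr:
  assumes "finite V" "\<alpha> \<in> exps V K" "\<And>v. v \<in> V \<Longrightarrow> polyf W D (\<lambda>x. g x v)"
  shows "polyf W (D * K) (\<lambda>x. pwr V \<alpha> (g x))"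
proof -
  have "polyf W (\<Sum>v\<in>V. \<alpha> v * D) (\<lambda>x. pwr V \<alpha> (g x))"
    unfolding pwr_def using assms by (intro polyf_prod polyf_power) auto
  moreover have "(\<Sum>v\<in>V. \<alpha> v * D) \<le> D * K"
    using assms(2) by (simp add: exps_def sum_distrib_right[symmetric] mult.commute[of D])
  ultimately show ?thesis by (rule polyf_mono) auto
qed

text \<open>Passage from the closure rules to coefficients, on which the dimension counts act. For a
  product, the coefficients are collected along pairs of exponents with the same sum.\<close>

lemma polyf_expand:
  assumes "polyf V D f" "finite V"
  shows "\<exists>c. \<forall>x. f x = (\<Sum>\<alpha>\<in>exps V D. c \<alpha> * pwr V \<alpha> x)"
  using assms(1)
proof (induction rule: polyf.induct)
  case (polyf_const D c)
  have "(\<Sum>\<alpha>\<in>exps V D. (if \<alpha> = (\<lambda>_. 0) then c else 0) * pwr V \<alpha> x) = c" for x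
    using assms(2) zero_in_exps[of V D]
    by (simp add: if_distrib[of "\<lambda>t. t * _"] sum.delta pwr_def cong: if_cong)
  then show ?case by (intro exI[of _ "\<lambda>\<alpha>. if \<alpha> = (\<lambda>_. 0) then c else 0"]) simp
next
  case (polyf_var v D)
  let ?e = "\<lambda>w. if w = v then 1 else 0 :: nat"
  have e: "?e \<in> exps V (Suc D)" using polyf_var assms(2) by (auto simp: exps_def sum.delta)
  have "pwr V ?e x = x v" for x
  proof -
    have "pwr V ?e x = (\<Prod>w\<in>V. if w = v then x w else 1)"
      unfolding pwr_def by (intro prod.cong) auto
    also have "\<dots> = x v" using polyf_var assms(2) by (simp add: prod.delta)
    finally show ?thesis .
  qed
  then have "(\<Sum>\<alpha>\<in>exps V (Suc D). (if \<alpha> = ?e then 1 else 0) * pwr V \<alpha> x) = x v" for x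
    using assms(2) e by (simp add: if_distrib[of "\<lambda>t. t * _"] sum.delta cong: if_cong)
  then show ?case by (intro exI[of _ "\<lambda>\<alpha>. if \<alpha> = ?e then 1 else 0"]) simp
next
  case (polyf_add D f g)
  then obtain c c' where "\<forall>x. f x = (\<Sum>\<alpha>\<in>exps V D. c \<alpha> * pwr V \<alpha> x)"
    "\<forall>x. g x = (\<Sum>\<alpha>\<in>exps V D. c' \<alpha> * pwr V \<alpha> x)" by blast
  then show ?case
    by (intro exI[of _ "\<lambda>\<alpha>. c \<alpha> + c' \<alpha>"]) (simp add: distrib_right sum.distrib)
next
  case (polyf_mult D f E g)
  then obtain c c' where c: "\<And>x. f x = (\<Sum>\<alpha>\<in>exps V D. c \<alpha> * pwr V \<alpha> x)"
    and c': "\<And>x. g x = (\<Sum>\<alpha>\<in>exps V E. c' \<alpha> * pwr V \<alpha> x)" by blast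
  let ?S = "exps V D \<times> exps V E"
  let ?p = "\<lambda>(\<alpha>, \<beta>). (\<lambda>v. \<alpha> v + \<beta> v) :: 'a \<Rightarrow> nat"
  define k where "k \<gamma> = (\<Sum>z\<in>{z \<in> ?S. ?p z = \<gamma>}. c (fst z) * c' (snd z))" for \<gamma>
  have "f x * g x = (\<Sum>\<gamma>\<in>exps V (D + E). k \<gamma> * pwr V \<gamma> x)" for x
  proof -
    have "f x * g x = (\<Sum>z\<in>?S. c (fst z) * c' (snd z) * pwr V (?p z) x)"
      unfolding c c' sum_product sum.cartesian_product
      by (intro sum.cong) (auto simp: pwr_add)
    also have "\<dots> = (\<Sum>\<gamma>\<in>exps V (D + E). \<Sum>z\<in>{z \<in> ?S. ?p z = \<gamma>}. c (fst z) * c' (snd z) * pwr V (?p z) x)"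
      using assms(2) by (intro sum.group[symmetric] finite_cartesian_product finite_exps) (auto simp: exps_def sum.distrib)
    also have "\<dots> = (\<Sum>\<gamma>\<in>exps V (D + E). k \<gamma> * pwr V \<gamma> x)"
      unfolding k_def sum_distrib_right by (intro sum.cong) auto
    finally show ?thesis .
  qed
  then show ?case by blast
qed

section \<open>Dimension counts and algebraic relations\<close>

lemma linear_dependence:
  fixes C :: "'a \<Rightarrow> 'b \<Rightarrow> real"
  assumes "finite B" "finite A" "card B < card A"
  shows "\<exists>w. (\<exists>a\<in>A. w a \<noteq> 0) \<and> (\<forall>b\<in>B. (\<Sum>a\<in>A. w a * C a b) = 0)"
  using assms
proof (induction B arbitrary: A C rule: finite_induct)
  case empty
  then obtain a where "a \<in> A" by fastforce
  then show ?case by (intro exI[of _ "\<lambda>_. 1"]) auto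
next
  case (insert b B)
  show ?case
  proof (cases "\<exists>a\<in>A. C a b \<noteq> 0")
    case True
    then obtain a0 where a0: "a0 \<in> A" "C a0 b \<noteq> 0" by blast
    \<comment> \<open>Gaussian elimination with pivot \<open>C a0 b\<close>: subtracting multiples
      of row \<open>a0\<close> clears column \<open>b\<close>.\<close>
    define C' where "C' a b' = C a b' - C a b / C a0 b * C a0 b'" for a b'
    have "card B < card (A - {a0})" using insert a0 by simp
    then obtain w where w: "\<exists>a\<in>A - {a0}. w a \<noteq> 0" "\<forall>b\<in>B. (\<Sum>a\<in>A - {a0}. w a * C' a b) = 0"
      using insert.IH[of "A - {a0}" C'] insert.prems by auto
    \<comment> \<open>The weight of \<open>a0\<close> that makes column \<open>b\<close> vanish; the
      other columns then vanish by the relation for \<open>C'\<close>.\<close>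
    define s where "s = - (\<Sum>a\<in>A - {a0}. w a * C a b) / C a0 b"
    define w' where "w' = w(a0 := s)"
    have split: "(\<Sum>a\<in>A. w' a * C a b') = s * C a0 b' + (\<Sum>a\<in>A - {a0}. w a * C a b')" for b'
      using insert.prems a0 by (simp add: sum.remove[of A a0] w'_def)
    have "(\<Sum>a\<in>A. w' a * C a b') = 0" if "b' \<in> insert b B" for b'
    proof (cases "b' = b")
      case True
      then show ?thesis using a0 by (simp add: split s_def)
    next
      case False
      then have "b' \<in> B" using that by simp
      then have "0 = (\<Sum>a\<in>A - {a0}. w a * C' a b')" using w by simp
      also have "\<dots> = (\<Sum>a\<in>A - {a0}. w a * C a b') + s * C a0 b'"
        by (simp add: C'_def s_def right_diff_distrib sum_subtractf sum_distrib_right sum_distrib_left sum_divide_distrib mult_ac)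
      finally show ?thesis by (simp add: split)
    qed
    moreover have "\<exists>a\<in>A. w' a \<noteq> 0" using w(1) by (auto simp: w'_def)
    ultimately show ?thesis by blast
  next
    case False
    have "\<exists>w. (\<exists>a\<in>A. w a \<noteq> 0) \<and> (\<forall>b\<in>B. (\<Sum>a\<in>A. w a * C a b) = 0)"
      using insert by (intro insert.IH) auto
    then show ?thesis using False by auto
  qed
qed

text \<open>Every exponent is divided by \<open>D\<close> with remainder: there are
  \<open>D ^ card V\<close> families of remainders, and the quotients have total at most
  \<open>K + B\<close>.\<close>

lemma card_exps_scale:
  assumes "finite V" "1 \<le> D"
  shows "card (exps V (D * K + B)) \<le> D ^ card V * card (exps V (K + B))"
proof -
  have "card (exps V (D * K + B)) \<le> card ((V \<rightarrow>\<^sub>E {..<D}) \<times> exps V (K + B))"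
  proof (rule card_inj_on_le[where f = "\<lambda>\<alpha>. (restrict (\<lambda>v. \<alpha> v mod D) V, \<lambda>v. \<alpha> v div D)"])
    show "inj_on (\<lambda>\<alpha>. (restrict (\<lambda>v. \<alpha> v mod D) V, \<lambda>v. \<alpha> v div D)) (exps V (D * K + B))"
    proof (rule inj_onI, rule ext)
      fix \<alpha> \<beta> v
      assume a: "\<alpha> \<in> exps V (D * K + B)" "\<beta> \<in> exps V (D * K + B)"
        "(restrict (\<lambda>v. \<alpha> v mod D) V, \<lambda>v. \<alpha> v div D) = (restrict (\<lambda>v. \<beta> v mod D) V, \<lambda>v. \<beta> v div D)"
      show "\<alpha> v = \<beta> v"
      proof (cases "v \<in> V")
        case True
        have "restrict (\<lambda>v. \<alpha> v mod D) V v = restrict (\<lambda>v. \<beta> v mod D) V v" "\<alpha> v div D = \<beta> v div D"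
          using a(3) by (metis prod.inject)+
        then have "\<alpha> v mod D = \<beta> v mod D" "\<alpha> v div D = \<beta> v div D" using True by auto
        then show ?thesis by (metis div_mult_mod_eq)
      qed (use a in \<open>auto simp: exps_def\<close>)
    qed
    have "(\<lambda>v. \<alpha> v div D) \<in> exps V (K + B)" if "\<alpha> \<in> exps V (D * K + B)" for \<alpha>
    proof -
      have "D * (\<Sum>v\<in>V. \<alpha> v div D) \<le> (\<Sum>v\<in>V. \<alpha> v)"
        by (simp add: sum_distrib_left sum_mono)
      also have "\<dots> \<le> D * K + B" using that by (simp add: exps_def)
      also have "\<dots> \<le> D * (K + B)" using assms by (simp add: add_mult_distrib2)
      finally have "(\<Sum>v\<in>V. \<alpha> v div D) \<le> K + B" using assms by simp
      then show ?thesis using that by (auto simp: exps_def)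
    qed
    then show "(\<lambda>\<alpha>. (restrict (\<lambda>v. \<alpha> v mod D) V, \<lambda>v. \<alpha> v div D)) ` exps V (D * K + B)
      \<subseteq> (V \<rightarrow>\<^sub>E {..<D}) \<times> exps V (K + B)" using assms by auto
  qed (use assms in \<open>auto intro: finite_PiE\<close>)
  also have "\<dots> = D ^ card V * card (exps V (K + B))"
    using assms by (simp add: card_cartesian_product card_PiE)
  finally show ?thesis .
qed

text \<open>If the inequality failed for all \<open>K\<close>, each shift by \<open>e\<close> would
  multiply \<open>s\<close> by at least \<open>(P + 1) / P\<close>, and \<open>s\<close> would grow
  exponentially against its polynomial bound.\<close>

lemma poly_growth:
  fixes s :: "nat \<Rightarrow> nat"
  assumes s: "\<And>K. 0 < s K" "\<And>K. s K \<le> (K + 1) ^ M" and "0 < P"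
  shows "\<exists>K. P * s (K + e) < (P + 1) * s K"
proof (rule ccontr)
  assume "\<not> ?thesis"
  then have *: "(P + 1) * s K \<le> P * s (K + e)" for K by (meson not_less)
  define c where "c = real P / real (P + 1)"
  have c: "0 < c" "c < 1" using \<open>0 < P\<close> by (auto simp: c_def)
  have step: "s K \<le> c * s (K + e)" for K
  proof -
    have "real (P + 1) * real (s K) \<le> real P * real (s (K + e))"
      using *[of K] by (metis of_nat_le_iff of_nat_mult)
    then show ?thesis by (simp add: c_def field_simps)
  qed
  have le: "1 \<le> c ^ j * s (j * e)" for j
  proof (induction j)
    case 0
    then show ?case using s(1)[of 0] by simp
  next
    case (Suc j)
    have "c ^ j * s (j * e) \<le> c ^ j * (c * s (j * e + e))"
      by (intro mult_left_mono step) (use c in auto)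
    then show ?case using Suc by (simp add: algebra_simps)
  qed
  \<comment> \<open>The root spreads the decay \<open>c ^ j\<close> over the factors of the
    polynomial bound, so that it is enough that \<open>(j * e + 1) * y ^ j\<close> tends to 0.
    \<open>Suc M\<close> keeps the root meaningful for \<open>M = 0\<close>.\<close>
  define y where "y = root (Suc M) c"
  have y: "0 < y" "y < 1" using c by (auto simp: y_def)
  have yc: "y ^ Suc M = c" using c unfolding y_def by (intro real_root_pow_pos2) auto
  have b: "1 \<le> (real (j * e + 1) * y ^ j) ^ Suc M" for j
  proof -
    have "1 \<le> c ^ j * s (j * e)" by (rule le)
    also have "\<dots> \<le> c ^ j * real ((j * e + 1) ^ M)"
      using s(2)[of "j * e"] c by (intro mult_left_mono) (auto simp del: of_nat_power)
    also have "\<dots> \<le> c ^ j * real (j * e + 1) ^ Suc M"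
      unfolding of_nat_power using c by (intro mult_left_mono power_increasing) auto
    also have "\<dots> = (real (j * e + 1) * y ^ j) ^ Suc M"
    proof -
      have "c ^ j = (y ^ j) ^ Suc M"
        unfolding yc[symmetric] power_mult[symmetric] by (simp only: mult.commute)
      then show ?thesis by (simp only: power_mult_distrib mult.commute)
    qed
    finally show ?thesis .
  qed
  have "(\<lambda>j. real e * (real j * y ^ j) + y ^ j) \<longlonglongrightarrow> real e * 0 + 0"
    using y by (intro tendsto_intros powser_times_n_limit_0 LIMSEQ_power_zero) auto
  then have "\<forall>\<^sub>F j in sequentially. real e * (real j * y ^ j) + y ^ j < 1"
    by (rule order_tendstoD) simp
  then obtain j where "real e * (real j * y ^ j) + y ^ j < 1"
    by (meson eventually_happens' sequentially_bot)
  then have "real (j * e + 1) * y ^ j < 1" by (simp add: algebra_simps)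
  moreover have "0 \<le> real (j * e + 1) * y ^ j" using y by auto
  ultimately have "(real (j * e + 1) * y ^ j) ^ Suc M < 1"
    using power_strict_mono[of _ "1::real" "Suc M"] by simp
  with b[of j] show False by simp
qed

text \<open>Counting dimensions: the products of powers of the \<open>f v\<close> and of \<open>l\<close> outnumber the monomials
  they are combined from, since \<open>card (exps V K)\<close> grows polynomially in \<open>K\<close>.\<close>
lemma algebraic_dependence:
  assumes V: "finite V" and D: "1 \<le> D" and f: "\<And>v. v \<in> V \<Longrightarrow> polyf V D (f v)" and l: "polyf V e l"
  shows "\<exists>K w. (\<exists>\<alpha>\<in>exps V K. \<exists>b\<le>D ^ card V. w \<alpha> b \<noteq> 0) \<and>
    (\<forall>x. (\<Sum>\<alpha>\<in>exps V K. \<Sum>b\<le>D ^ card V. w \<alpha> b * (pwr V \<alpha> (\<lambda>v. f v x) * l x ^ b)) = 0)"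
proof -
  define B where "B = D ^ card V"
  have "0 < B" using D by (simp add: B_def)
  \<comment> \<open>\<open>(B + 1) * card (exps V K)\<close> products face at most
    \<open>B * card (exps V (K + e * B))\<close> monomials of degree at most
    \<open>D * K + e * B\<close>, by \<open>card_exps_scale\<close>.\<close>
  obtain K where K: "B * card (exps V (K + e * B)) < (B + 1) * card (exps V K)"
    using poly_growth[OF card_exps_pos[OF V] card_exps_le[OF V] \<open>0 < B\<close>] by blast
  let ?A = "exps V K \<times> {..B}"
  let ?N = "D * K + e * B"
  have "polyf V ?N (\<lambda>x. pwr V \<alpha> (\<lambda>v. f v x) * l x ^ b)" if "\<alpha> \<in> exps V K" "b \<le> B" for \<alpha> b
  proof (rule polyf_mult')
    show "polyf V (D * K) (\<lambda>x. pwr V \<alpha> (\<lambda>v. f v x))"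
      using polyf_pwr[OF V that(1), of V D "\<lambda>x v. f v x"] f by simp
    show "polyf V (b * e) (\<lambda>x. l x ^ b)" using l by (rule polyf_power)
    show "D * K + b * e \<le> ?N" using that by (simp add: mult.commute)
  qed
  then have "\<forall>z\<in>?A. \<exists>c. \<forall>x. pwr V (fst z) (\<lambda>v. f v x) * l x ^ snd z = (\<Sum>\<gamma>\<in>exps V ?N. c \<gamma> * pwr V \<gamma> x)"
    using polyf_expand[OF _ V] by auto
  from bchoice[OF this] obtain C where C: "\<And>z x. z \<in> ?A \<Longrightarrow> pwr V (fst z) (\<lambda>v. f v x) * l x ^ snd z = (\<Sum>\<gamma>\<in>exps V ?N. C z \<gamma> * pwr V \<gamma> x)"
    by blast
  have "card (exps V ?N) < card ?A"
    using card_exps_scale[OF V D, of K "e * B"] K by (simp add: card_cartesian_product B_def mult.commute)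
  then obtain w where w: "\<exists>z\<in>?A. w z \<noteq> 0" "\<forall>\<gamma>\<in>exps V ?N. (\<Sum>z\<in>?A. w z * C z \<gamma>) = 0"
    using linear_dependence[of "exps V ?N" ?A C] V by auto
  have "(\<Sum>\<alpha>\<in>exps V K. \<Sum>b\<le>B. w (\<alpha>, b) * (pwr V \<alpha> (\<lambda>v. f v x) * l x ^ b)) = 0" for x
  proof -
    have "(\<Sum>\<alpha>\<in>exps V K. \<Sum>b\<le>B. w (\<alpha>, b) * (pwr V \<alpha> (\<lambda>v. f v x) * l x ^ b))
      = (\<Sum>z\<in>?A. w z * (pwr V (fst z) (\<lambda>v. f v x) * l x ^ snd z))"
      by (simp add: sum.cartesian_product case_prod_beta)
    also have "\<dots> = (\<Sum>z\<in>?A. \<Sum>\<gamma>\<in>exps V ?N. w z * C z \<gamma> * pwr V \<gamma> x)"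
      using C by (intro sum.cong) (auto simp: sum_distrib_left mult.assoc)
    also have "\<dots> = (\<Sum>\<gamma>\<in>exps V ?N. (\<Sum>z\<in>?A. w z * C z \<gamma>) * pwr V \<gamma> x)"
      by (subst sum.swap) (simp add: sum_distrib_right)
    also have "\<dots> = 0" using w(2) by simp
    finally show ?thesis .
  qed
  moreover have "\<exists>\<alpha>\<in>exps V K. \<exists>b\<le>B. w (\<alpha>, b) \<noteq> 0" using w(1) by auto
  ultimately show ?thesis unfolding B_def
    by (intro exI[of _ K] exI[of _ "\<lambda>\<alpha> b. w (\<alpha>, b)"]) auto
qed

text \<open>Contained in the zero set of finitely many nonzero polynomials, each given by a bound \<open>K\<close> on the
  exponents and a family \<open>u\<close> of coefficients.\<close>
definition thin :: "'v set \<Rightarrow> ('v \<Rightarrow> real) set \<Rightarrow> bool" where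
  "thin V Z \<longleftrightarrow> (\<exists>U. finite U \<and> (\<forall>(K, u)\<in>U. \<exists>\<alpha>\<in>exps V K. u \<alpha> \<noteq> 0) \<and>
     (\<forall>\<tau>\<in>Z. \<exists>(K, u)\<in>U. (\<Sum>\<alpha>\<in>exps V K. u \<alpha> * pwr V \<alpha> \<tau>) = 0))"

lemma thin_Un: "thin V Y \<Longrightarrow> thin V Z \<Longrightarrow> thin V (Y \<union> Z)"
  unfolding thin_def
proof (elim exE conjE)
  fix U U' :: "(nat \<times> (('a \<Rightarrow> nat) \<Rightarrow> real)) set"
  assume *: "finite U" "finite U'"
    "\<forall>(K, u)\<in>U. \<exists>\<alpha>\<in>exps V K. u \<alpha> \<noteq> 0" "\<forall>(K, u)\<in>U'. \<exists>\<alpha>\<in>exps V K. u \<alpha> \<noteq> 0"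
    "\<forall>\<tau>\<in>Y. \<exists>(K, u)\<in>U. (\<Sum>\<alpha>\<in>exps V K. u \<alpha> * pwr V \<alpha> \<tau>) = 0"
    "\<forall>\<tau>\<in>Z. \<exists>(K, u)\<in>U'. (\<Sum>\<alpha>\<in>exps V K. u \<alpha> * pwr V \<alpha> \<tau>) = 0"
  show "\<exists>U. finite U \<and> (\<forall>(K, u)\<in>U. \<exists>\<alpha>\<in>exps V K. u \<alpha> \<noteq> 0) \<and>
     (\<forall>\<tau>\<in>Y \<union> Z. \<exists>(K, u)\<in>U. (\<Sum>\<alpha>\<in>exps V K. u \<alpha> * pwr V \<alpha> \<tau>) = 0)"
    by (rule exI[of _ "U \<union> U'"]) (use * in \<open>simp only: finite_Un ball_Un bex_Un, blast\<close>)
qed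

lemma thin_empty: "thin V {}"
  unfolding thin_def by (rule exI[of _ "{}"]) auto

lemma thin_UN: "finite I \<Longrightarrow> (\<And>i. i \<in> I \<Longrightarrow> thin V (Z i)) \<Longrightarrow> thin V (\<Union>i\<in>I. Z i)"
  by (induction I rule: finite_induct) (auto intro: thin_Un thin_empty)

text \<open>Real space with coordinates in \<open>V\<close>, realised inside the functions on the
  whole index type; fixing the remaining values to 0 allows fibres to be finite.\<close>

definition RV :: "'v set \<Rightarrow> ('v \<Rightarrow> real) set" where
  "RV V = {x. \<forall>v. v \<notin> V \<longrightarrow> x v = 0}"

text \<open>On the fibre over \<tau>, the relation for a linear form \<open>l t\<close> becomes a
  polynomial in one variable of degree at most \<open>B\<close> whose coefficients depend on \<tau>
  only. Unless a chosen nonzero coefficient polynomial vanishes at \<tau>, \<open>l t\<close> takes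
  at most \<open>B\<close> values on the fibre, and finitely many \<open>t\<close> suffice to
  separate any \<open>B + 1\<close> points.\<close>

lemma generic_fibre:
  assumes V: "finite V" and D: "1 \<le> D" and f: "\<And>v. v \<in> V \<Longrightarrow> polyf V D (f v)"
  shows "thin V {\<tau>. \<not> (finite {x\<in>RV V. \<forall>v\<in>V. f v x = \<tau> v} \<and> card {x\<in>RV V. \<forall>v\<in>V. f v x = \<tau> v} \<le> D ^ card V)}"
proof -
  define B where "B = D ^ card V"
  obtain idx :: "'a \<Rightarrow> nat" where idx: "inj_on idx V" "idx ` V \<subseteq> {..<card V}"
    using finite_imp_inj_to_nat_seg[OF V] ex_bij_betw_finite_nat[OF V]
    by (metis bij_betw_def atLeast0LessThan order_refl)
  \<comment> \<open>Coefficients on the moment curve: two distinct points are separated by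
    \<open>l t\<close> except for at most \<open>card V\<close> values of \<open>t\<close>.\<close>
  define l where "l t x = (\<Sum>v\<in>V. t ^ idx v * x v)" for t :: real and x :: "'a \<Rightarrow> real"
  have "polyf V 1 (l t)" for t
    unfolding l_def by (intro polyf_sum polyf_cmult polyf_var') auto
  then have "\<forall>t. \<exists>K w. (\<exists>\<alpha>\<in>exps V K. \<exists>b\<le>B. w \<alpha> b \<noteq> 0) \<and>
    (\<forall>x. (\<Sum>\<alpha>\<in>exps V K. \<Sum>b\<le>B. w \<alpha> b * (pwr V \<alpha> (\<lambda>v. f v x) * l t x ^ b)) = 0)"
    unfolding B_def by (intro allI algebraic_dependence[OF V D f])
  from choice[OF this] obtain K where "\<forall>t. \<exists>w. (\<exists>\<alpha>\<in>exps V (K t). \<exists>b\<le>B. w \<alpha> b \<noteq> 0) \<and>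
    (\<forall>x. (\<Sum>\<alpha>\<in>exps V (K t). \<Sum>b\<le>B. w \<alpha> b * (pwr V \<alpha> (\<lambda>v. f v x) * l t x ^ b)) = 0)" by blast
  from choice[OF this] obtain w where w: "\<And>t. \<exists>\<alpha>\<in>exps V (K t). \<exists>b\<le>B. w t \<alpha> b \<noteq> 0"
    and W: "\<And>t x. (\<Sum>\<alpha>\<in>exps V (K t). \<Sum>b\<le>B. w t \<alpha> b * (pwr V \<alpha> (\<lambda>v. f v x) * l t x ^ b)) = 0"
    by blast
  have "\<forall>t. \<exists>b. b \<le> B \<and> (\<exists>\<alpha>\<in>exps V (K t). w t \<alpha> b \<noteq> 0)"
    using w by blast
  from choice[OF this] obtain b where b: "\<And>t. b t \<le> B" "\<And>t. \<exists>\<alpha>\<in>exps V (K t). w t \<alpha> (b t) \<noteq> 0"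
    by blast
  \<comment> \<open>One more than the bound on the number of parameters spoiled by pairs among
    \<open>B + 1\<close> points.\<close>
  define T where "T = (B + 1) * (B + 1) * card V + 1"
  define U where "U = (\<lambda>t. (K t, \<lambda>\<alpha>. w t \<alpha> (b t))) ` real ` {..<T}"
  show ?thesis unfolding thin_def
  proof (intro exI[of _ U] conjI ballI)
    show "finite U" by (auto simp: U_def)
    show "case z of (K, u) \<Rightarrow> \<exists>\<alpha>\<in>exps V K. u \<alpha> \<noteq> 0" if "z \<in> U" for z
      using that b by (auto simp: U_def)
    fix \<tau>
    let ?F = "{x\<in>RV V. \<forall>v\<in>V. f v x = \<tau> v}"
    assume "\<tau> \<in> {\<tau>. \<not> (finite {x\<in>RV V. \<forall>v\<in>V. f v x = \<tau> v} \<and> card {x\<in>RV V. \<forall>v\<in>V. f v x = \<tau> v} \<le> D ^ card V)}"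
    then have "\<not> (finite ?F \<and> card ?F \<le> B)" by (simp add: B_def)
    then have "\<exists>X\<subseteq>?F. finite X \<and> card X = B + 1"
    proof (cases "finite ?F")
      case True
      then have "B + 1 \<le> card ?F" using \<open>\<not> (finite ?F \<and> card ?F \<le> B)\<close> by auto
      then obtain X where "X \<subseteq> ?F" "card X = B + 1" "finite X"
        using obtain_subset_with_card_n[of "B + 1" ?F] by blast
      then show ?thesis by blast
    next
      case False
      then show ?thesis using infinite_arbitrarily_large[of ?F "B + 1"] by blast
    qed
    then obtain X where X: "X \<subseteq> ?F" "finite X" "card X = B + 1" by blast
    define bad where "bad z = {t. l t (fst z) = l t (snd z)}" for z :: "('a \<Rightarrow> real) \<times> ('a \<Rightarrow> real)"
    have bad: "finite (bad z) \<and> card (bad z) \<le> card V" if "z \<in> X \<times> X - Id" for z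
    proof -
      obtain x y where z: "z = (x, y)" "x \<in> X" "y \<in> X" "x \<noteq> y" using \<open>z \<in> X \<times> X - Id\<close> by (cases z) auto
      then have "x \<in> RV V" "y \<in> RV V" using X by auto
      then obtain v where v: "v \<in> V" "x v \<noteq> y v" using \<open>x \<noteq> y\<close> unfolding RV_def by fastforce
      define p where "p = (\<Sum>v\<in>V. monom (x v - y v) (idx v))"
      have "coeff p (idx v) = (\<Sum>w\<in>V. if w = v then x w - y w else 0)"
        unfolding p_def coeff_sum coeff_monom using idx v by (intro sum.cong) (auto dest: inj_onD)
      then have "coeff p (idx v) \<noteq> 0" using v V by (simp add: sum.delta)
      then have p0: "p \<noteq> 0" by auto
      have "degree p \<le> card V"
        unfolding p_def
      proof (intro degree_sum_le[OF V])
        fix v assume "v \<in> V"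
        then have "idx v < card V" using idx by auto
        then show "degree (monom (x v - y v) (idx v)) \<le> card V"
          using degree_monom_le[of "x v - y v" "idx v"] by linarith
      qed
      have "poly p t = l t x - l t y" for t
        unfolding p_def l_def by (simp add: poly_sum poly_monom sum_subtractf algebra_simps)
      then have "bad z = {t. poly p t = 0}" by (auto simp: bad_def z)
      then show ?thesis using poly_roots_finite[OF p0] card_poly_roots_bound[OF p0] \<open>degree p \<le> card V\<close> by auto
    qed
    let ?bad = "\<Union>z\<in>X \<times> X - Id. bad z"
    have "card ?bad \<le> (\<Sum>z\<in>X \<times> X - Id. card (bad z))"
      using X by (intro card_UN_le) auto
    also have "\<dots> \<le> (\<Sum>z\<in>X \<times> X - Id. card V)" using bad by (intro sum_mono) auto
    also have "\<dots> = card (X \<times> X - Id) * card V" by simp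
    also have "\<dots> \<le> card (X \<times> X) * card V"
      using X by (intro mult_right_mono card_mono) auto
    also have "\<dots> = (B + 1) * (B + 1) * card V" using X by (simp add: card_cartesian_product)
    also have "\<dots> < card (real ` {..<T})" by (simp add: T_def card_image)
    finally have lt: "card ?bad < card (real ` {..<T})" .
    have "finite ?bad" using bad X by auto
    then have "\<not> real ` {..<T} \<subseteq> ?bad" using lt card_mono by (metis not_less)
    then obtain t where t: "t \<in> real ` {..<T}" "t \<notin> ?bad" by blast
    have inj: "inj_on (l t) X"
    proof (intro inj_onI, rule ccontr)
      fix x y assume xy: "x \<in> X" "y \<in> X" "l t x = l t y" "x \<noteq> y"
      then have "(x, y) \<in> X \<times> X - Id" "t \<in> bad (x, y)" by (auto simp: bad_def)
      then show False using t(2) by blast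
    qed
    have "(\<Sum>\<alpha>\<in>exps V (K t). w t \<alpha> (b t) * pwr V \<alpha> \<tau>) = 0"
    proof (rule ccontr)
      assume nz: "(\<Sum>\<alpha>\<in>exps V (K t). w t \<alpha> (b t) * pwr V \<alpha> \<tau>) \<noteq> 0"
      \<comment> \<open>The relation with \<tau> substituted for \<open>f\<close>; the values of
        \<open>l t\<close> on \<open>X\<close> would be \<open>B + 1\<close> distinct roots.\<close>
      define q where "q = (\<Sum>c\<le>B. monom (\<Sum>\<alpha>\<in>exps V (K t). w t \<alpha> c * pwr V \<alpha> \<tau>) c)"
      have "coeff q (b t) = (\<Sum>\<alpha>\<in>exps V (K t). w t \<alpha> (b t) * pwr V \<alpha> \<tau>)"
        unfolding q_def coeff_sum coeff_monom using b by (simp add: sum.delta)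
      then have "q \<noteq> 0" using nz by auto
      have "degree q \<le> B" unfolding q_def by (intro degree_sum_le) (auto intro!: order_trans[OF degree_monom_le])
      have "poly q (l t x) = 0" if "x \<in> X" for x
      proof -
        have "pwr V \<alpha> (\<lambda>v. f v x) = pwr V \<alpha> \<tau>" for \<alpha>
          unfolding pwr_def using that X by (intro prod.cong) auto
        then have "poly q (l t x) = (\<Sum>c\<le>B. \<Sum>\<alpha>\<in>exps V (K t). w t \<alpha> c * (pwr V \<alpha> (\<lambda>v. f v x) * l t x ^ c))"
          unfolding q_def poly_sum poly_monom sum_distrib_right by (simp add: mult.assoc)
        also have "\<dots> = 0" using W[of t x] by (subst sum.swap) simp
        finally show ?thesis .
      qed
      then have "l t ` X \<subseteq> {s. poly q s = 0}" by auto
      then have "card (l t ` X) \<le> B"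
        using card_mono[OF poly_roots_finite[OF \<open>q \<noteq> 0\<close>], of "l t ` X"]
          card_poly_roots_bound[OF \<open>q \<noteq> 0\<close>] \<open>degree q \<le> B\<close> by linarith
      then show False using X card_image[OF inj] by simp
    qed
    moreover have "(K t, \<lambda>\<alpha>. w t \<alpha> (b t)) \<in> U" using t(1) unfolding U_def by blast
    ultimately show "\<exists>(K, u)\<in>U. (\<Sum>\<alpha>\<in>exps V K. u \<alpha> * pwr V \<alpha> \<tau>) = 0"
      by (intro bexI[of _ "(K t, \<lambda>\<alpha>. w t \<alpha> (b t))"]) simp_all
  qed
qed

section \<open>Generic parameters\<close>

text \<open>Nonzero polynomials, by recursion on the variables: slicing and negligibility then reduce to
  the finiteness of roots in one variable.\<close>
fun nzp :: "'v list \<Rightarrow> (('v \<Rightarrow> real) \<Rightarrow> real) \<Rightarrow> bool" where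
  "nzp [] q \<longleftrightarrow> (\<exists>c. c \<noteq> 0 \<and> (\<forall>x. q x = c))"
| "nzp (v # vs) q \<longleftrightarrow> (\<exists>B c. (\<exists>b\<le>B. nzp vs (c b)) \<and> (\<forall>b\<le>B. continuous_on UNIV (c b)) \<and>
     (\<forall>b\<le>B. \<forall>x y. (\<forall>w\<in>set vs. x w = y w) \<longrightarrow> c b x = c b y) \<and> (\<forall>x. q x = (\<Sum>b\<le>B. c b x * x v ^ b)))"

lemma nzp_cong: "nzp vs q \<Longrightarrow> (\<And>w. w \<in> set vs \<Longrightarrow> x w = y w) \<Longrightarrow> q x = q y"
proof (cases vs)
  case (Cons v vs')
  assume a: "nzp vs q" "\<And>w. w \<in> set vs \<Longrightarrow> x w = y w"
  then obtain B c where *: "\<forall>b\<le>B. \<forall>x y. (\<forall>w\<in>set vs'. x w = y w) \<longrightarrow> c b x = c b y" "\<forall>x. q x = (\<Sum>b\<le>B. c b x * x v ^ b)"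
    using Cons by auto
  have "c b x = c b y" if "b \<le> B" for b using *(1) that a(2) Cons by auto
  moreover have "x v = y v" using a(2) Cons by auto
  ultimately show ?thesis using *(2) by simp
qed auto

lemma continuous_on_pwr: "continuous_on A (pwr V \<alpha>)"
  unfolding pwr_def
  by (intro continuous_intros continuous_on_subset[OF continuous_on_product_coordinates]) auto

text \<open>Monomials are sorted by the exponent of the head variable: the term
  \<open>\<alpha>\<close> lands in the coefficient of \<open>x v ^ \<alpha> v\<close> under the
  exponent \<open>\<alpha>(v := 0)\<close>, so that nonvanishing passes to the tail.\<close>

lemma exps_nzp:
  assumes "distinct vs" "\<alpha> \<in> exps (set vs) K" "u \<alpha> \<noteq> 0"
  shows "nzp vs (\<lambda>x. \<Sum>\<alpha>\<in>exps (set vs) K. u \<alpha> * pwr (set vs) \<alpha> x)"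
  using assms
proof (induction vs arbitrary: u \<alpha>)
  case Nil
  have "exps ({} :: 'a set) K = {\<lambda>_. 0}" for K by (auto simp: exps_def)
  from this[of K] show ?case using Nil by (simp add: pwr_def)
next
  case (Cons v vs)
  let ?V = "set vs" and ?W = "insert v (set vs)"
  have v: "v \<notin> ?V" using Cons.prems by simp
  \<comment> \<open>Pairs whose total exceeds \<open>K\<close> get coefficient 0, so that all
    coefficients are summed over the same set \<open>exps ?V K\<close>.\<close>
  define u' where "u' b \<beta> = (if \<beta>(v := b) \<in> exps ?W K then u (\<beta>(v := b)) else 0)" for b and \<beta> :: "'a \<Rightarrow> nat"
  define c where "c b x = (\<Sum>\<beta>\<in>exps ?V K. u' b \<beta> * pwr ?V \<beta> x)" for b x
  have sumv: "sum (\<beta>(v := b)) ?V = sum \<beta> ?V" for \<beta> and b :: nat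
    using v by (intro sum.cong) auto
  have sumv': "sum \<beta> ?W = \<beta> v + sum \<beta> ?V" for \<beta> :: "'a \<Rightarrow> nat"
    using v by simp
  have down: "\<beta>(v := 0) \<in> exps ?V K" if "\<beta> \<in> exps ?W K" for \<beta>
  proof -
    have "sum (\<beta>(v := 0)) ?V \<le> K" unfolding sumv using that sumv'[of \<beta>] by (simp add: exps_def)
    then show ?thesis using that by (auto simp: exps_def)
  qed
  have pw: "pwr ?W (\<beta>(v := b)) x = pwr ?V \<beta> x * x v ^ b" for \<beta> b x
  proof -
    have "pwr ?V (\<beta>(v := b)) x = pwr ?V \<beta> x"
      unfolding pwr_def using v by (intro prod.cong) auto
    then show ?thesis using v by (simp add: pwr_def)
  qed
  have eq: "(\<Sum>\<alpha>\<in>exps ?W K. u \<alpha> * pwr ?W \<alpha> x) = (\<Sum>b\<le>K. c b x * x v ^ b)" for x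
  proof -
    let ?P = "{z \<in> {..K} \<times> exps ?V K. (snd z)(v := fst z) \<in> exps ?W K}"
    have "(\<Sum>b\<le>K. c b x * x v ^ b) = (\<Sum>z\<in>{..K} \<times> exps ?V K. u' (fst z) (snd z) * pwr ?V (snd z) x * x v ^ fst z)"
      by (simp add: c_def sum_distrib_right sum.cartesian_product case_prod_beta)
    also have "\<dots> = (\<Sum>z\<in>?P. u ((snd z)(v := fst z)) * pwr ?W ((snd z)(v := fst z)) x)"
      by (intro sum.mono_neutral_cong_right) (auto simp: u'_def pw)
    also have "\<dots> = (\<Sum>\<alpha>\<in>exps ?W K. u \<alpha> * pwr ?W \<alpha> x)"
    proof (rule sum.reindex_bij_witness[where j = "\<lambda>z. (snd z)(v := fst z)" and i = "\<lambda>\<alpha>. (\<alpha> v, \<alpha>(v := 0))"])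
      fix z assume z: "z \<in> ?P"
      then have "snd z v = 0" using v by (auto simp: exps_def)
      then show "(((snd z)(v := fst z)) v, ((snd z)(v := fst z))(v := 0)) = z"
        by (cases z) (auto simp: fun_eq_iff)
    next
      fix \<alpha> assume \<alpha>: "\<alpha> \<in> exps ?W K"
      then show "(\<alpha> v, \<alpha>(v := 0)) \<in> ?P"
        using down[OF \<alpha>] exps_le[OF _ \<alpha>, of v] by auto
    qed auto
    finally show ?thesis by simp
  qed
  have "nzp vs (c (\<alpha> v))"
    unfolding c_def
  proof (rule Cons.IH)
    show "\<alpha>(v := 0) \<in> exps ?V K" using Cons.prems down by simp
    show "u' (\<alpha> v) (\<alpha>(v := 0)) \<noteq> 0" using Cons.prems by (simp add: u'_def)
  qed (use Cons.prems in simp)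
  moreover have "\<alpha> v \<le> K" using Cons.prems exps_le[of ?W \<alpha> K v] by simp
  moreover have "continuous_on UNIV (c b)" for b
    unfolding c_def by (intro continuous_intros continuous_on_pwr)
  moreover have "c b x = c b y" if "\<forall>w\<in>?V. x w = y w" for b x y
    unfolding c_def pwr_def using that by (intro sum.cong arg_cong2[where f = "(*)"] prod.cong) auto
  ultimately show ?case
    unfolding nzp.simps list.set eq by (intro exI[of _ K] exI[of _ c]) auto
qed

lemma finite_roots_sum:
  fixes c :: "nat \<Rightarrow> real"
  assumes "b \<le> B" "c b \<noteq> 0"
  shows "finite {t. (\<Sum>b\<le>B. c b * t ^ b) = 0}" "card {t. (\<Sum>b\<le>B. c b * t ^ b) = 0} \<le> B"
proof -
  define p where "p = (\<Sum>b\<le>B. monom (c b) b)"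
  have "coeff p b = c b" unfolding p_def coeff_sum coeff_monom using assms by (simp add: sum.delta)
  then have "p \<noteq> 0" using assms by auto
  have "degree p \<le> B" unfolding p_def by (intro degree_sum_le) (auto intro!: order_trans[OF degree_monom_le])
  have "{t. (\<Sum>b\<le>B. c b * t ^ b) = 0} = {t. poly p t = 0}" by (auto simp: p_def poly_sum poly_monom)
  then show "finite {t. (\<Sum>b\<le>B. c b * t ^ b) = 0}" "card {t. (\<Sum>b\<le>B. c b * t ^ b) = 0} \<le> B"
    using poly_roots_finite[OF \<open>p \<noteq> 0\<close>] card_poly_roots_bound[OF \<open>p \<noteq> 0\<close>] \<open>degree p \<le> B\<close> by auto
qed

text \<open>Values are chosen from the last variable of the list to the first: once some coefficient
  of each \<open>q\<close> is nonzero at the later variables, only finitely many values of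
  \<open>v\<close> are forbidden. The infinite sets \<open>A v\<close> serve to make parameters
  small.\<close>

lemma nzp_avoid:
  assumes "distinct vs" "finite Q" "\<And>q. q \<in> Q \<Longrightarrow> nzp vs q" "\<And>v. infinite (A v)"
  shows "\<exists>\<tau>\<in>RV (set vs). (\<forall>v\<in>set vs. \<tau> v \<in> A v) \<and> (\<forall>q\<in>Q. q \<tau> \<noteq> 0)"
  using assms(1-3)
proof (induction vs arbitrary: Q)
  case Nil
  show ?case by (rule bexI[of _ "\<lambda>_. 0"]) (use Nil in \<open>force simp: RV_def\<close>)+
next
  case (Cons v vs)
  have "\<forall>q\<in>Q. \<exists>B c b. b \<le> B \<and> nzp vs (c b) \<and> (\<forall>b\<le>B. \<forall>x y. (\<forall>w\<in>set vs. x w = y w) \<longrightarrow> c b x = c b y) \<and> (\<forall>x. q x = (\<Sum>b\<le>B. c b x * x v ^ b))"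
  proof
    fix q assume "q \<in> Q"
    then have "nzp (v # vs) q" using Cons.prems by blast
    then show "\<exists>B c b. b \<le> B \<and> nzp vs (c b) \<and> (\<forall>b\<le>B. \<forall>x y. (\<forall>w\<in>set vs. x w = y w) \<longrightarrow> c b x = c b y) \<and> (\<forall>x. q x = (\<Sum>b\<le>B. c b x * x v ^ b))"
      unfolding nzp.simps by (elim exE conjE) (intro exI conjI; assumption)
  qed
  from bchoice[OF this] obtain B where "\<forall>q\<in>Q. \<exists>c b. b \<le> B q \<and> nzp vs (c b) \<and> (\<forall>b\<le>B q. \<forall>x y. (\<forall>w\<in>set vs. x w = y w) \<longrightarrow> c b x = c b y) \<and> (\<forall>x. q x = (\<Sum>b\<le>B q. c b x * x v ^ b))" by blast
  from bchoice[OF this] obtain c where "\<forall>q\<in>Q. \<exists>b. b \<le> B q \<and> nzp vs (c q b) \<and> (\<forall>b\<le>B q. \<forall>x y. (\<forall>w\<in>set vs. x w = y w) \<longrightarrow> c q b x = c q b y) \<and> (\<forall>x. q x = (\<Sum>b\<le>B q. c q b x * x v ^ b))" by blast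
  from bchoice[OF this] obtain b where b: "\<forall>q\<in>Q. b q \<le> B q \<and> nzp vs (c q (b q)) \<and> (\<forall>b\<le>B q. \<forall>x y. (\<forall>w\<in>set vs. x w = y w) \<longrightarrow> c q b x = c q b y) \<and> (\<forall>x. q x = (\<Sum>b\<le>B q. c q b x * x v ^ b))" by blast
  have "\<exists>\<tau>\<in>RV (set vs). (\<forall>v\<in>set vs. \<tau> v \<in> A v) \<and> (\<forall>q\<in>(\<lambda>q. c q (b q)) ` Q. q \<tau> \<noteq> 0)"
    using Cons.prems b by (intro Cons.IH) auto
  then obtain \<tau> where \<tau>: "\<tau> \<in> RV (set vs)" "\<forall>v\<in>set vs. \<tau> v \<in> A v" "\<forall>q\<in>Q. c q (b q) \<tau> \<noteq> 0" by blast
  have "finite (\<Union>q\<in>Q. {t. (\<Sum>b\<le>B q. c q b \<tau> * t ^ b) = 0})"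
  proof (rule finite_UN_I)
    show "finite {t. (\<Sum>b\<le>B q. c q b \<tau> * t ^ b) = 0}" if "q \<in> Q" for q
      by (rule finite_roots_sum(1)[of "b q"]) (use \<tau> b that in blast)+
  qed (rule Cons.prems)
  then have "\<not> A v \<subseteq> (\<Union>q\<in>Q. {t. (\<Sum>b\<le>B q. c q b \<tau> * t ^ b) = 0})"
    using assms(4)[of v] finite_subset by blast
  then obtain t where t: "t \<in> A v" "t \<notin> (\<Union>q\<in>Q. {t. (\<Sum>b\<le>B q. c q b \<tau> * t ^ b) = 0})"
    by blast
  have v: "v \<notin> set vs" using Cons.prems by simp
  have "q (\<tau>(v := t)) \<noteq> 0" if "q \<in> Q" for q
  proof -
    have "c q b' (\<tau>(v := t)) = c q b' \<tau>" if "b' \<le> B q" for b'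
    proof -
      have "\<forall>w\<in>set vs. (\<tau>(v := t)) w = \<tau> w" using v by auto
      then show ?thesis using b \<open>q \<in> Q\<close> that by blast
    qed
    then have "q (\<tau>(v := t)) = (\<Sum>b\<le>B q. c q b \<tau> * t ^ b)"
      using b \<open>q \<in> Q\<close> by (auto intro!: sum.cong)
    then show ?thesis using t that by auto
  qed
  moreover have "\<tau>(v := t) \<in> RV (set (v # vs))" "\<forall>w\<in>set (v # vs). (\<tau>(v := t)) w \<in> A w"
    using \<tau> t by (auto simp: RV_def)
  ultimately show ?case by blast
qed

text \<open>Arbitrarily many translates of a bounded piece along \<open>e\<close> fit in one ball
  and overlap at most \<open>P\<close> times, which forces measure zero. This takes the place of
  Fubini's theorem.\<close>

lemma negligible_finite_on_lines:
  fixes L :: "'a::euclidean_space set"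
  assumes L: "L \<in> sets borel" and fin: "\<And>y. finite {t::real. y + t *\<^sub>R e \<in> L} \<and> card {t::real. y + t *\<^sub>R e \<in> L} \<le> P"
  shows "negligible L"
proof -
  have "negligible (L \<inter> cball 0 (real n))" for n
  proof -
    define S where "S = L \<inter> cball 0 (real n)"
    have S: "S \<in> sets borel" using L by (auto simp: S_def)
    define C where "C = cball (0::'a) (real n + norm e)"
    have trans: "(\<integral>\<^sup>+y. indicator S (a + y) \<partial>lborel) = emeasure lborel S" for a :: 'a
    proof -
      have "emeasure lborel S = (\<integral>\<^sup>+y. indicator S y \<partial>distr lborel borel ((+) a))"
        using S by (simp add: lborel_distr_plus)
      also have "\<dots> = (\<integral>\<^sup>+y. indicator S (a + y) \<partial>lborel)"
        using S by (intro nn_integral_distr) auto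
      finally show ?thesis by simp
    qed
    have J: "of_nat J * emeasure lborel S \<le> of_nat P * emeasure lborel C" for J
    proof -
      \<comment> \<open>Distinct shifts in (0, 1], so that all translates stay in
        \<open>C\<close>.\<close>
      let ?t = "\<lambda>j::nat. 1 / real (Suc j)"
      have pt: "(\<Sum>j<J. indicator S (?t j *\<^sub>R e + y)) \<le> of_nat P * (indicator C y :: ennreal)" for y
      proof (cases "y \<in> C")
        case True
        have "(\<Sum>j<J. indicator S (?t j *\<^sub>R e + y) :: ennreal) = of_nat (card {j\<in>{..<J}. ?t j *\<^sub>R e + y \<in> S})"
          by (simp add: indicator_def sum.If_cases Int_def)
        also have "card {j\<in>{..<J}. ?t j *\<^sub>R e + y \<in> S} \<le> card {t::real. y + t *\<^sub>R e \<in> L}"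
          by (rule card_inj_on_le[where f = ?t]) (use fin[of y] in \<open>auto simp: inj_on_def S_def add.commute\<close>)
        also have "\<dots> \<le> P" using fin by blast
        finally show ?thesis using True by (simp add: of_nat_mono)
      next
        case False
        have "?t j *\<^sub>R e + y \<notin> S" for j
        proof
          assume "?t j *\<^sub>R e + y \<in> S"
          then have "norm (?t j *\<^sub>R e + y) \<le> real n" by (simp add: S_def)
          moreover have "norm (?t j *\<^sub>R e) \<le> norm e"
            by (simp add: divide_le_eq mult_le_cancel_left1)
          moreover have "norm y \<le> norm (?t j *\<^sub>R e + y) + norm (?t j *\<^sub>R e)"
            by (metis add.commute norm_minus_commute norm_triangle_sub add_diff_cancel_left' add_diff_cancel_right')
          ultimately show False using False by (simp add: C_def)
        qed
        then show ?thesis by simp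
      qed
      have "of_nat J * emeasure lborel S = (\<Sum>j<J. \<integral>\<^sup>+y. indicator S (?t j *\<^sub>R e + y) \<partial>lborel)"
        by (simp add: trans)
      also have "\<dots> = (\<integral>\<^sup>+y. (\<Sum>j<J. indicator S (?t j *\<^sub>R e + y)) \<partial>lborel)"
      proof (rule nn_integral_sum[symmetric])
        have "(\<lambda>y. a + y) \<in> measurable lborel borel" "(indicator S :: 'a \<Rightarrow> ennreal) \<in> borel_measurable borel" for a :: 'a
          using S by auto
        then show "(\<lambda>y. indicator S (?t j *\<^sub>R e + y) :: ennreal) \<in> borel_measurable lborel" for j
          by (rule measurable_compose)
      qed
      also have "\<dots> \<le> (\<integral>\<^sup>+y. of_nat P * indicator C y \<partial>lborel)"
        by (intro nn_integral_mono pt)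
      also have "\<dots> = of_nat P * emeasure lborel C"
        by (intro nn_integral_cmult_indicator) (auto simp: C_def)
      finally show ?thesis .
    qed
    have finC: "emeasure lborel C < \<infinity>" unfolding C_def by (intro emeasure_bounded_finite) auto
    have finS: "emeasure lborel S < \<infinity>" unfolding S_def by (intro emeasure_bounded_finite) auto
    obtain s c where sc: "emeasure lborel S = ennreal s" "0 \<le> s" "emeasure lborel C = ennreal c" "0 \<le> c"
      using finS finC by (metis ennreal_cases less_irrefl infinity_ennreal_def)
    have "real J * s \<le> real P * c" for J
      using J[of J] sc by (simp add: ennreal_of_nat_eq_real_of_nat ennreal_mult'[symmetric])
    then have "s \<le> 0" using reals_Archimedean3[of s] by (meson not_less)
    then have "emeasure lborel S = 0" using sc by simp
    then have "S \<in> null_sets lborel" using S by (simp add: null_setsI)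
    then have "S \<in> null_sets lebesgue" using null_sets_completionI by blast
    then show ?thesis by (simp add: negligible_iff_null_sets S_def)
  qed
  then have "negligible (\<Union>n. L \<inter> cball 0 (real n))" by (intro negligible_countable_Union) auto
  moreover have "(\<Union>n. L \<inter> cball 0 (real n)) = L"
    using real_arch_simple by (auto simp: mem_cball)
  ultimately show ?thesis by simp
qed

section \<open>Parameters split into fixed ones and a free slice\<close>

definition emb :: "('k \<Rightarrow> 'v) \<Rightarrow> ('v \<Rightarrow> real) \<Rightarrow> real ^ 'k \<Rightarrow> 'v \<Rightarrow> real" where
  "emb N \<tau> y v = (if v \<in> range N then y $ inv N v else \<tau> v)"

lemma emb_N: "inj N \<Longrightarrow> emb N \<tau> y (N k) = y $ k"
  by (simp add: emb_def)

lemma emb_notin: "v \<notin> range N \<Longrightarrow> emb N \<tau> y v = \<tau> v"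
  by (simp add: emb_def)

lemma continuous_on_emb: "continuous_on A (emb N \<tau>)"
proof (rule continuous_on_coordinatewise_then_product)
  show "continuous_on A (\<lambda>y. emb N \<tau> y v)" for v
    by (cases "v \<in> range N") (simp_all add: emb_def continuous_on_component continuous_on_id)
qed

text \<open>The variables of the slice stand first in the list and are peeled off one by one;
  \<open>q'\<close> is the coefficient left over, which depends on the other parameters only. Where
  the coefficient \<open>c b\<close> does not vanish, lines in the direction of \<open>v\<close>
  meet the zero set in at most \<open>B\<close> points.\<close>

lemma nzp_slice:
  fixes N :: "'k::finite \<Rightarrow> 'v"
  assumes N: "inj N" and "distinct (ns @ vs)" "set ns \<subseteq> range N" and vs: "set vs \<inter> range N = {}"
    and "nzp (ns @ vs) q"
  shows "\<exists>q'. nzp vs q' \<and> (\<forall>\<tau>. q' \<tau> \<noteq> 0 \<longrightarrow> negligible {y. q (emb N \<tau> y) = 0})"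
  using assms(2,3,5)
proof (induction ns arbitrary: q)
  case Nil
  have "q (emb N \<tau> y) = q \<tau>" for \<tau> y
    by (rule nzp_cong[of vs]) (use Nil vs in \<open>auto intro!: emb_notin\<close>)
  then show ?case using Nil by (intro exI[of _ q]) auto
next
  case (Cons v ns)
  obtain k where k: "v = N k" using Cons.prems by auto
  obtain B c b where b: "b \<le> B" "nzp (ns @ vs) (c b)" and cont: "\<And>b. b \<le> B \<Longrightarrow> continuous_on UNIV (c b)"
    and dep: "\<And>b x y. b \<le> B \<Longrightarrow> (\<forall>w\<in>set (ns @ vs). x w = y w) \<Longrightarrow> c b x = c b y"
    and q: "\<And>x. q x = (\<Sum>b\<le>B. c b x * x v ^ b)"
    using Cons.prems(3) unfolding append_Cons nzp.simps by blast
  obtain q' where q': "nzp vs q'" "\<And>\<tau>. q' \<tau> \<noteq> 0 \<Longrightarrow> negligible {y. c b (emb N \<tau> y) = 0}"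
    using Cons.IH[of "c b"] Cons.prems b by auto
  have "negligible {y. q (emb N \<tau> y) = 0}" if "q' \<tau> \<noteq> 0" for \<tau>
  proof -
    define L where "L = {y. q (emb N \<tau> y) = 0 \<and> c b (emb N \<tau> y) \<noteq> 0}"
    have cq: "continuous_on UNIV q"
      unfolding q by (intro continuous_intros cont continuous_on_subset[OF continuous_on_product_coordinates]) auto
    have comp: "continuous_on UNIV (\<lambda>y. g (emb N \<tau> y))" if "continuous_on UNIV g" for g :: "('v \<Rightarrow> real) \<Rightarrow> real"
      by (rule continuous_on_compose2[OF that continuous_on_emb]) auto
    have m: "(\<lambda>y. q (emb N \<tau> y)) \<in> borel_measurable borel" "(\<lambda>y. c b (emb N \<tau> y)) \<in> borel_measurable borel"
      using comp[OF cq] comp[OF cont[OF b(1)]] by (auto intro: borel_measurable_continuous_onI)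
    have "negligible L"
    proof (rule negligible_finite_on_lines[where e = "axis k 1" and P = B])
      show "L \<in> sets borel" unfolding L_def using m by measurable
      fix y
      have e: "emb N \<tau> (y + t *\<^sub>R axis k 1) v = y $ k + t" for t
        using N by (simp add: k emb_N)
      have "emb N \<tau> (y + t *\<^sub>R axis k 1) w = emb N \<tau> y w" if "w \<noteq> v" for t w
        using N that by (auto simp: k emb_def axis_def)
      then have c: "c b (emb N \<tau> (y + t *\<^sub>R axis k 1)) = c b (emb N \<tau> y)" if "b \<le> B" for b t
        using Cons.prems(1) that by (intro dep ballI that) (metis \<open>\<And>w t. w \<noteq> v \<Longrightarrow> emb N \<tau> (y + t *\<^sub>R axis k 1) w = emb N \<tau> y w\<close> append_Cons distinct.simps(2))
      let ?T = "{t. y + t *\<^sub>R axis k 1 \<in> L}"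
      show "finite ?T \<and> card ?T \<le> B"
      proof (cases "c b (emb N \<tau> y) = 0")
        case True
        then have "?T = {}" using c[OF b(1)] by (auto simp: L_def)
        then show ?thesis by simp
      next
        case False
        let ?R = "{t. (\<Sum>b\<le>B. c b (emb N \<tau> y) * t ^ b) = 0}"
        have R: "finite ?R" "card ?R \<le> B" using finite_roots_sum[OF b(1), of "\<lambda>b. c b (emb N \<tau> y)"] False by auto
        have sub: "(\<lambda>t. y $ k + t) ` ?T \<subseteq> ?R"
          using c e by (auto simp: L_def q)
        have inj: "inj_on (\<lambda>t. y $ k + t) ?T" by (auto simp: inj_on_def)
        show ?thesis
          using inj_on_finite[OF inj sub R(1)] card_inj_on_le[OF inj sub R(1)] R(2) by auto
      qed
    qed
    then have "negligible (L \<union> {y. c b (emb N \<tau> y) = 0})" using q'(2)[OF that] by (intro negligible_Un)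
    then show ?thesis by (rule negligible_subset) (auto simp: L_def)
  qed
  then show ?case using q'(1) by blast
qed

text \<open>The curve must be fixed before targets or coordinate values vary. So the parameters in
  \<open>V\<close> are chosen once, in such a way that almost every value of the free ones is
  generic; a generic choice of all parameters together would not provide this.\<close>

lemma generic_slice:
  fixes N :: "'k::finite \<Rightarrow> 'v"
  assumes V: "finite V" and N: "inj N" "V \<inter> range N = {}" and Z: "thin (V \<union> range N) Z" and A: "\<And>v. infinite (A v)"
  shows "\<exists>\<tau>\<in>RV V. (\<forall>v\<in>V. \<tau> v \<in> A v) \<and> negligible {y. emb N \<tau> y \<in> Z}"
proof -
  obtain U where U: "finite U" "\<forall>(K, u)\<in>U. \<exists>\<alpha>\<in>exps (V \<union> range N) K. u \<alpha> \<noteq> 0"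
    "\<forall>\<tau>\<in>Z. \<exists>(K, u)\<in>U. (\<Sum>\<alpha>\<in>exps (V \<union> range N) K. u \<alpha> * pwr (V \<union> range N) \<alpha> \<tau>) = 0"
    using Z unfolding thin_def by blast
  obtain vs where vs: "set vs = V" "distinct vs" using V finite_distinct_list by blast
  obtain ns where ns: "set ns = range N" "distinct ns" using finite_distinct_list[of "range N"] by auto
  define ev where "ev z x = (\<Sum>\<alpha>\<in>exps (V \<union> range N) (fst z). snd z \<alpha> * pwr (V \<union> range N) \<alpha> x)"
    for z :: "nat \<times> (('v \<Rightarrow> nat) \<Rightarrow> real)" and x
  have set: "set (ns @ vs) = V \<union> range N" using vs ns by auto
  have dist: "distinct (ns @ vs)" using vs ns N by auto
  have "\<forall>z\<in>U. \<exists>q'. nzp vs q' \<and> (\<forall>\<tau>. q' \<tau> \<noteq> 0 \<longrightarrow> negligible {y. ev z (emb N \<tau> y) = 0})"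
  proof
    fix z assume "z \<in> U"
    then obtain \<alpha> where "\<alpha> \<in> exps (V \<union> range N) (fst z)" "snd z \<alpha> \<noteq> 0" using U(2) by (cases z) auto
    then have "nzp (ns @ vs) (ev z)"
      using exps_nzp[OF dist, of \<alpha> "fst z" "snd z"] unfolding set ev_def by blast
    then show "\<exists>q'. nzp vs q' \<and> (\<forall>\<tau>. q' \<tau> \<noteq> 0 \<longrightarrow> negligible {y. ev z (emb N \<tau> y) = 0})"
      using N dist ns vs by (intro nzp_slice) auto
  qed
  from bchoice[OF this] obtain q' where q': "\<forall>z\<in>U. nzp vs (q' z) \<and> (\<forall>\<tau>. q' z \<tau> \<noteq> 0 \<longrightarrow> negligible {y. ev z (emb N \<tau> y) = 0})" by blast
  have "\<exists>\<tau>\<in>RV (set vs). (\<forall>v\<in>set vs. \<tau> v \<in> A v) \<and> (\<forall>q\<in>q' ` U. q \<tau> \<noteq> 0)"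
    using vs U q' A by (intro nzp_avoid) auto
  then obtain \<tau> where \<tau>: "\<tau> \<in> RV V" "\<forall>v\<in>V. \<tau> v \<in> A v" "\<forall>z\<in>U. q' z \<tau> \<noteq> 0" using vs by auto
  have "negligible (\<Union>z\<in>U. {y. ev z (emb N \<tau> y) = 0})"
    using U(1) q' \<tau> by (intro negligible_Union) auto
  moreover have "{y. emb N \<tau> y \<in> Z} \<subseteq> (\<Union>z\<in>U. {y. ev z (emb N \<tau> y) = 0})"
    using U(3) by (fastforce simp: ev_def)
  ultimately show ?thesis using \<tau> negligible_subset by blast
qed

lemma generic_point:
  assumes V: "finite V" and Z: "thin V Z" and A: "\<And>v. infinite (A v)"
  shows "\<exists>\<tau>\<in>RV V. (\<forall>v\<in>V. \<tau> v \<in> A v) \<and> \<tau> \<notin> Z"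
proof -
  obtain U where U: "finite U" "\<forall>(K, u)\<in>U. \<exists>\<alpha>\<in>exps V K. u \<alpha> \<noteq> 0"
    "\<forall>\<tau>\<in>Z. \<exists>(K, u)\<in>U. (\<Sum>\<alpha>\<in>exps V K. u \<alpha> * pwr V \<alpha> \<tau>) = 0"
    using Z unfolding thin_def by blast
  obtain vs where vs: "set vs = V" "distinct vs" using V finite_distinct_list by blast
  define ev where "ev z x = (\<Sum>\<alpha>\<in>exps V (fst z). snd z \<alpha> * pwr V \<alpha> x)"
    for z :: "nat \<times> (('a \<Rightarrow> nat) \<Rightarrow> real)" and x
  have "\<exists>\<tau>\<in>RV (set vs). (\<forall>v\<in>set vs. \<tau> v \<in> A v) \<and> (\<forall>q\<in>ev ` U. q \<tau> \<noteq> 0)"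
  proof (rule nzp_avoid)
    fix q assume "q \<in> ev ` U"
    then obtain z where z: "z \<in> U" "q = ev z" by blast
    then obtain \<alpha> where "\<alpha> \<in> exps V (fst z)" "snd z \<alpha> \<noteq> 0" using U(2) by (cases z) auto
    then show "nzp vs q"
      using exps_nzp[OF vs(2), of \<alpha> "fst z" "snd z"] z unfolding vs ev_def by blast
  qed (use vs U A in auto)
  then obtain \<tau> where \<tau>: "\<tau> \<in> RV V" "\<forall>v\<in>V. \<tau> v \<in> A v" "\<forall>z\<in>U. ev z \<tau> \<noteq> 0" using vs by auto
  have "\<tau> \<notin> Z" using U(3) \<tau>(3) by (fastforce simp: ev_def)
  then show ?thesis using \<tau> by blast
qed

section \<open>Components of images of zero sets\<close>

text \<open>A component meets some piece, contains it because the piece is connected, and cannot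
  leave it because the other pieces together form a closed set. It is used contrapositively, to find
  a disconnected piece.\<close>

lemma card_components_le:
  assumes "finite \<P>" "\<Union>\<P> = A" "pairwise disjnt \<P>"
    and conn: "\<And>B. B \<in> \<P> \<Longrightarrow> connected B \<and> closed B \<and> B \<noteq> {}"
  shows "finite (components A) \<and> card (components A) \<le> card \<P>"
proof -
  have "components A \<subseteq> \<P>"
  proof
    fix C assume C: "C \<in> components A"
    then obtain x where x: "x \<in> C" using in_components_nonempty by blast
    then obtain B where B: "B \<in> \<P>" "x \<in> B" using C in_components_subset assms(2) by blast
    have "B \<subseteq> A" using B assms by blast
    then have BC: "B \<subseteq> C" using components_maximal[OF C] conn[OF B(1)] B x by blast
    have "connected C" "C \<subseteq> A" using C in_components_connected in_components_subset by blast+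
    have "closed (\<Union>(\<P> - {B}))" using assms(1) conn by (intro closed_Union) auto
    moreover have "closed B" using conn B by blast
    moreover have "B \<inter> \<Union>(\<P> - {B}) \<inter> C = {}"
      using assms(3) B unfolding pairwise_def disjnt_def by blast
    moreover have "C \<subseteq> B \<union> \<Union>(\<P> - {B})" using \<open>C \<subseteq> A\<close> assms(2) by blast
    ultimately have "B \<inter> C = {} \<or> \<Union>(\<P> - {B}) \<inter> C = {}"
      using connected_closedD[OF \<open>connected C\<close>, of B "\<Union>(\<P> - {B})"] by blast
    then have "C \<subseteq> B" using B x \<open>C \<subseteq> B \<union> \<Union>(\<P> - {B})\<close> by blast
    then show "C \<in> \<P>" using BC B by auto
  qed
  then show ?thesis using assms(1) finite_subset card_mono by blast
qed

text \<open>As long as there are too many components, some piece is disconnected and splits into two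
  closed ones. Closed pieces replace components, which need not be relatively open when there are
  infinitely many.\<close>

lemma closed_partition:
  assumes "closed A" "A \<noteq> {}" "\<not> (finite (components A) \<and> card (components A) \<le> k)"
  shows "\<exists>\<P>. finite \<P> \<and> card \<P> = Suc k \<and> \<Union>\<P> = A \<and> pairwise disjnt \<P> \<and> (\<forall>B\<in>\<P>. closed B \<and> B \<noteq> {})"
  using assms(3)
proof (induction k)
  case 0
  show ?case by (rule exI[of _ "{A}"]) (use assms in auto)
next
  case (Suc k)
  then have "\<not> (finite (components A) \<and> card (components A) \<le> k)" by auto
  then obtain \<P> where P: "finite \<P>" "card \<P> = Suc k" "\<Union>\<P> = A" "pairwise disjnt \<P>" "\<forall>B\<in>\<P>. closed B \<and> B \<noteq> {}"
    using Suc.IH by blast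
  have "\<not> (\<forall>B\<in>\<P>. connected B)"
  proof
    assume "\<forall>B\<in>\<P>. connected B"
    then have "finite (components A) \<and> card (components A) \<le> card \<P>"
      using P(5) by (intro card_components_le[OF P(1,3,4)]) auto
    then show False using P(2) Suc.prems by simp
  qed
  then obtain B where B: "B \<in> \<P>" "\<not> connected B" by blast
  then have "closed B" using P by blast
  then obtain B1 B2 where B12: "closed B1" "closed B2" "B1 \<noteq> {}" "B2 \<noteq> {}" "B1 \<union> B2 = B" "B1 \<inter> B2 = {}"
    using B(2) unfolding connected_closed_set[OF \<open>closed B\<close>] by auto
  let ?Q = "insert B1 (insert B2 (\<P> - {B}))"
  have dis: "disjnt B' X" if "X \<in> \<P> - {B}" "B' \<subseteq> B" for X B'
    using that P(4) B unfolding pairwise_def disjnt_def by blast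
  have "B1 \<notin> insert B2 (\<P> - {B})" "B2 \<notin> \<P> - {B}"
    using dis[of B1 B1] dis[of B2 B2] B12 by (auto simp: disjnt_def)
  then have "card ?Q = Suc (Suc k)" using P B by (simp add: card_Diff_singleton)
  moreover have "pairwise disjnt ?Q"
  proof -
    have "pairwise disjnt (\<P> - {B})" using P(4) by (rule pairwise_subset) auto
    moreover have "disjnt B1 B2" "disjnt B2 B1" using B12 by (auto simp: disjnt_def)
    moreover have "disjnt B1 X \<and> disjnt X B1 \<and> disjnt B2 X \<and> disjnt X B2" if "X \<in> \<P> - {B}" for X
      using dis[OF that] B12(5) by (meson disjnt_sym sup_ge1 sup_ge2 subset_refl order_trans)
    ultimately show ?thesis unfolding pairwise_insert by blast
  qed
  moreover have "\<Union>?Q = A" using P(3) B(1) B12(5) by blast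
  moreover have "finite ?Q" using P by simp
  moreover have "\<forall>B\<in>?Q. closed B \<and> B \<noteq> {}" using P(5) B12 by blast
  ultimately show ?case by blast
qed

definition boxV :: "'v set \<Rightarrow> real \<Rightarrow> ('v \<Rightarrow> real) set" where
  "boxV V R = {x\<in>RV V. \<forall>v\<in>V. \<bar>x v\<bar> \<le> R}"

lemma compact_boxV: "compact (boxV V R)"
proof -
  have "compactin (product_topology (\<lambda>_. euclidean) (UNIV::'a set)) (PiE UNIV (\<lambda>v. if v \<in> V then {-R..R} else {0}))"
    unfolding compactin_PiE by auto
  moreover have "PiE UNIV (\<lambda>v. if v \<in> V then {-R..R} else {0}) = boxV V R"
    by (auto simp: boxV_def RV_def PiE_def Pi_def abs_le_iff split: if_splits) (force+)?
  ultimately show ?thesis by (simp add: euclidean_product_topology)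
qed

lemma continuous_on_upd: "continuous_on A (\<lambda>t. x(v := t))"
proof (rule continuous_on_coordinatewise_then_product)
  show "continuous_on A (\<lambda>t. (x(v := t)) w)" for w
    by (cases "w = v") (auto intro: continuous_intros)
qed

text \<open>Perturbing \<open>h\<close> by a small linear form with generic coefficients \<open>\<tau>\<close> creates a local minimum near
  each piece of a partition of the zero set, and the equations \<open>pd v h = \<tau> v\<close> have few solutions.\<close>
lemma components_bound:
  fixes h :: "('v::countable \<Rightarrow> real) \<Rightarrow> real" and q :: "('v \<Rightarrow> real) \<Rightarrow> 'b::euclidean_space"
  assumes V: "finite V" and D: "1 \<le> D" and h: "polyf V D h" and nonneg: "\<And>x. x \<in> RV V \<Longrightarrow> 0 \<le> h x"
    and bd: "\<And>x v. x \<in> RV V \<Longrightarrow> h x = 0 \<Longrightarrow> v \<in> V \<Longrightarrow> \<bar>x v\<bar> < R"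
    and q: "continuous_on UNIV q"
  shows "b0 (q ` {x\<in>RV V. h x = 0}) \<le> of_nat (D ^ card V)"
proof -
  let ?K = "{x\<in>RV V. h x = 0}"
  let ?A = "q ` ?K"
  have ch: "continuous_on A h" for A using h by (rule polyf_continuous)
  have K: "?K = boxV V R \<inter> h -` {0}" using bd by (auto simp: boxV_def intro: less_imp_le)
  have "compact ?K"
    unfolding K by (intro compact_Int_closed compact_boxV closed_vimage closed_singleton ch)
  then have "compact ?A" using q continuous_on_subset by (intro compact_continuous_image) blast+
  have "finite (components ?A) \<and> card (components ?A) \<le> D ^ card V"
  proof (rule ccontr)
    assume neg: "\<not> ?thesis"
    have "?A \<noteq> {}" using neg by (intro notI) simp
    then obtain \<P> where P: "finite \<P>" "card \<P> = Suc (D ^ card V)" "\<Union>\<P> = ?A" "pairwise disjnt \<P>"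
      "\<forall>B\<in>\<P>. closed B \<and> B \<noteq> {}"
      using closed_partition[OF compact_imp_closed[OF \<open>compact ?A\<close>] _ neg] by blast
    \<comment> \<open>Compactness separates each piece from the union of the others; neighbourhoods
      of half the distance are then disjoint.\<close>
    have "\<forall>B\<in>\<P>. \<exists>e>0. \<forall>x\<in>B. \<forall>y\<in>\<Union>(\<P> - {B}). e \<le> dist x y"
    proof
      fix B assume B: "B \<in> \<P>"
      then have "B \<subseteq> ?A" using P by blast
      have "closed (\<Union>(\<P> - {B}))" using P by (intro closed_Union) auto
      moreover have "compact B" using P B \<open>B \<subseteq> ?A\<close> \<open>compact ?A\<close> by (metis compact_Int_closed inf.absorb2)
      moreover have "B \<inter> \<Union>(\<P> - {B}) = {}" using P(4) B unfolding pairwise_def disjnt_def by blast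
      ultimately show "\<exists>e>0. \<forall>x\<in>B. \<forall>y\<in>\<Union>(\<P> - {B}). e \<le> dist x y"
        using separate_compact_closed by metis
    qed
    from bchoice[OF this] obtain e where e: "\<forall>B\<in>\<P>. 0 < e B \<and> (\<forall>x\<in>B. \<forall>y\<in>\<Union>(\<P> - {B}). e B \<le> dist x y)" by blast
    define U where "U B = (\<Union>x\<in>B. ball x (e B / 2))" for B
    have Udisj: "U B \<inter> U B' = {}" if B: "B \<in> \<P>" "B' \<in> \<P>" "B \<noteq> B'" for B B'
    proof (rule ccontr)
      assume "\<not> ?thesis"
      then obtain x y z where xyz: "x \<in> B" "y \<in> B'" "dist x z < e B / 2" "dist y z < e B' / 2"
        unfolding U_def by auto
      have "y \<in> \<Union>(\<P> - {B})" "x \<in> \<Union>(\<P> - {B'})" using B xyz by auto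
      then have "e B \<le> dist x y" "e B' \<le> dist y x" using e B xyz by blast+
      moreover have "dist x y < e B / 2 + e B' / 2" using xyz dist_triangle2[of x y z] by linarith
      ultimately show False using dist_commute[of x y] by linarith
    qed
    have BU: "B \<subseteq> U B" if "B \<in> \<P>" for B using e that unfolding U_def by force
    \<comment> \<open>Strictly beyond the bound \<open>R\<close>, so that zeros of \<open>h\<close>
      are interior to the box and minima near them are free critical points.\<close>
    define S where "S = \<bar>R\<bar> + 1"
    define W where "W B = {x. q x \<in> U B} \<inter> (\<Inter>v\<in>V. {x. \<bar>x v\<bar> < S})" for B
    have openW: "open (W B)" for B
    proof -
      have "open (U B)" by (auto simp: U_def)
      then have "open (q -` U B)" using q by (simp add: continuous_on_open_vimage)
      moreover have "open {x :: 'v \<Rightarrow> real. \<bar>x v\<bar> < S}" for v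
        by (intro open_Collect_less continuous_intros continuous_on_subset[OF continuous_on_product_coordinates]) auto
      ultimately show ?thesis unfolding W_def vimage_def using V by (intro open_Int open_INT) auto
    qed
    have Wdisj: "W B \<inter> W B' = {}" if "B \<in> \<P>" "B' \<in> \<P>" "B \<noteq> B'" for B B'
      using Udisj[OF that] unfolding W_def by blast
    have KS: "x \<in> boxV V S" "v \<in> V \<Longrightarrow> \<bar>x v\<bar> < S" if "x \<in> ?K" for x v
      using bd that by (force simp: boxV_def S_def)+
    have KW: "x \<in> W B" if "x \<in> ?K" "q x \<in> B" "B \<in> \<P>" for x B
      using that KS(2)[OF that(1)] BU[OF that(3)] by (auto simp: W_def)
    \<comment> \<open>Away from the neighbourhoods \<open>W B\<close>, \<open>h\<close> is positive
      on a compact set, hence bounded below by some \<delta>.\<close>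
    define C where "C = boxV V S - (\<Union>B\<in>\<P>. W B)"
    have compC: "compact C" unfolding C_def by (intro compact_diff compact_boxV open_UN ballI openW)
    have posC: "0 < h x" if "x \<in> C" for x
    proof -
      have "x \<in> RV V" using that by (auto simp: C_def boxV_def)
      moreover have "h x \<noteq> 0"
      proof
        assume "h x = 0"
        then have "x \<in> ?K" using \<open>x \<in> RV V\<close> by simp
        moreover then obtain B where "B \<in> \<P>" "q x \<in> B" using P(3) by blast
        ultimately show False using KW that by (auto simp: C_def)
      qed
      ultimately show ?thesis using nonneg[of x] by linarith
    qed
    obtain \<delta> where \<delta>: "0 < \<delta>" "\<And>x. x \<in> C \<Longrightarrow> \<delta> \<le> h x"
    proof (cases "C = {}")
      case False
      then obtain x where "x \<in> C" "\<forall>y\<in>C. h x \<le> h y"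
        using continuous_attains_inf[OF compC False ch] by blast
      then show ?thesis using posC that by blast
    qed (use that[of 1] in auto)
    \<comment> \<open>Chosen so that the linear form stays below \<open>\<delta> / 2\<close> on the
      box.\<close>
    define \<eta> where "\<eta> = \<delta> / 2 / ((real (card V) + 1) * S)"
    have S: "0 < S" by (simp add: S_def)
    have \<eta>: "0 < \<eta>" using \<delta> S by (simp add: \<eta>_def)
    have "\<exists>\<tau>\<in>RV V. (\<forall>v\<in>V. \<tau> v \<in> {0<..<\<eta>}) \<and> \<tau> \<notin> {\<tau>. \<not> (finite {x\<in>RV V. \<forall>v\<in>V. pd v h x = \<tau> v} \<and>
      card {x\<in>RV V. \<forall>v\<in>V. pd v h x = \<tau> v} \<le> D ^ card V)}"
      using \<eta> by (intro generic_point[OF V] generic_fibre[OF V D] polyf_pd[OF h]) (auto simp: infinite_Ioo)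
    then obtain \<tau> where \<tau>: "\<And>v. v \<in> V \<Longrightarrow> 0 < \<tau> v \<and> \<tau> v < \<eta>"
      and fib: "finite {x\<in>RV V. \<forall>v\<in>V. pd v h x = \<tau> v}" "card {x\<in>RV V. \<forall>v\<in>V. pd v h x = \<tau> v} \<le> D ^ card V"
      by auto
    define l where "l x = (\<Sum>v\<in>V. - \<tau> v * x v)" for x
    define g where "g x = h x + l x" for x
    have l: "polyf V D l" unfolding l_def using D by (intro polyf_sum polyf_cmult polyf_var') auto
    have g: "polyf V D g" unfolding g_def using h l by (intro polyf_add)
    have "pd v l = (\<lambda>x. - \<tau> v)" if "v \<in> V" for v
    proof -
      have "pd v l = (\<lambda>x. \<Sum>w\<in>V. pd v (\<lambda>x. - \<tau> w * x w) x)"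
        unfolding l_def by (intro pd_sum[of V V D] polyf_cmult polyf_var' D)
      also have "\<dots> = (\<lambda>x. \<Sum>w\<in>V. if w = v then - \<tau> v else 0)"
        by (intro ext sum.cong refl, subst pd_cmult[of V 1]) (auto intro: polyf_var' simp: pd_var)
      finally show ?thesis using that V by (simp add: sum.delta)
    qed
    then have pdg: "pd v g x = pd v h x - \<tau> v" if "v \<in> V" for v x
      unfolding g_def pd_add[OF h l] using that by simp
    have lb: "\<bar>l x\<bar> < \<delta> / 2" if "x \<in> boxV V S" for x
    proof -
      have "\<bar>l x\<bar> \<le> (\<Sum>v\<in>V. \<bar>- \<tau> v * x v\<bar>)" unfolding l_def by (rule sum_abs)
      also have "\<dots> \<le> (\<Sum>v\<in>V. \<eta> * S)"
        using that \<tau> S \<eta> by (intro sum_mono) (force simp: abs_mult boxV_def intro!: mult_mono)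
      also have "\<dots> = real (card V) * (\<eta> * S)" by simp
      also have "\<dots> < (real (card V) + 1) * (\<eta> * S)" using \<eta> S by (intro mult_strict_right_mono) auto
      also have "\<dots> = \<eta> * ((real (card V) + 1) * S)" by (simp only: mult_ac)
    also have "\<dots> = \<delta> / 2"
    proof -
      have "(real (card V) + 1) * S \<noteq> 0" using S by simp
      then show ?thesis unfolding \<eta>_def by (rule nonzero_eq_divide_eq[THEN iffD1, OF _ refl])
    qed
      finally show ?thesis .
    qed
    have "\<exists>x. x \<in> W B \<and> x \<in> {x\<in>RV V. \<forall>v\<in>V. pd v h x = \<tau> v}" if B: "B \<in> \<P>" for B
    proof -
      \<comment> \<open>Removing the other neighbourhoods leaves a compact set on which the minimum
        is forced into \<open>W B\<close>: outside it the function exceeds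
        \<open>\<delta> / 2\<close>, while at a zero over \<open>B\<close> it is smaller.\<close>
      define C' where "C' = boxV V S - (\<Union>B'\<in>\<P> - {B}. W B')"
      have compC': "compact C'" unfolding C'_def by (intro compact_diff compact_boxV open_UN ballI openW)
      obtain b where "b \<in> B" using P(5) B by blast
      moreover have "B \<subseteq> ?A" using P(3) B by blast
      ultimately obtain t where t: "t \<in> ?K" "q t \<in> B" by blast
      have "t \<in> W B" by (rule KW[OF t B])
      then have tC': "t \<in> C'" using KS(1)[OF t(1)] Wdisj B unfolding C'_def by blast
      then obtain x where x: "x \<in> C'" "\<And>y. y \<in> C' \<Longrightarrow> g x \<le> g y"
        using continuous_attains_inf[OF compC' _ polyf_continuous[OF g]] by blast
      have "x \<in> W B"
      proof (rule ccontr)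
        assume "x \<notin> W B"
        then have "x \<in> C" using x(1) by (auto simp: C_def C'_def)
        then have "\<delta> - \<delta> / 2 < g x" using \<delta>(2)[of x] lb[of x] by (auto simp: g_def C_def)
        moreover have "g t < \<delta> / 2" using t lb[of t] KS(1)[OF t(1)] by (auto simp: g_def)
        ultimately show False using x(2)[OF tC'] by linarith
      qed
      have xV: "x \<in> RV V" using x(1) by (auto simp: C'_def boxV_def)
      \<comment> \<open>Small moves of one coordinate stay in the open set \<open>W B\<close>, hence
        in \<open>C'\<close>, so the minimum over \<open>C'\<close> is a local one.\<close>
      have "pd v g x = 0" if v: "v \<in> V" for v
      proof -
        have "open ((\<lambda>t. x(v := t)) -` W B)"
          using continuous_on_upd[of UNIV x v] openW by (simp add: continuous_on_open_vimage)
        moreover have "x v \<in> (\<lambda>t. x(v := t)) -` W B" using \<open>x \<in> W B\<close> by simp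
        ultimately obtain r where r: "0 < r" "ball (x v) r \<subseteq> (\<lambda>t. x(v := t)) -` W B"
          using open_contains_ball by blast
        have "g (x(v := x v)) \<le> g (x(v := s))" if "\<bar>x v - s\<bar> < r" for s
        proof -
          have "x(v := s) \<in> W B" using r(2) that by (auto simp: dist_real_def)
          moreover then have "x(v := s) \<in> boxV V S"
            using xV v by (auto simp: W_def boxV_def RV_def intro: less_imp_le)
          ultimately have "x(v := s) \<in> C'" using Wdisj B unfolding C'_def by blast
          then show ?thesis using x(2) by simp
        qed
        then show ?thesis
          using DERIV_local_min[OF has_derivative_pd[OF g, of x v "x v"] r(1)] by simp
      qed
      then show ?thesis using pdg \<open>x \<in> W B\<close> xV by force
    qed
    then have "\<forall>B\<in>\<P>. \<exists>x. x \<in> W B \<and> x \<in> {x\<in>RV V. \<forall>v\<in>V. pd v h x = \<tau> v}" by blast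
    from bchoice[OF this] obtain x where x: "\<forall>B\<in>\<P>. x B \<in> W B \<and> x B \<in> {x\<in>RV V. \<forall>v\<in>V. pd v h x = \<tau> v}" by blast
    have "inj_on x \<P>"
    proof (rule inj_onI, rule ccontr)
      fix B B' assume B: "B \<in> \<P>" "B' \<in> \<P>" "x B = x B'" "B \<noteq> B'"
      then have "x B \<in> W B \<inter> W B'" using x by auto
      then show False using Wdisj[OF B(1,2,4)] by blast
    qed
    moreover have "x ` \<P> \<subseteq> {x\<in>RV V. \<forall>v\<in>V. pd v h x = \<tau> v}" using x by blast
    ultimately have "card \<P> \<le> D ^ card V"
      using card_inj_on_le fib order_trans by blast
    then show False using P(2) by simp
  qed
  then show ?thesis unfolding b0_def by (simp add: of_nat_mono del: of_nat_power)
qed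

section \<open>Cauchy-Binet and the area inequality\<close>

text \<open>The sum runs over all maps into \<open>C\<close>, not over subsets: noninjective maps
  contribute 0 and every subset is met once per ordering, whence
  \<open>fact CARD('k)\<close>.\<close>

lemma cauchy_binet:
  fixes A :: "'k::finite \<Rightarrow> 'c \<Rightarrow> real" and B :: "'c \<Rightarrow> 'k \<Rightarrow> real"
  assumes C: "finite C"
  shows "fact CARD('k) * det (\<chi> a b. \<Sum>c\<in>C. A a c * B c b) =
    (\<Sum>\<kappa>\<in>{\<kappa>. \<forall>a. \<kappa> a \<in> C}. det (\<chi> a b. A a (\<kappa> b)) * det (\<chi> a b. B (\<kappa> a) b))"
proof -
  let ?F = "{\<kappa>. \<forall>a::'k. \<kappa> a \<in> C}"
  let ?B = "\<lambda>\<kappa>. \<chi> a b. B (\<kappa> a) b"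
  \<comment> \<open>At this stage only the rows of the right factor are assembled into a
    determinant.\<close>
  have D: "det (\<chi> a b. \<Sum>c\<in>C. A a c * B c b) = (\<Sum>\<kappa>\<in>?F. (\<Prod>a\<in>UNIV. A a (\<kappa> a)) * det (?B \<kappa>))"
  proof -
    have "(\<Prod>a\<in>UNIV. \<Sum>c\<in>C. A a c * B c (p a)) = (\<Sum>\<kappa>\<in>?F. (\<Prod>a\<in>UNIV. A a (\<kappa> a)) * (\<Prod>a\<in>UNIV. B (\<kappa> a) (p a)))" for p
    proof -
      have "PiE UNIV (\<lambda>_::'k. C) = ?F" by auto
      then show ?thesis using C prod_sum_PiE[of "UNIV::'k set" "\<lambda>_. C" "\<lambda>a c. A a c * B c (p a)"]
        by (simp add: prod.distrib)
    qed
    then have "det (\<chi> a b. \<Sum>c\<in>C. A a c * B c b) = (\<Sum>p\<in>{p. p permutes (UNIV::'k set)}.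
      \<Sum>\<kappa>\<in>?F. (\<Prod>a\<in>UNIV. A a (\<kappa> a)) * (of_int (sign p) * (\<Prod>a\<in>UNIV. B (\<kappa> a) (p a))))"
      unfolding det_def by (simp add: sum_distrib_left mult_ac)
    also have "\<dots> = (\<Sum>\<kappa>\<in>?F. (\<Prod>a\<in>UNIV. A a (\<kappa> a)) * det (?B \<kappa>))"
      by (subst sum.swap) (simp add: det_def sum_distrib_left)
    finally show ?thesis .
  qed
  have perm: "(\<Sum>\<kappa>\<in>?F. h \<kappa>) = (\<Sum>\<kappa>\<in>?F. h (\<kappa> \<circ> \<sigma>))" if "\<sigma> permutes UNIV" for \<sigma> and h :: "('k \<Rightarrow> 'c) \<Rightarrow> real"
  proof (rule sum.reindex_bij_witness[where i = "\<lambda>\<kappa>. \<kappa> \<circ> \<sigma>" and j = "\<lambda>\<kappa>. \<kappa> \<circ> inv \<sigma>"])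
    fix \<kappa> :: "'k \<Rightarrow> 'c"
    show "\<kappa> \<circ> inv \<sigma> \<circ> \<sigma> = \<kappa>" "\<kappa> \<circ> \<sigma> \<circ> inv \<sigma> = \<kappa>"
      using permutes_inv_o[OF that] by (simp_all add: comp_assoc)
  qed (auto simp: comp_assoc permutes_inv_o[OF that])
  \<comment> \<open>Replacing \<kappa> by its composition with \<sigma> puts a sign on the left
    product; summing over \<sigma> completes the left determinant.\<close>
  have "det (\<chi> a b. \<Sum>c\<in>C. A a c * B c b) =
    (\<Sum>\<kappa>\<in>?F. (of_int (sign \<sigma>) * (\<Prod>a\<in>UNIV. A a (\<kappa> (\<sigma> a)))) * det (?B \<kappa>))" if \<sigma>: "\<sigma> permutes UNIV" for \<sigma>
  proof -
    have "det (?B (\<kappa> \<circ> \<sigma>)) = of_int (sign \<sigma>) * det (?B \<kappa>)" for \<kappa>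
      using det_permute_rows[OF \<sigma>, of "?B \<kappa>"] by simp
    then show ?thesis unfolding D by (subst perm[OF \<sigma>]) (simp add: mult_ac)
  qed
  then have "(\<Sum>\<sigma>\<in>{\<sigma>. \<sigma> permutes (UNIV::'k set)}. det (\<chi> a b. \<Sum>c\<in>C. A a c * B c b)) =
    (\<Sum>\<sigma>\<in>{\<sigma>. \<sigma> permutes (UNIV::'k set)}. \<Sum>\<kappa>\<in>?F. (of_int (sign \<sigma>) * (\<Prod>a\<in>UNIV. A a (\<kappa> (\<sigma> a)))) * det (?B \<kappa>))"
    by (intro sum.cong) auto
  also have "\<dots> = (\<Sum>\<kappa>\<in>?F. det (\<chi> a b. A a (\<kappa> b)) * det (?B \<kappa>))"
    by (subst sum.swap) (simp add: det_def[of "\<chi> a b. A a (_ b)"] sum_distrib_right)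
  finally show ?thesis
    using card_permutations[of "UNIV::'k set" "CARD('k)"] by simp
qed

lemma finite_maps: "finite C \<Longrightarrow> finite {\<kappa>. \<forall>a::'k::finite. \<kappa> a \<in> C}"
  using finite_PiE[of "UNIV::'k set" "\<lambda>_. C"] by (simp add: PiE_def Pi_def)

lemma card_maps: "finite C \<Longrightarrow> card {\<kappa>. \<forall>a::'k::finite. \<kappa> a \<in> C} = card C ^ CARD('k)"
  using card_PiE[of "UNIV::'k set" "\<lambda>_. C"] by (simp add: PiE_def Pi_def)

lemma cauchy_binet_weighted:
  fixes A :: "'k::finite \<Rightarrow> 'c \<Rightarrow> real"
  assumes C: "finite C"
  shows "fact CARD('k) * det (\<chi> a b. \<Sum>c\<in>C. A a c * (\<omega> c * A b c)) =
    (\<Sum>\<kappa>\<in>{\<kappa>. \<forall>a. \<kappa> a \<in> C}. (\<Prod>a\<in>UNIV. \<omega> (\<kappa> a)) * (det (\<chi> a b. A a (\<kappa> b)))\<^sup>2)"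
proof -
  have "det (\<chi> a b. \<omega> (\<kappa> a) * A b (\<kappa> a)) = (\<Prod>a\<in>UNIV. \<omega> (\<kappa> a)) * det (\<chi> a b. A a (\<kappa> b))" for \<kappa> :: "'k \<Rightarrow> 'c"
  proof -
    have "(\<chi> a b. \<omega> (\<kappa> a) * A b (\<kappa> a)) = (\<chi> a. \<omega> (\<kappa> a) *s (\<chi> b. A b (\<kappa> a)))"
      by (simp add: vec_eq_iff)
    then have "det (\<chi> a b. \<omega> (\<kappa> a) * A b (\<kappa> a)) = (\<Prod>a\<in>UNIV. \<omega> (\<kappa> a)) * det (\<chi> a b. A b (\<kappa> a))"
      using det_rows_mul[of "\<lambda>a. \<omega> (\<kappa> a)" "\<lambda>a. \<chi> b. A b (\<kappa> a)"] by simp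
    also have "det (\<chi> a b. A b (\<kappa> a)) = det (\<chi> a b. A a (\<kappa> b))"
      using det_transpose[of "\<chi> a b. A a (\<kappa> b)"] by (simp add: transpose_def)
    finally show ?thesis .
  qed
  then show ?thesis unfolding cauchy_binet[OF C, of A "\<lambda>c b. \<omega> c * A b c"]
    by (simp add: power2_eq_square mult_ac)
qed

lemma cauchy_binet_gram:
  fixes A :: "'k::finite \<Rightarrow> 'c \<Rightarrow> real"
  assumes C: "finite C"
  shows "(\<Sum>\<kappa>\<in>{\<kappa>. \<forall>a. \<kappa> a \<in> C}. (det (\<chi> a b. A a (\<kappa> b)))\<^sup>2) = fact CARD('k) * det (\<chi> a b. \<Sum>c\<in>C. A a c * A b c)"
  using cauchy_binet_weighted[OF C, of A "\<lambda>_. 1"] by simp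

text \<open>A squared minor is one term of the Cauchy-Binet sum of squares. The factor
  \<open>fact CARD('k)\<close> is a convenient weakening of its square root.\<close>

lemma minor_le_gram:
  fixes A :: "'k::finite \<Rightarrow> 'c \<Rightarrow> real"
  assumes C: "finite C" and \<kappa>: "\<And>a. \<kappa> a \<in> C" and J: "det (\<chi> a b. \<Sum>c\<in>C. A a c * A b c) \<le> J\<^sup>2" "0 \<le> J"
  shows "\<bar>det (\<chi> a b. A a (\<kappa> b))\<bar> \<le> fact CARD('k) * J"
proof -
  have "(det (\<chi> a b. A a (\<kappa> b)))\<^sup>2 \<le> fact CARD('k) * det (\<chi> a b. \<Sum>c\<in>C. A a c * A b c)"
    unfolding cauchy_binet_gram[OF C, symmetric] using \<kappa> finite_maps[OF C]
    by (intro member_le_sum) auto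
  also have "\<dots> \<le> fact CARD('k) * J\<^sup>2" using J by simp
  also have "\<dots> \<le> (fact CARD('k))\<^sup>2 * J\<^sup>2"
    by (intro mult_right_mono) (auto simp: power2_eq_square fact_ge_1)
  finally have "(det (\<chi> a b. A a (\<kappa> b)))\<^sup>2 \<le> (fact CARD('k) * J)\<^sup>2" by (simp add: power_mult_distrib)
  then show ?thesis using J by (simp add: abs_le_square_iff[symmetric])
qed

text \<open>Termwise comparison of two Cauchy-Binet sums. Restricting \<open>W\<close> to
  nonvanishing minors is what lets \<open>lift_gram_bound\<close> count the weighted columns that
  are selected.\<close>

lemma det_weighted_gram_le:
  fixes A :: "'k::finite \<Rightarrow> 'c \<Rightarrow> real"
  assumes C: "finite C"
    and W: "\<And>\<kappa>. (\<And>a. \<kappa> a \<in> C) \<Longrightarrow> det (\<chi> a b. A a (\<kappa> b)) \<noteq> 0 \<Longrightarrow> (\<Prod>a\<in>UNIV. \<omega> (\<kappa> a)) \<le> W"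
  shows "det (\<chi> a b. \<Sum>c\<in>C. A a c * (\<omega> c * A b c)) \<le> W * det (\<chi> a b. \<Sum>c\<in>C. A a c * A b c)"
proof -
  have "fact CARD('k) * det (\<chi> a b. \<Sum>c\<in>C. A a c * (\<omega> c * A b c)) \<le>
    (\<Sum>\<kappa>\<in>{\<kappa>. \<forall>a. \<kappa> a \<in> C}. W * (det (\<chi> a b. A a (\<kappa> b)))\<^sup>2)"
    unfolding cauchy_binet_weighted[OF C]
  proof (rule sum_mono)
    fix \<kappa> :: "'k \<Rightarrow> 'c" assume "\<kappa> \<in> {\<kappa>. \<forall>a. \<kappa> a \<in> C}"
    then show "(\<Prod>a\<in>UNIV. \<omega> (\<kappa> a)) * (det (\<chi> a b. A a (\<kappa> b)))\<^sup>2 \<le> W * (det (\<chi> a b. A a (\<kappa> b)))\<^sup>2"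
      using W[of \<kappa>] by (cases "det (\<chi> a b. A a (\<kappa> b)) = 0") (auto intro: mult_right_mono)
  qed
  also have "\<dots> = fact CARD('k) * (W * det (\<chi> a b. \<Sum>c\<in>C. A a c * A b c))"
    by (simp add: sum_distrib_left[symmetric] cauchy_binet_gram[OF C] mult_ac)
  finally show ?thesis by (simp del: fact_Suc)
qed

section \<open>Change of variables without injectivity\<close>

lemma borel_measurable_abs_det:
  fixes g :: "real^'k::{finite,wellorder} \<Rightarrow> real^'k::_"
  assumes E: "E \<in> sets lebesgue" and der: "\<And>y. y \<in> E \<Longrightarrow> (g has_derivative g' y) (at y within E)"
  shows "(\<lambda>y. ennreal \<bar>det (matrix (g' y))\<bar> * indicator E y) \<in> borel_measurable lebesgue"
proof -
  have "(\<lambda>x. det (matrix (g' x))) \<in> borel_measurable (lebesgue_on E)"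
    using borel_measurable_det_Jacobian[OF E der] by simp
  then have "(\<lambda>x. ennreal \<bar>det (matrix (g' x))\<bar>) \<in> borel_measurable (lebesgue_on E)" by measurable
  then show ?thesis using E by (subst (asm) borel_measurable_restrict_space_iff_ennreal) auto
qed

text \<open>Where the derivative is invertible, \<open>g\<close> scales small distances by at least
  some \<open>r j\<close>; intersecting \<open>F j\<close> with a ball of radius
  \<open>r j / 2\<close> makes \<open>g\<close> injective. Countably many centres and indices
  \<open>j\<close> exhaust the set.\<close>

lemma injective_pieces:
  fixes g :: "real^'k::{finite,wellorder} \<Rightarrow> real^'k::_"
  assumes E: "E \<in> sets lebesgue" and der: "\<And>y. y \<in> E \<Longrightarrow> (g has_derivative g' y) (at y within E)"
  shows "\<exists>H::nat \<Rightarrow> _. (\<forall>n. H n \<in> sets lebesgue \<and> inj_on g (H n)) \<and> disjoint_family H \<and>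
    (\<Union>n. H n) = {y\<in>E. det (matrix (g' y)) \<noteq> 0}"
proof -
  define r where "r j = 1 / real (Suc j)" for j
  have r: "0 < r j" for j by (simp add: r_def)
  define E0 where "E0 = {y\<in>E. det (matrix (g' y)) \<noteq> 0}"
  have "(\<lambda>x. det (matrix (g' x))) \<in> borel_measurable (lebesgue_on E)"
    using borel_measurable_det_Jacobian[OF E der] by simp
  then have "\<forall>T. T \<in> sets borel \<longrightarrow> {x \<in> E. det (matrix (g' x)) \<in> T} \<in> sets lebesgue"
    using borel_measurable_lebesgue_on_preimage_borel[OF E, of "\<lambda>x. det (matrix (g' x))"] by simp
  then have "{y\<in>E. det (matrix (g' y)) \<in> - {0}} \<in> sets lebesgue"
    by (rule allE[of _ "- {0}"]) auto
  then have E0: "E0 \<in> sets lebesgue" by (simp add: E0_def)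
  \<comment> \<open>The opposite condition is relatively open in \<open>E\<close>, so that
    \<open>F j\<close> is \<open>E\<close> minus an open set, hence measurable.\<close>
  define F where "F j = {y\<in>E. \<forall>y'\<in>E. dist y' y < r j \<longrightarrow> r j * dist y' y \<le> dist (g y') (g y)}" for j
  have contg: "continuous_on E g" by (rule has_derivative_continuous_on[OF der])
  have F: "F j \<in> sets lebesgue" for j
  proof -
    have "openin (top_of_set E) {y\<in>E. \<exists>y'\<in>E. dist y' y < r j \<and> dist (g y') (g y) < r j * dist y' y}"
    proof -
      have "openin (top_of_set E) {y\<in>E. dist y' y < r j \<and> dist (g y') (g y) < r j * dist y' y}" for y'
      proof -
        have "openin (top_of_set E) ({y\<in>E. r j - dist y' y \<in> {0<..}} \<inter> {y\<in>E. r j * dist y' y - dist (g y') (g y) \<in> {0<..}})"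
          using contg by (intro openin_Int continuous_openin_preimage_gen[unfolded vimage_def Int_def mem_Collect_eq] continuous_intros) auto
        moreover have "({y\<in>E. r j - dist y' y \<in> {0<..}} \<inter> {y\<in>E. r j * dist y' y - dist (g y') (g y) \<in> {0<..}})
          = {y\<in>E. dist y' y < r j \<and> dist (g y') (g y) < r j * dist y' y}" by auto
        ultimately show ?thesis by simp
      qed
      then have "openin (top_of_set E) (\<Union>y'\<in>E. {y\<in>E. dist y' y < r j \<and> dist (g y') (g y) < r j * dist y' y})"
        by (intro openin_Union) auto
      moreover have "(\<Union>y'\<in>E. {y\<in>E. dist y' y < r j \<and> dist (g y') (g y) < r j * dist y' y}) =
        {y\<in>E. \<exists>y'\<in>E. dist y' y < r j \<and> dist (g y') (g y) < r j * dist y' y}" by auto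
      ultimately show ?thesis by simp
    qed
    then obtain T where T: "open T" "{y\<in>E. \<exists>y'\<in>E. dist y' y < r j \<and> dist (g y') (g y) < r j * dist y' y} = E \<inter> T"
      by (auto simp: openin_open)
    have "F j = E - T" using T(2) unfolding F_def by (force simp: not_le)
    then show ?thesis using E T(1) by auto
  qed
  have cover: "\<exists>j. y \<in> F j" if "y \<in> E0" for y
  proof -
    have y: "y \<in> E" "det (matrix (g' y)) \<noteq> 0" using that by (auto simp: E0_def)
    have lin: "linear (g' y)" using der[OF y(1)] has_derivative_linear by blast
    then have "inj (g' y)" using y(2) det_nz_iff_inj by (metis matrix_works invertible_det_nz inj_matrix_vector_mult matrix_vector_mul)
    then obtain c where c: "0 < c" "\<And>v. c * norm v \<le> norm (g' y v)"
      using linear_inj_bounded_below_pos[OF lin] by blast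
    have "0 < c / 2" using c by simp
    then obtain d where d: "0 < d" "\<And>y'. y' \<in> E \<Longrightarrow> norm (y' - y) < d \<Longrightarrow> norm (g y' - g y - g' y (y' - y)) \<le> c / 2 * norm (y' - y)"
      using der[OF y(1)] unfolding has_derivative_within_alt by blast
    \<comment> \<open>One \<open>j\<close> serves as radius and as scaling factor; half of the lower
      bound \<open>c\<close> absorbs the remainder of the derivative.\<close>
    obtain j where j: "r j < min d (c / 2)" using reals_Archimedean[of "min d (c/2)"] c d by (auto simp: r_def inverse_eq_divide)
    have "r j * dist y' y \<le> dist (g y') (g y)" if "y' \<in> E" "dist y' y < r j" for y'
    proof -
      have "c * norm (y' - y) \<le> norm (g' y (y' - y))" by (rule c)
      also have "\<dots> \<le> norm (g y' - g y) + norm (g y' - g y - g' y (y' - y))"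
        by (metis norm_minus_commute norm_triangle_sub add.commute)
      also have "\<dots> \<le> norm (g y' - g y) + c / 2 * norm (y' - y)"
        using d(2)[OF that(1)] that(2) j by (simp add: dist_norm)
      finally have "c / 2 * norm (y' - y) \<le> norm (g y' - g y)" by linarith
      moreover have "r j * norm (y' - y) \<le> c / 2 * norm (y' - y)" using j by (intro mult_right_mono) auto
      ultimately show ?thesis by (simp add: dist_norm)
    qed
    then show ?thesis using y by (auto simp: F_def)
  qed
  obtain Q :: "(real^'k::{finite,wellorder}) set" where Q: "countable Q" "\<And>X. open X \<Longrightarrow> X \<noteq> {} \<Longrightarrow> \<exists>d\<in>Q. d \<in> X"
    using countable_dense_setE by blast
  have "Q \<noteq> {}" using Q(2)[of UNIV] by auto
  define H where "H n = (case prod_decode n of (j, i) \<Rightarrow> E0 \<inter> F j \<inter> ball (from_nat_into Q i) (r j / 2))" for n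
  have Hm: "H n \<in> sets lebesgue" for n
    using E0 F by (auto simp: H_def split: prod.split)
  have Hi: "inj_on g (H n)" for n
  proof (rule inj_onI)
    fix x y assume xy: "x \<in> H n" "y \<in> H n" "g x = g y"
    obtain j i where n: "prod_decode n = (j, i)" by fastforce
    have "dist (from_nat_into Q i) x < r j / 2" "dist (from_nat_into Q i) y < r j / 2" using xy n by (auto simp: H_def)
    then have "dist x y < r j" using dist_triangle_half_r by blast
    moreover have "x \<in> E" "y \<in> F j" using xy n by (auto simp: H_def E0_def)
    ultimately have "r j * dist x y \<le> dist (g x) (g y)" unfolding F_def by blast
    then show "x = y" using r[of j] xy(3) by (simp add: mult_le_0_iff)
  qed
  have HU: "(\<Union>n. H n) = E0"
  proof
    show "E0 \<subseteq> (\<Union>n. H n)"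
    proof
      fix y assume y: "y \<in> E0"
      then obtain j where j: "y \<in> F j" using cover by blast
      have "ball y (r j / 2) \<noteq> {}" using r[of j] by simp
      then obtain d where d: "d \<in> Q" "d \<in> ball y (r j / 2)" using Q(2)[OF open_ball] by blast
      then obtain i where "d = from_nat_into Q i" using from_nat_into_surj[OF Q(1)] by metis
      then have "y \<in> H (prod_encode (j, i))" using y j d by (auto simp: H_def dist_commute)
      then show "y \<in> (\<Union>n. H n)" by blast
    qed
  qed (auto simp: H_def split: prod.splits)
  show ?thesis
  proof (intro exI[of _ "disjointed H"] conjI allI)
    fix n
    show "disjointed H n \<in> sets lebesgue"
      using sets.range_disjointed_sets[of H lebesgue] Hm by blast
    show "inj_on g (disjointed H n)" by (rule inj_on_subset[OF Hi disjointed_subset])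
    show "disjoint_family (disjointed H)" by (rule disjoint_family_disjointed)
    show "(\<Union>n. disjointed H n) = {y\<in>E. det (matrix (g' y)) \<noteq> 0}"
      unfolding UN_disjointed_eq HU E0_def ..
  qed
qed

text \<open>On each injective piece the integral is the measure of the image; together, the images
  cover almost every point of \<open>B\<close> at most \<open>P\<close> times. Points with vanishing
  determinant contribute nothing to the left side.\<close>

lemma area_inequality:
  fixes g :: "real^'k::{finite,wellorder} \<Rightarrow> real^'k::_"
  assumes E: "\<And>q::nat. E q \<in> sets lebesgue" and disj: "disjoint_family E"
    and der: "\<And>q y. y \<in> E q \<Longrightarrow> (g has_derivative g' y) (at y within E q)"
    and B: "B \<in> lmeasurable" "\<And>q. g ` E q \<subseteq> B"
    and N: "negligible N" and mult: "\<And>z. z \<notin> N \<Longrightarrow> finite {y\<in>(\<Union>q. E q). g y = z} \<and> card {y\<in>(\<Union>q. E q). g y = z} \<le> P"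
  shows "(\<Sum>q. \<integral>\<^sup>+ y. ennreal \<bar>det (matrix (g' y))\<bar> * indicator (E q) y \<partial>lborel) \<le> of_nat P * emeasure lebesgue B"
proof -
  have "\<forall>q. \<exists>H::nat \<Rightarrow> _. (\<forall>n. H n \<in> sets lebesgue \<and> inj_on g (H n)) \<and> disjoint_family H \<and>
    (\<Union>n. H n) = {y\<in>E q. det (matrix (g' y)) \<noteq> 0}"
    using injective_pieces[OF E der] by blast
  then obtain H :: "nat \<Rightarrow> nat \<Rightarrow> (real^'k::{finite,wellorder}) set" where HH: "\<forall>q. (\<forall>n. H q n \<in> sets lebesgue \<and> inj_on g (H q n)) \<and> disjoint_family (H q) \<and>
    (\<Union>n. H q n) = {y\<in>E q. det (matrix (g' y)) \<noteq> 0}"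
    by (rule choice[THEN exE])
  have H: "H q n \<in> sets lebesgue" "inj_on g (H q n)" "disjoint_family (H q)"
    "(\<Union>n. H q n) = {y\<in>E q. det (matrix (g' y)) \<noteq> 0}" for q n
    using HH[rule_format, of q] by simp_all
  have HE: "H q n \<subseteq> E q" for q n using H(4)[of q] by blast
  have derH: "(g has_derivative g' y) (at y within H q n)" if "y \<in> H q n" for y q n
    using der that HE by (blast intro: has_derivative_subset)
  have img: "g ` H q n \<in> lmeasurable" for q n
  proof -
    have "g differentiable_on H q n" using derH unfolding differentiable_on_def differentiable_def by blast
    then have "g ` H q n \<in> sets lebesgue" by (intro differentiable_image_in_sets_lebesgue H) auto
    moreover have "g ` H q n \<subseteq> B" using B HE by blast
    ultimately show ?thesis using B fmeasurableI2 by blast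
  qed
  have int: "(\<integral>\<^sup>+ y. ennreal \<bar>det (matrix (g' y))\<bar> * indicator (H q n) y \<partial>lborel) = (\<integral>\<^sup>+ z. indicator (g ` H q n) z \<partial>lebesgue)" for q n
  proof -
    have "((\<lambda>x. \<bar>det (matrix (g' x))\<bar>) has_integral measure lebesgue (g ` H q n)) (H q n)"
      using has_measure_differentiable_image[OF H(1) derH H(2), of q n "measure lebesgue (g ` H q n)"] img by simp
    then have "(\<integral>\<^sup>+ y. ennreal \<bar>det (matrix (g' y))\<bar> * indicator (H q n) y \<partial>lborel) = ennreal (measure lebesgue (g ` H q n))"
      by (intro nn_integral_has_integral_lebesgue') auto
    then show ?thesis using img by (simp add: emeasure_eq_measure2 fmeasurableD)
  qed
  have split: "(\<integral>\<^sup>+ y. ennreal \<bar>det (matrix (g' y))\<bar> * indicator (E q) y \<partial>lborel) =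
    (\<Sum>n. \<integral>\<^sup>+ y. ennreal \<bar>det (matrix (g' y))\<bar> * indicator (H q n) y \<partial>lborel)" for q
  proof -
    have m: "(\<lambda>y. ennreal \<bar>det (matrix (g' y))\<bar> * indicator (H q n) y) \<in> borel_measurable lebesgue" for n
      by (rule borel_measurable_abs_det[OF H(1) derH])
    have "ennreal \<bar>det (matrix (g' y))\<bar> * indicator (E q) y = (\<Sum>n. ennreal \<bar>det (matrix (g' y))\<bar> * indicator (H q n) y)" for y
    proof -
      have "(\<Sum>n. ennreal \<bar>det (matrix (g' y))\<bar> * indicator (H q n) y) = ennreal \<bar>det (matrix (g' y))\<bar> * (\<Sum>n. indicator (H q n) y)"
        by simp
      also have "(\<Sum>n. indicator (H q n) y) = (indicator (\<Union>n. H q n) y :: ennreal)"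
        using H(3) by (simp add: suminf_indicator)
      finally show ?thesis by (auto simp: H(4) indicator_def)
    qed
    then have "(\<integral>\<^sup>+ y. ennreal \<bar>det (matrix (g' y))\<bar> * indicator (E q) y \<partial>lebesgue) =
      (\<integral>\<^sup>+ y. (\<Sum>n. ennreal \<bar>det (matrix (g' y))\<bar> * indicator (H q n) y) \<partial>lebesgue)" by simp
    also have "\<dots> = (\<Sum>n. \<integral>\<^sup>+ y. ennreal \<bar>det (matrix (g' y))\<bar> * indicator (H q n) y \<partial>lebesgue)"
      by (intro nn_integral_suminf m)
    finally have "(\<integral>\<^sup>+ y. ennreal \<bar>det (matrix (g' y))\<bar> * indicator (E q) y \<partial>lebesgue) =
      (\<Sum>n. \<integral>\<^sup>+ y. ennreal \<bar>det (matrix (g' y))\<bar> * indicator (H q n) y \<partial>lebesgue)" .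
    then show ?thesis by (simp only: nn_integral_completion)
  qed
  \<comment> \<open>The double family is flattened by \<open>prod_decode\<close>, so that one
    partial sum counts how many images contain \<open>z\<close>.\<close>
  let ?G = "\<lambda>m. case prod_decode m of (q, n) \<Rightarrow> g ` H q n"
  let ?H = "\<lambda>m. case prod_decode m of (q, n) \<Rightarrow> H q n"
  have Hdisj: "?H m \<inter> ?H m' = {}" if "m \<noteq> m'" for m m'
  proof -
    obtain q n q' n' where *: "prod_decode m = (q, n)" "prod_decode m' = (q', n')" by fastforce
    have ne: "(q, n) \<noteq> (q', n')" using that * by (metis prod_decode_eq)
    show ?thesis
    proof (cases "q = q'")
      case True
      then have "n \<noteq> n'" using ne by simp
      then show ?thesis using H(3)[of q] * True by (auto simp: disjoint_family_on_def)
    next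
      case False
      then have "E q \<inter> E q' = {}" using disj by (auto simp: disjoint_family_on_def)
      then show ?thesis using * HE by fastforce
    qed
  qed
  have count: "(\<Sum>m. indicator (?G m) z) \<le> (of_nat P * indicator B z :: ennreal)" if "z \<notin> N" for z
  proof -
    have "(\<Sum>m<M. indicator (?G m) z) \<le> (of_nat P * indicator B z :: ennreal)" for M
    proof (cases "z \<in> B")
      case True
      have "(\<Sum>m<M. indicator (?G m) z :: ennreal) = of_nat (card {m\<in>{..<M}. z \<in> ?G m})"
        by (simp add: indicator_def sum.If_cases Int_def)
      also have "card {m\<in>{..<M}. z \<in> ?G m} \<le> card {y\<in>(\<Union>q. E q). g y = z}"
      proof -
        \<comment> \<open>Each image that contains \<open>z\<close> supplies a preimage, and
          disjointness of the pieces makes these preimages distinct.\<close>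
        have "\<forall>m\<in>{m\<in>{..<M}. z \<in> ?G m}. \<exists>y. y \<in> ?H m \<and> g y = z" by (auto split: prod.splits)
        from bchoice[OF this] obtain y where y: "\<forall>m\<in>{m\<in>{..<M}. z \<in> ?G m}. y m \<in> ?H m \<and> g (y m) = z" by blast
        show ?thesis
        proof (rule card_inj_on_le[where f = y])
          show "inj_on y {m\<in>{..<M}. z \<in> ?G m}"
          proof (rule inj_onI, rule ccontr)
            fix m m' assume m: "m \<in> {m\<in>{..<M}. z \<in> ?G m}" "m' \<in> {m\<in>{..<M}. z \<in> ?G m}" "y m = y m'" "m \<noteq> m'"
            have "y m \<in> ?H m" "y m' \<in> ?H m'" using bspec[OF y m(1)] bspec[OF y m(2)] by simp_all
            then show False using Hdisj[OF m(4)] m(3) by auto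
          qed
          show "y ` {m\<in>{..<M}. z \<in> ?G m} \<subseteq> {y\<in>(\<Union>q. E q). g y = z}"
          proof
            fix w assume "w \<in> y ` {m\<in>{..<M}. z \<in> ?G m}"
            then obtain m where m: "m \<in> {m\<in>{..<M}. z \<in> ?G m}" "w = y m" by (rule imageE)
            obtain q n where qn: "prod_decode m = (q, n)" by (cases "prod_decode m")
            have "y m \<in> ?H m \<and> g (y m) = z" by (rule bspec[OF y m(1)])
            then have "y m \<in> H q n" "g (y m) = z" using qn by auto
            then show "w \<in> {y\<in>(\<Union>q. E q). g y = z}" using HE[of q n] m(2) by blast
          qed
          show "finite {y\<in>(\<Union>q. E q). g y = z}" using mult[OF that] by blast
        qed
      qed
      also have "\<dots> \<le> P" using mult[OF that] by blast
      finally show ?thesis using True by (simp add: of_nat_mono)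
    next
      case False
      have "z \<notin> ?G m" for m using False B HE by (fastforce split: prod.split)
      then show ?thesis by simp
    qed
    then show ?thesis by (intro suminf_le_const) (auto simp: summableI)
  qed
  have "(\<Sum>q. \<integral>\<^sup>+ y. ennreal \<bar>det (matrix (g' y))\<bar> * indicator (E q) y \<partial>lborel) =
    (\<Sum>q. \<Sum>n. \<integral>\<^sup>+ z. indicator (g ` H q n) z \<partial>lebesgue)"
    unfolding split int ..
  also have "\<dots> = (\<Sum>m. (\<lambda>(q, n). \<integral>\<^sup>+ z. indicator (g ` H q n) z \<partial>lebesgue) (prod_decode m))"
    by (rule suminf_ennreal_2dimen[symmetric]) simp
  also have "\<dots> = (\<Sum>m. \<integral>\<^sup>+ z. indicator (?G m) z \<partial>lebesgue)"
    by (simp add: case_prod_beta)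
  also have "\<dots> = (\<integral>\<^sup>+ z. (\<Sum>m. indicator (?G m) z) \<partial>lebesgue)"
    using img by (intro nn_integral_suminf[symmetric]) (auto split: prod.split)
  also have "\<dots> \<le> (\<integral>\<^sup>+ z. of_nat P * indicator B z \<partial>lebesgue)"
  proof (rule nn_integral_mono_AE, rule AE_I')
    show "N \<in> null_sets lebesgue" using N negligible_iff_null_sets by blast
  qed (use count in auto)
  also have "\<dots> = of_nat P * emeasure lebesgue B"
    using B by (intro nn_integral_cmult_indicator) auto
  finally show ?thesis .
qed

section \<open>Volume of images of zero sets\<close>

text \<open>The solution \<open>x\<close> is given and continuous, so only its differentiability is
  at stake, relative to an arbitrary set \<open>E\<close>. The increment of \<open>x\<close> is
  bounded by \<open>M\<close> times that of \<open>y\<close>, and then the remainder is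
  small.\<close>

lemma implicit_derivative:
  fixes F :: "'a::euclidean_space \<times> real \<Rightarrow> real" and x :: "'a \<Rightarrow> real"
  assumes der: "(F has_derivative L) (at (y0, x y0))" and nz: "L (0, 1) \<noteq> 0"
    and cont: "continuous (at y0 within E) x" and zero: "\<And>y. y \<in> E \<Longrightarrow> F (y, x y) = 0" and "y0 \<in> E"
  shows "(x has_derivative (\<lambda>v. - L (v, 0) / L (0, 1))) (at y0 within E)"
proof -
  define l where "l = L (0, 1)"
  have linL: "bounded_linear L" using der by (rule has_derivative_bounded_linear)
  have Lsplit: "L (v, t) = L (v, 0) + t * l" for v t
  proof -
    have "L (v, t) = L ((v, 0) + t *\<^sub>R (0, 1))" by simp
    also have "\<dots> = L (v, 0) + t *\<^sub>R L (0, 1)"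
      using linL by (simp only: bounded_linear.linear linear_add linear_cmul)
    finally show ?thesis by (simp add: l_def)
  qed
  have blA: "bounded_linear (\<lambda>v. L (v, 0))"
    by (rule bounded_linear_compose[OF linL]) (intro bounded_linear_intros)
  then obtain K where K: "0 < K" "\<And>v. norm (L (v, 0)) \<le> norm v * K" using bounded_linear.pos_bounded by blast
  have l0: "0 < \<bar>l\<bar>" using nz by (simp add: l_def)
  define M where "M = 2 / \<bar>l\<bar> * (K + \<bar>l\<bar>)"
  have M: "0 < M" using K l0 by (simp add: M_def)
  show ?thesis
    unfolding has_derivative_within_alt
  proof (intro conjI allI impI)
    have "bounded_linear (\<lambda>v. L (v, 0) * (- 1 / l))" using blA by (rule bounded_linear_mult_const)
    then show "bounded_linear (\<lambda>v. - L (v, 0) / L (0, 1))" by (simp add: l_def)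
    fix e :: real assume e: "0 < e"
    \<comment> \<open>The bound \<open>\<bar>l\<bar> / 2\<close> absorbs the increment of
      \<open>x\<close> on the right-hand side when \<open>\<bar>t\<bar> \<le> M * norm u\<close> is
      derived; the other one yields the final \<open>e\<close>.\<close>
    define e' where "e' = min (\<bar>l\<bar> / 2) (e * \<bar>l\<bar> / (1 + M))"
    have e'1: "e' \<le> e * \<bar>l\<bar> / (1 + M)" by (simp add: e'_def)
    have e'2: "e' \<le> \<bar>l\<bar> / 2" unfolding e'_def by (rule min.cobounded1)
    have e'3: "0 < e'" using e l0 M by (simp add: e'_def)
    have "e' * (1 + M) \<le> e * \<bar>l\<bar>" using e'1 M by (simp add: pos_le_divide_eq)
    note e' = e'3 e'2 this
    obtain d where d: "0 < d" "\<And>z. norm (z - (y0, x y0)) < d \<Longrightarrow> norm (F z - F (y0, x y0) - L (z - (y0, x y0))) \<le> e' * norm (z - (y0, x y0))"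
      using der e'(1) unfolding has_derivative_at_alt by blast
    obtain d1 where d1: "0 < d1" "\<And>y. y \<in> E \<Longrightarrow> dist y y0 < d1 \<Longrightarrow> dist (x y) (x y0) < d / 2"
      using cont d(1) unfolding continuous_within_eps_delta by (meson half_gt_zero)
    show "\<exists>d>0. \<forall>y\<in>E. norm (y - y0) < d \<longrightarrow> norm (x y - x y0 - - L (y - y0, 0) / L (0, 1)) \<le> e * norm (y - y0)"
    proof (intro exI[of _ "min d1 (d / 2)"] conjI ballI impI)
      show "0 < min d1 (d / 2)" using d d1 by simp
      fix y assume y: "y \<in> E" "norm (y - y0) < min d1 (d / 2)"
      define u where "u = y - y0"
      define t where "t = x y - x y0"
      have "norm t < d / 2" using d1(2)[of y] y by (simp add: t_def dist_norm)
      have nle: "norm (u, t) \<le> norm u + norm t" by (rule norm_Pair_le)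
      then have "norm ((y, x y) - (y0, x y0)) < d" using y \<open>norm t < d / 2\<close> by (simp add: u_def t_def)
      from d(2)[OF this] have "\<bar>L (u, t)\<bar> \<le> e' * norm (u, t)"
        using zero[OF y(1)] zero[OF \<open>y0 \<in> E\<close>] by (simp add: u_def t_def)
      also have "\<dots> \<le> e' * (norm u + \<bar>t\<bar>)" using nle e' by (intro mult_left_mono) auto
      finally have 1: "\<bar>L (u, 0) + t * l\<bar> \<le> e' * (norm u + \<bar>t\<bar>)" by (simp add: Lsplit[of u t])
      have "\<bar>t * l\<bar> \<le> \<bar>L (u, 0)\<bar> + e' * (norm u + \<bar>t\<bar>)" using 1 by linarith
      also have "\<dots> \<le> norm u * K + (\<bar>l\<bar> / 2) * (norm u + \<bar>t\<bar>)"
        using K(2)[of u] e'(2) by (intro add_mono mult_right_mono) auto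
      finally have "\<bar>t\<bar> * \<bar>l\<bar> \<le> norm u * K + (\<bar>l\<bar> / 2) * (norm u + \<bar>t\<bar>)" by (simp only: abs_mult)
      moreover have "(\<bar>l\<bar> / 2) * (norm u + \<bar>t\<bar>) = \<bar>l\<bar> * norm u / 2 + \<bar>t\<bar> * \<bar>l\<bar> / 2"
        "2 * (norm u * (K + \<bar>l\<bar>)) = 2 * (norm u * K) + 2 * (\<bar>l\<bar> * norm u)"
        by (simp_all add: algebra_simps)
      moreover have "0 \<le> \<bar>l\<bar> * norm u" by simp
      ultimately have "\<bar>t\<bar> * \<bar>l\<bar> \<le> 2 * (norm u * (K + \<bar>l\<bar>))" by linarith
      then have t: "\<bar>t\<bar> \<le> M * norm u" using l0 by (simp add: M_def field_simps)
      have "\<bar>L (u, 0) + t * l\<bar> \<le> e' * (norm u + M * norm u)"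
        using 1 t e' by (meson add_left_mono less_imp_le mult_left_mono order_trans)
      also have "\<dots> = (e' * (1 + M)) * norm u" by (simp add: algebra_simps)
      also have "\<dots> \<le> (e * \<bar>l\<bar>) * norm u" using e' by (intro mult_right_mono) auto
      finally have "\<bar>L (u, 0) + t * l\<bar> / \<bar>l\<bar> \<le> e * norm u" using l0 by (simp add: field_simps)
      moreover have "t - - L (u, 0) / l = (L (u, 0) + t * l) / l" using l0 by (simp add: field_simps)
      ultimately show "norm (x y - x y0 - - L (y - y0, 0) / L (0, 1)) \<le> e * norm (y - y0)"
        by (simp add: u_def t_def l_def abs_divide)
    qed
  qed
qed

section \<open>Coordinates as roots of polynomials depending on the target\<close>

lemma higher_pderiv_nonzero:
  fixes p :: "real poly"
  shows "p \<noteq> 0 \<Longrightarrow> \<exists>\<mu>. poly ((pderiv ^^ \<mu>) p) s \<noteq> 0"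
proof (induction "degree p" arbitrary: p)
  case 0
  then obtain c where "p = [:c:]" using degree_eq_zeroE by metis
  then show ?case using 0 by (intro exI[of _ 0]) auto
next
  case (Suc n)
  have "pderiv p \<noteq> 0" "degree (pderiv p) = n"
    using Suc.hyps(2) by (auto simp: pderiv_eq_0_iff degree_pderiv)
  then obtain \<mu> where "poly ((pderiv ^^ \<mu>) (pderiv p)) s \<noteq> 0" using Suc.hyps(1) by blast
  moreover have "(pderiv ^^ Suc \<mu>) p = (pderiv ^^ \<mu>) (pderiv p)" by (simp only: funpow_Suc_right comp_apply)
  ultimately show ?case by metis
qed

definition hd_poly :: "(nat \<Rightarrow> 'a \<Rightarrow> real) \<Rightarrow> nat \<Rightarrow> nat \<Rightarrow> 'a \<Rightarrow> real \<Rightarrow> real" where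
  "hd_poly co B \<mu> y s = poly ((pderiv ^^ \<mu>) (\<Sum>b\<le>B. monom (co b y) b)) s"

lemma hd_poly_0: "hd_poly co B 0 y s = (\<Sum>b\<le>B. co b y * s ^ b)"
  by (simp add: hd_poly_def poly_sum poly_monom)

lemma hd_poly_eq: "hd_poly co B \<mu> y s = (\<Sum>b\<le>B. co b y * poly ((pderiv ^^ \<mu>) (monom 1 b)) s)"
proof -
  have "(\<Sum>b\<le>B. monom (co b y) b) = (\<Sum>b\<le>B. smult (co b y) (monom 1 b))"
    by (simp add: smult_monom)
  then show ?thesis unfolding hd_poly_def
    by (simp only: higher_pderiv_sum poly_sum higher_pderiv_smult poly_smult)
qed

lemma hd_poly_DERIV: "(hd_poly co B \<mu> y has_real_derivative hd_poly co B (Suc \<mu>) y s) (at s)"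
  unfolding hd_poly_def by (simp add: poly_DERIV)

text \<open>A multiple root is a simple root of some derivative of the polynomial, so implicit
  differentiation works without discarding a discriminant.\<close>

lemma hd_poly_multiplicity:
  assumes "hd_poly co B 0 y s = 0" "\<exists>b\<le>B. co b y \<noteq> 0"
  shows "\<exists>\<mu>. hd_poly co B \<mu> y s = 0 \<and> hd_poly co B (Suc \<mu>) y s \<noteq> 0"
proof -
  let ?p = "\<Sum>b\<le>B. monom (co b y) b"
  obtain b where b: "b \<le> B" "co b y \<noteq> 0" using assms by blast
  have "coeff ?p b = co b y" unfolding coeff_sum coeff_monom using b by (simp add: sum.delta)
  then have "?p \<noteq> 0" using b by auto
  then obtain \<nu> where "hd_poly co B \<nu> y s \<noteq> 0" using higher_pderiv_nonzero unfolding hd_poly_def by blast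
  then show ?thesis
  proof (induction \<nu>)
    case (Suc \<nu>)
    then show ?case by (cases "hd_poly co B \<nu> y s = 0") auto
  qed (use assms in simp)
qed

text \<open>The partial derivative in the root variable is the next derivative of the polynomial,
  the quantity that \<open>implicit_derivative\<close> needs to be nonzero.\<close>

lemma hd_poly_has_derivative:
  fixes co :: "nat \<Rightarrow> 'a::euclidean_space \<Rightarrow> real"
  assumes "\<And>b. co b differentiable (at y)"
  shows "\<exists>L. ((\<lambda>z. hd_poly co B \<mu> (fst z) (snd z)) has_derivative L) (at (y, s)) \<and> L (0, 1) = hd_poly co B (Suc \<mu>) y s"
proof -
  have "(\<lambda>z. hd_poly co B \<mu> (fst z) (snd z)) differentiable (at (y, s))"
    unfolding hd_poly_eq
  proof (intro differentiable_sum ballI differentiable_mult)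
    fix b
    have "(co b \<circ> fst) differentiable (at (y, s))"
      by (rule differentiable_chain_at) (use assms in \<open>auto intro!: bounded_linear_imp_differentiable bounded_linear_fst\<close>)
    then show "(\<lambda>z. co b (fst z)) differentiable (at (y, s))" by (simp add: comp_def)
    have "poly ((pderiv ^^ \<mu>) (monom 1 b)) differentiable (at s)"
      using poly_DERIV real_differentiable_def by blast
    then have "(poly ((pderiv ^^ \<mu>) (monom 1 b)) \<circ> snd) differentiable (at (y, s))"
      by (intro differentiable_chain_at) (auto intro!: bounded_linear_imp_differentiable bounded_linear_snd)
    then show "(\<lambda>z. poly ((pderiv ^^ \<mu>) (monom 1 b)) (snd z)) differentiable (at (y, s))" by (simp add: comp_def)
  qed auto
  then obtain L where L: "((\<lambda>z. hd_poly co B \<mu> (fst z) (snd z)) has_derivative L) (at (y, s))"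
    unfolding differentiable_def by blast
  have "((\<lambda>t. (y, t)) has_derivative (\<lambda>t. (0, t))) (at s)"
    by (auto intro!: derivative_eq_intros)
  then have "((\<lambda>t. hd_poly co B \<mu> (fst (y, t)) (snd (y, t))) has_derivative (\<lambda>t. L (0, t))) (at s)"
    using has_derivative_compose[of "\<lambda>t. (y, t)" "\<lambda>t. (0, t)" s UNIV "\<lambda>z. hd_poly co B \<mu> (fst z) (snd z)" L] L by simp
  then have "(\<lambda>t. L (0, t)) = (*) (hd_poly co B (Suc \<mu>) y s)"
    using hd_poly_DERIV[of co B \<mu> y s] unfolding has_field_derivative_def
    by (simp add: has_derivative_unique)
  then have "L (0, 1) = hd_poly co B (Suc \<mu>) y s" by (metis mult.right_neutral)
  then show ?thesis using L by blast
qed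

lemma hd_poly_unique_root:
  assumes "s \<in> {a..b}" "s' \<in> {a..b}" "hd_poly co B \<mu> y s = 0" "hd_poly co B \<mu> y s' = 0"
    and nz: "\<And>t. t \<in> {a..b} \<Longrightarrow> hd_poly co B (Suc \<mu>) y t \<noteq> 0"
  shows "s = s'"
proof -
  have "\<not> s < s'" if *: "s \<in> {a..b}" "s' \<in> {a..b}" "hd_poly co B \<mu> y s = 0" "hd_poly co B \<mu> y s' = 0" for s s'
  proof
    assume "s < s'"
    have "continuous_on {s..s'} (hd_poly co B \<mu> y)"
      by (intro continuous_at_imp_continuous_on ballI DERIV_isCont[OF hd_poly_DERIV])
    moreover have "hd_poly co B \<mu> y differentiable (at t)" for t
      unfolding real_differentiable_def by (rule exI, rule hd_poly_DERIV)
    moreover have "hd_poly co B \<mu> y s = hd_poly co B \<mu> y s'" using * by simp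
    ultimately have "\<exists>t. s < t \<and> t < s' \<and> DERIV (hd_poly co B \<mu> y) t :> 0"
      using \<open>s < s'\<close> by (intro Rolle)
    then obtain t where t: "s < t" "t < s'" "DERIV (hd_poly co B \<mu> y) t :> 0" by blast
    then have "hd_poly co B (Suc \<mu>) y t = 0" using DERIV_unique[OF t(3) hd_poly_DERIV] by simp
    then show False using nz[of t] t * by auto
  qed
  then show ?thesis using assms by (meson linorder_neqE)
qed

lemma has_derivative_vec_lambda:
  fixes f :: "'a::real_normed_vector \<Rightarrow> 'k::finite \<Rightarrow> real"
  assumes "\<And>a. ((\<lambda>y. f y a) has_derivative f' a) (at y within E)"
  shows "((\<lambda>y. \<chi> a. f y a) has_derivative (\<lambda>v. \<chi> a. f' a v)) (at y within E)"
  unfolding has_derivative_componentwise_within[of "\<lambda>y. \<chi> a. f y a"]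
  using assms by (auto simp: Basis_vec_def inner_axis)

lemma hd_poly_continuous:
  fixes co :: "nat \<Rightarrow> 'a::euclidean_space \<Rightarrow> real"
  assumes "\<And>b. continuous_on UNIV (co b)" "continuous_on S p" "continuous_on S q"
  shows "continuous_on S (\<lambda>x. hd_poly co B \<mu> (p x) (q x))"
  unfolding hd_poly_eq
  by (intro continuous_intros assms(2-) continuous_on_compose2[OF assms(1) assms(2)]) auto

text \<open>An algebraic window for the coordinate \<open>s\<close> over \<open>y\<close>: in \<open>[lo, hi]\<close> the derivative of order
  \<open>\<mu> + 1\<close> has no zero, hence the one of order \<open>\<mu>\<close> has at most one.\<close>
definition window :: "(nat \<Rightarrow> 'a \<Rightarrow> real) \<Rightarrow> nat \<Rightarrow> nat \<times> rat \<times> rat \<times> nat \<Rightarrow> 'a \<Rightarrow> real \<Rightarrow> bool" where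
  "window co B t y s \<longleftrightarrow> (case t of (\<mu>, lo, hi, j) \<Rightarrow> of_rat lo \<le> s \<and> s \<le> of_rat hi \<and> hd_poly co B \<mu> y s = 0 \<and>
     (\<forall>u\<in>{of_rat lo..of_rat hi}. 1 / real (Suc j) \<le> \<bar>hd_poly co B (Suc \<mu>) y u\<bar>))"

lemma window_unique: "window co B t y s \<Longrightarrow> window co B t y s' \<Longrightarrow> s = s'"
proof -
  assume w: "window co B t y s" "window co B t y s'"
  obtain \<mu> lo hi j where t: "t = (\<mu>, lo, hi, j)" by (cases t)
  show ?thesis
  proof (rule hd_poly_unique_root[where a = "of_rat lo" and b = "of_rat hi"])
    fix u :: real assume "u \<in> {of_rat lo..of_rat hi}"
    then have "1 / real (Suc j) \<le> \<bar>hd_poly co B (Suc \<mu>) y u\<bar>" using w(1) by (simp add: window_def t)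
    moreover have "0 < 1 / real (Suc j)" by simp
    ultimately show "hd_poly co B (Suc \<mu>) y u \<noteq> 0" by linarith
  qed (use w in \<open>auto simp: window_def t\<close>)
qed

text \<open>Rational end points and bounds \<open>1 / real (Suc j)\<close> leave only countably many
  windows, so that the points split into countably many pieces.\<close>

lemma window_exists:
  assumes "hd_poly co B 0 y s = 0" "\<exists>b\<le>B. co b y \<noteq> 0"
  shows "\<exists>t. window co B t y s"
proof -
  obtain \<mu> where \<mu>: "hd_poly co B \<mu> y s = 0" "hd_poly co B (Suc \<mu>) y s \<noteq> 0"
    using hd_poly_multiplicity[OF assms] by blast
  let ?h = "hd_poly co B (Suc \<mu>) y"
  have "isCont ?h s" by (rule DERIV_isCont[OF hd_poly_DERIV])
  moreover have "0 < \<bar>?h s\<bar> / 2" using \<mu> by simp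
  ultimately obtain d where d: "0 < d" "\<And>u. \<bar>u - s\<bar> < d \<Longrightarrow> \<bar>?h u - ?h s\<bar> < \<bar>?h s\<bar> / 2"
    unfolding continuous_at_eps_delta dist_real_def by metis
  obtain lo where lo: "s - d < of_rat lo" "of_rat lo < s" using of_rat_dense[of "s - d" s] d by auto
  obtain hi where hi: "s < of_rat hi" "of_rat hi < s + d" using of_rat_dense[of s "s + d"] d by auto
  obtain j where j: "1 / real (Suc j) < \<bar>?h s\<bar> / 2"
    using reals_Archimedean[of "\<bar>?h s\<bar> / 2"] \<mu> by (auto simp: inverse_eq_divide)
  have "1 / real (Suc j) \<le> \<bar>?h u\<bar>" if "u \<in> {of_rat lo..of_rat hi}" for u
  proof -
    have "\<bar>u - s\<bar> < d" using that lo hi by auto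
    from d(2)[OF this] show ?thesis using j by linarith
  qed
  then have "window co B (\<mu>, lo, hi, j) y s" using \<mu> lo hi by (auto simp: window_def)
  then show ?thesis by blast
qed

text \<open>The quantitative bound in \<open>window\<close>, instead of mere nonvanishing, is what
  makes the condition closed; compactness of the pieces rests on this.\<close>

lemma closed_window:
  fixes co :: "nat \<Rightarrow> 'a::euclidean_space \<Rightarrow> real" and p :: "'b::topological_space \<Rightarrow> 'a"
  assumes co: "\<And>b. continuous_on UNIV (co b)" and p: "continuous_on UNIV p" "continuous_on UNIV q"
  shows "closed {x. window co B t (p x) (q x)}"
proof -
  obtain \<mu> lo hi j where t: "t = (\<mu>, lo, hi, j)" by (cases t)
  have "{x. window co B t (p x) (q x)} = {x. of_rat lo \<le> q x} \<inter> {x. q x \<le> of_rat hi} \<inter>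
    {x. hd_poly co B \<mu> (p x) (q x) = 0} \<inter> (\<Inter>u\<in>{of_rat lo..of_rat hi}. {x. 1 / real (Suc j) \<le> \<bar>hd_poly co B (Suc \<mu>) (p x) u\<bar>})"
    by (auto simp: window_def t)
  moreover have "closed \<dots>"
    by (intro closed_Int closed_INT ballI closed_Collect_le closed_Collect_eq continuous_intros
      hd_poly_continuous co p)
  ultimately show ?thesis by simp
qed

lemma window_has_derivative:
  fixes co :: "nat \<Rightarrow> 'a::euclidean_space \<Rightarrow> real"
  assumes "\<And>b. co b differentiable (at y0)" and w: "\<And>y. y \<in> E \<Longrightarrow> window co B t y (x y)"
    and cont: "continuous_on E x" and "y0 \<in> E"
  shows "\<exists>X. (x has_derivative X) (at y0 within E)"
proof -
  obtain \<mu> lo hi j where t: "t = (\<mu>, lo, hi, j)" by (cases t)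
  obtain L where L: "((\<lambda>z. hd_poly co B \<mu> (fst z) (snd z)) has_derivative L) (at (y0, x y0))"
    "L (0, 1) = hd_poly co B (Suc \<mu>) y0 (x y0)"
    using hd_poly_has_derivative[of co y0 B \<mu> "x y0"] assms(1) by blast
  have "1 / real (Suc j) \<le> \<bar>hd_poly co B (Suc \<mu>) y0 (x y0)\<bar>"
    using w[OF \<open>y0 \<in> E\<close>] by (simp add: window_def t)
  moreover have "0 < 1 / real (Suc j)" by simp
  ultimately have "L (0, 1) \<noteq> 0" using L(2) by linarith
  moreover have "hd_poly co B \<mu> (fst (y, x y)) (snd (y, x y)) = 0" if "y \<in> E" for y
    using w[OF that] by (simp add: window_def t)
  moreover have "continuous (at y0 within E) x" using cont \<open>y0 \<in> E\<close> by (simp add: continuous_on_eq_continuous_within)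
  ultimately show ?thesis
    using implicit_derivative[of "\<lambda>z. hd_poly co B \<mu> (fst z) (snd z)" L y0 x E] L(1) \<open>y0 \<in> E\<close> by blast
qed

text \<open>Locally the points of \<open>\<Gamma>\<close> are functions of their image \<open>y\<close>. Since \<open>G\<close> composed with such a section
  is the identity, Cauchy-Binet bounds \<open>1\<close> by \<open>J\<close> times the sum of the Jacobians of the projections
  of the section to \<open>CARD('k)\<close> coordinates.\<close>
lemma curve_image_bound:
  fixes G :: "'k::{finite,wellorder} \<Rightarrow> ('v::countable \<Rightarrow> real) \<Rightarrow> real"
  assumes \<Gamma>: "compact \<Gamma>" and C: "finite C" and G: "\<And>a. polyf C D (G a)"
    and \<rho>: "\<And>\<xi> c. \<xi> \<in> \<Gamma> \<Longrightarrow> c \<in> C \<Longrightarrow> \<bar>\<xi> c\<bar> \<le> \<rho>" "0 \<le> \<rho>"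
    and J: "0 \<le> J" "\<And>\<xi>. \<xi> \<in> \<Gamma> \<Longrightarrow> det (\<chi> a b. \<Sum>c\<in>C. pd c (G a) \<xi> * pd c (G b) \<xi>) \<le> J\<^sup>2"
    and co: "\<And>c b. c \<in> C \<Longrightarrow> co c b differentiable_on UNIV"
    and alg: "\<And>\<xi> c. \<xi> \<in> \<Gamma> \<Longrightarrow> c \<in> C \<Longrightarrow> hd_poly (co c) B 0 (\<chi> a. G a \<xi>) (\<xi> c) = 0"
    and Nn: "negligible Nn" "\<And>y c. y \<notin> Nn \<Longrightarrow> c \<in> C \<Longrightarrow> \<exists>b\<le>B. co c b y \<noteq> 0"
    and mult: "\<And>\<kappa> :: 'k \<Rightarrow> 'v. (\<And>a. \<kappa> a \<in> C) \<Longrightarrow> \<exists>Nk. negligible Nk \<and> (\<forall>z. z \<notin> Nk \<longrightarrow>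
      finite {\<xi>\<in>\<Gamma>. (\<chi> a. \<xi> (\<kappa> a)) = z} \<and> card {\<xi>\<in>\<Gamma>. (\<chi> a. \<xi> (\<kappa> a)) = z} \<le> P)"
  shows "emeasure lborel ((\<lambda>\<xi>. \<chi> a. G a \<xi>) ` \<Gamma>) \<le> ennreal (J * real (card C) ^ CARD('k) * (real P * (2 * \<rho>) ^ CARD('k)))"
proof -
  define Gv where "Gv \<xi> = (\<chi> a. G a \<xi>)" for \<xi>
  have contG: "continuous_on UNIV Gv"
    unfolding Gv_def by (intro continuous_on_vec_lambda polyf_continuous[OF G])
  have cc: "continuous_on UNIV (\<lambda>\<xi> :: 'v \<Rightarrow> real. \<xi> c)" for c
    by (rule continuous_on_subset[OF continuous_on_product_coordinates]) auto
  have cco: "continuous_on UNIV (co c b)" if "c \<in> C" for c b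
    using co[OF that] by (rule differentiable_imp_continuous_on)
  \<comment> \<open>One window for each coordinate; there are countably many choices because
    \<open>C\<close> is finite.\<close>
  define \<Theta> where "\<Theta> = PiE C (\<lambda>_. UNIV :: (nat \<times> rat \<times> rat \<times> nat) set)"
  have \<Theta>: "countable \<Theta>" "\<Theta> \<noteq> {}" unfolding \<Theta>_def using C by (auto intro!: countable_PiE simp: PiE_eq_empty_iff)
  define \<Gamma>t where "\<Gamma>t \<theta> = \<Gamma> \<inter> (\<Inter>c\<in>C. {\<xi>. window (co c) B (\<theta> c) (Gv \<xi>) (\<xi> c)})" for \<theta>
  have comp: "compact (\<Gamma>t \<theta>)" for \<theta>
    unfolding \<Gamma>t_def by (intro compact_Int_closed \<Gamma> closed_INT ballI closed_window cco contG cc)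
  have cover: "\<exists>\<theta>\<in>\<Theta>. \<xi> \<in> \<Gamma>t \<theta>" if "\<xi> \<in> \<Gamma>" "Gv \<xi> \<notin> Nn" for \<xi>
  proof -
    have "\<forall>c\<in>C. \<exists>t. window (co c) B t (Gv \<xi>) (\<xi> c)"
    proof (intro ballI window_exists)
      fix c assume "c \<in> C"
      then show "hd_poly (co c) B 0 (Gv \<xi>) (\<xi> c) = 0" "\<exists>b\<le>B. co c b (Gv \<xi>) \<noteq> 0"
        using alg[OF that(1)] Nn(2)[OF that(2)] by (auto simp: Gv_def)
    qed
    then obtain \<theta> where \<theta>: "\<forall>c\<in>C. window (co c) B (\<theta> c) (Gv \<xi>) (\<xi> c)" by (rule bchoice[THEN exE])
    then show ?thesis using that(1)
      by (intro bexI[of _ "restrict \<theta> C"]) (auto simp: \<Theta>_def \<Gamma>t_def)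
  qed
  have uniq: "\<xi> c = \<xi>' c" if "\<xi> \<in> \<Gamma>t \<theta>" "\<xi>' \<in> \<Gamma>t \<theta>" "Gv \<xi> = Gv \<xi>'" "c \<in> C" for \<theta> \<xi> \<xi>' c
  proof (rule window_unique)
    show "window (co c) B (\<theta> c) (Gv \<xi>) (\<xi> c)" using that by (auto simp: \<Gamma>t_def)
    show "window (co c) B (\<theta> c) (Gv \<xi>) (\<xi>' c)" using that by (auto simp: \<Gamma>t_def)
  qed
  define E where "E \<theta> = Gv ` \<Gamma>t \<theta>" for \<theta>
  define sel where "sel \<theta> y = (SOME \<xi>. \<xi> \<in> \<Gamma>t \<theta> \<and> Gv \<xi> = y)" for \<theta> y
  have sel: "sel \<theta> y \<in> \<Gamma>t \<theta>" "Gv (sel \<theta> y) = y" if "y \<in> E \<theta>" for \<theta> y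
  proof -
    have "\<exists>\<xi>. \<xi> \<in> \<Gamma>t \<theta> \<and> Gv \<xi> = y" using that by (auto simp: E_def)
    then have "sel \<theta> y \<in> \<Gamma>t \<theta> \<and> Gv (sel \<theta> y) = y" unfolding sel_def by (rule someI_ex)
    then show "sel \<theta> y \<in> \<Gamma>t \<theta>" "Gv (sel \<theta> y) = y" by auto
  qed
  have Ecomp: "compact (E \<theta>)" for \<theta>
    unfolding E_def by (rule compact_continuous_image[OF continuous_on_subset[OF contG] comp]) auto
  \<comment> \<open>The section is continuous because preimages of closed sets are images under
    \<open>Gv\<close> of compact subsets of \<open>\<Gamma>t \<theta>\<close>.\<close>
  have cont: "continuous_on (E \<theta>) (\<lambda>y. sel \<theta> y c)" if c: "c \<in> C" for \<theta> c
    unfolding continuous_on_closed_vimage[OF compact_imp_closed[OF Ecomp]]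
  proof (intro allI impI)
    fix F :: "real set" assume "closed F"
    have "(\<lambda>y. sel \<theta> y c) -` F \<inter> E \<theta> = Gv ` (\<Gamma>t \<theta> \<inter> (\<lambda>\<xi>. \<xi> c) -` F)"
    proof (intro equalityI subsetI)
      fix y assume "y \<in> (\<lambda>y. sel \<theta> y c) -` F \<inter> E \<theta>"
      then show "y \<in> Gv ` (\<Gamma>t \<theta> \<inter> (\<lambda>\<xi>. \<xi> c) -` F)"
        using sel[of y \<theta>] by (intro image_eqI[of _ _ "sel \<theta> y"]) auto
    next
      fix y assume "y \<in> Gv ` (\<Gamma>t \<theta> \<inter> (\<lambda>\<xi>. \<xi> c) -` F)"
      then obtain \<xi> where \<xi>: "\<xi> \<in> \<Gamma>t \<theta>" "\<xi> c \<in> F" "y = Gv \<xi>" by auto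
      then have "y \<in> E \<theta>" by (auto simp: E_def)
      moreover have "sel \<theta> y c = \<xi> c" using uniq[of "sel \<theta> y" \<theta> \<xi> c] sel[OF \<open>y \<in> E \<theta>\<close>] \<xi> c by simp
      ultimately show "y \<in> (\<lambda>y. sel \<theta> y c) -` F \<inter> E \<theta>" using \<xi> by simp
    qed
    moreover have "closed ((\<lambda>\<xi> :: 'v \<Rightarrow> real. \<xi> c) -` F)"
      by (rule closed_vimage[OF \<open>closed F\<close> cc])
    then have "compact (Gv ` (\<Gamma>t \<theta> \<inter> (\<lambda>\<xi>. \<xi> c) -` F))"
      by (intro compact_continuous_image[OF continuous_on_subset[OF contG]] compact_Int_closed comp) auto
    ultimately show "closed ((\<lambda>y. sel \<theta> y c) -` F \<inter> E \<theta>)" using compact_imp_closed by simp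
  qed
  have der: "\<exists>X. ((\<lambda>y. sel \<theta> y c) has_derivative X) (at y within E \<theta>)" if "y \<in> E \<theta>" "c \<in> C" for \<theta> y c
  proof (rule window_has_derivative)
    show "co c b differentiable (at y)" for b using co[OF that(2)] by (simp add: differentiable_on_def)
    show "window (co c) B (\<theta> c) y' (sel \<theta> y' c)" if "y' \<in> E \<theta>" for y'
      using sel[OF that] \<open>c \<in> C\<close> by (auto simp: \<Gamma>t_def)
  qed (use that cont in auto)
  define \<theta>s where "\<theta>s = from_nat_into \<Theta>"
  have \<theta>s: "\<exists>n. \<theta>s n = \<theta>" if "\<theta> \<in> \<Theta>" for \<theta>
    using from_nat_into_surj[OF \<Theta>(1) that] by (auto simp: \<theta>s_def)
  \<comment> \<open>The images overlap; disjoint pieces are needed to glue the sections into a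
    single map \<open>x\<close> and to add measures.\<close>
  define Ed where "Ed = disjointed (\<lambda>n. E (\<theta>s n))"
  have EdE: "Ed n \<subseteq> E (\<theta>s n)" for n unfolding Ed_def by (rule disjointed_subset)
  have Edd: "disjoint_family Ed" unfolding Ed_def by (rule disjoint_family_disjointed)
  have EdU: "(\<Union>n. Ed n) = (\<Union>n. E (\<theta>s n))" unfolding Ed_def by (rule UN_disjointed_eq)
  have Edb: "Ed n \<in> sets borel" for n
  proof -
    have "range (\<lambda>n. E (\<theta>s n)) \<subseteq> sets borel" using borel_compact[OF Ecomp] by blast
    then have "range Ed \<subseteq> sets borel" unfolding Ed_def by (rule sets.range_disjointed_sets)
    then show ?thesis by blast
  qed
  have EdR: "range Ed \<subseteq> sets lebesgue" using Edb by (simp add: image_subset_iff)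
  then have EdUl: "(\<Union>n. Ed n) \<in> sets lebesgue" by (rule sets.countable_nat_UN)
  define idx where "idx y = (THE n. y \<in> Ed n)" for y
  have idx: "idx y = n" if "y \<in> Ed n" for y n
    unfolding idx_def
  proof (rule the_equality)
    show "y \<in> Ed n" by (rule that)
    fix m assume "y \<in> Ed m"
    then show "m = n" using Edd that by (cases "m = n") (auto simp: disjoint_family_on_def)
  qed
  define x where "x y = sel (\<theta>s (idx y)) y" for y
  have x: "x y \<in> \<Gamma>" "Gv (x y) = y" if "y \<in> Ed n" for y n
    using sel[of y "\<theta>s n"] EdE that idx[OF that] by (auto simp: x_def \<Gamma>t_def)
  have "\<exists>X. ((\<lambda>y. x y c) has_derivative X) (at y within Ed (idx y))" if "y \<in> (\<Union>n. Ed n)" "c \<in> C" for y c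
  proof -
    obtain n where n: "y \<in> Ed n" using \<open>y \<in> (\<Union>n. Ed n)\<close> by blast
    obtain X where "((\<lambda>y. sel (\<theta>s n) y c) has_derivative X) (at y within E (\<theta>s n))"
      using der[of y "\<theta>s n" c] n EdE \<open>c \<in> C\<close> by blast
    then have "((\<lambda>y. sel (\<theta>s n) y c) has_derivative X) (at y within Ed n)"
      using EdE by (rule has_derivative_subset)
    then have "((\<lambda>y. x y c) has_derivative X) (at y within Ed n)"
      using n idx by (intro has_derivative_transform[of y "Ed n" "\<lambda>y. x y c" "\<lambda>y. sel (\<theta>s n) y c" X]) (simp_all add: x_def)
    then show ?thesis using idx[OF n] by auto
  qed
  then have "\<forall>y\<in>(\<Union>n. Ed n). \<forall>c\<in>C. \<exists>X. ((\<lambda>y. x y c) has_derivative X) (at y within Ed (idx y))" by blast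
  then obtain X where X: "\<And>y n c. y \<in> Ed n \<Longrightarrow> c \<in> C \<Longrightarrow> ((\<lambda>y. x y c) has_derivative X y c) (at y within Ed n)"
  proof -
    assume *: "\<And>X. (\<And>y n c. y \<in> Ed n \<Longrightarrow> c \<in> C \<Longrightarrow> ((\<lambda>y. x y c) has_derivative X y c) (at y within Ed n)) \<Longrightarrow> thesis"
      and ex: "\<forall>y\<in>(\<Union>n. Ed n). \<forall>c\<in>C. \<exists>X. ((\<lambda>y. x y c) has_derivative X) (at y within Ed (idx y))"
    define X where "X y c = (SOME X. ((\<lambda>y. x y c) has_derivative X) (at y within Ed (idx y)))" for y c
    show thesis
    proof (rule *)
      fix y n c assume y: "y \<in> Ed n" and c: "c \<in> C"
      then have "\<exists>X. ((\<lambda>y. x y c) has_derivative X) (at y within Ed (idx y))" using ex by blast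
      then have "((\<lambda>y. x y c) has_derivative X y c) (at y within Ed (idx y))" unfolding X_def by (rule someI_ex)
      then show "((\<lambda>y. x y c) has_derivative X y c) (at y within Ed n)" using idx[OF y] by simp
    qed
  qed
  define g where "g \<kappa> y = (\<chi> a. x y (\<kappa> a))" for \<kappa> :: "'k \<Rightarrow> 'v" and y
  define g' where "g' \<kappa> y v = (\<chi> a. X y (\<kappa> a) v)" for \<kappa> :: "'k \<Rightarrow> 'v" and y v
  have derg: "(g \<kappa> has_derivative g' \<kappa> y) (at y within Ed n)" if "\<forall>a. \<kappa> a \<in> C" "y \<in> Ed n" for \<kappa> y n
  proof -
    have "((\<lambda>y. \<chi> a. x y (\<kappa> a)) has_derivative (\<lambda>v. \<chi> a. X y (\<kappa> a) v)) (at y within Ed n)"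
      by (rule has_derivative_vec_lambda) (use X that in blast)
    moreover have "(\<lambda>y. \<chi> a. x y (\<kappa> a)) = g \<kappa>" "(\<lambda>v. \<chi> a. X y (\<kappa> a) v) = g' \<kappa> y"
      by (simp_all add: fun_eq_iff g_def g'_def)
    ultimately show ?thesis by simp
  qed
  define Bx where "Bx = cbox (\<chi> a::'k. - \<rho>) (\<chi> a. \<rho>)"
  have Bx: "emeasure lebesgue Bx = ennreal ((2 * \<rho>) ^ CARD('k))"
  proof -
    have "emeasure lebesgue Bx = emeasure lborel Bx" by (simp add: Bx_def)
    also have "\<dots> = ennreal (\<Prod>b\<in>Basis. ((\<chi> a. \<rho>) - (\<chi> a. - \<rho>)) \<bullet> (b :: real^'k::{finite,wellorder}))"
      unfolding Bx_def using \<rho>(2) by (intro emeasure_lborel_cbox) (auto simp: Basis_vec_def inner_axis)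
    also have "(\<Prod>b\<in>Basis. ((\<chi> a. \<rho>) - (\<chi> a. - \<rho>)) \<bullet> (b :: real^'k::{finite,wellorder})) = (\<Prod>b\<in>(Basis :: (real^'k::{finite,wellorder}) set). 2 * \<rho>)"
      by (intro prod.cong) (auto simp: Basis_vec_def inner_axis)
    finally show ?thesis by simp
  qed
  have area: "(\<Sum>n. \<integral>\<^sup>+ y. ennreal \<bar>det (matrix (g' \<kappa> y))\<bar> * indicator (Ed n) y \<partial>lborel) \<le> of_nat P * emeasure lebesgue Bx"
    if \<kappa>: "\<forall>a. \<kappa> a \<in> C" for \<kappa>
  proof -
    obtain Nk where Nk: "negligible Nk" "\<And>z. z \<notin> Nk \<Longrightarrow>
      finite {\<xi>\<in>\<Gamma>. (\<chi> a. \<xi> (\<kappa> a)) = z} \<and> card {\<xi>\<in>\<Gamma>. (\<chi> a. \<xi> (\<kappa> a)) = z} \<le> P"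
      using mult[of \<kappa>] \<kappa> by blast
    show ?thesis
    proof (rule area_inequality[where g = "g \<kappa>" and N = Nk])
      show "Ed n \<in> sets lebesgue" for n using Edb by auto
      show "disjoint_family Ed" by (rule Edd)
      show "(g \<kappa> has_derivative g' \<kappa> y) (at y within Ed n)" if "y \<in> Ed n" for y n using derg \<kappa> that by blast
      show "Bx \<in> lmeasurable" by (simp add: Bx_def)
      show "g \<kappa> ` Ed n \<subseteq> Bx" for n
      proof
        fix z assume "z \<in> g \<kappa> ` Ed n"
        then obtain y where y: "y \<in> Ed n" "z = g \<kappa> y" by blast
        have "\<bar>x y (\<kappa> a)\<bar> \<le> \<rho>" for a using \<rho>(1)[OF x(1)[OF y(1)]] \<kappa> by blast
        then show "z \<in> Bx" by (simp add: Bx_def mem_box_cart y(2) g_def abs_le_iff minus_le_iff)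
      qed
      fix z assume z: "z \<notin> Nk"
      let ?Y = "{y\<in>(\<Union>n. Ed n). g \<kappa> y = z}" and ?F = "{\<xi>\<in>\<Gamma>. (\<chi> a. \<xi> (\<kappa> a)) = z}"
      \<comment> \<open>\<open>Gv\<close> recovers \<open>y\<close> from \<open>x y\<close>, so the
        multiplicity of the projection on \<Gamma> bounds that of \<open>g \<kappa>\<close>.\<close>
      have inj: "inj_on x ?Y"
      proof (rule inj_onI)
        fix y y' assume "y \<in> ?Y" "y' \<in> ?Y" "x y = x y'"
        then show "y = y'" using x(2) by (metis (no_types, lifting) UN_E mem_Collect_eq)
      qed
      moreover have "x ` ?Y \<subseteq> ?F" using x(1) by (auto simp: g_def)
      ultimately show "finite ?Y \<and> card ?Y \<le> P"
        using Nk(2)[OF z] inj_on_finite[OF inj, of ?F] card_inj_on_le[OF inj, of ?F] by auto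
    qed (use Nk in auto)
  qed
  \<comment> \<open>The chain rule for \<open>Gv\<close> after the section, whose composition is the
    identity. \<open>L\<close> is a derivative of the identity within \<open>Ed n\<close> only and
    is not claimed to be the identity itself.\<close>
  define L where "L y v = (\<chi> a. \<Sum>c\<in>C. pd c (G a) (x y) * X y c v)" for y v
  have derL: "((\<lambda>y. y) has_derivative L y) (at y within Ed n)" if "y \<in> Ed n" for y n
  proof -
    have "((\<lambda>y. \<chi> a. G a (x y)) has_derivative (\<lambda>v. \<chi> a. \<Sum>c\<in>C. pd c (G a) (x y) * X y c v)) (at y within Ed n)"
      by (intro has_derivative_vec_lambda has_derivative_polyf[OF G C]) (use X that in blast)
    moreover have "(\<lambda>v. \<chi> a. \<Sum>c\<in>C. pd c (G a) (x y) * X y c v) = L y"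
      by (simp add: fun_eq_iff L_def)
    ultimately have "((\<lambda>y. \<chi> a. G a (x y)) has_derivative L y) (at y within Ed n)" by simp
    then show ?thesis
      by (rule has_derivative_transform[rotated 2]) (use that x(2) in \<open>auto simp: Gv_def\<close>)
  qed
  let ?K = "{\<kappa>. \<forall>a::'k. \<kappa> a \<in> C}"
  \<comment> \<open>Cauchy-Binet for the two factors of \<open>L\<close>: the minors of the first
    are bounded by \<open>minor_le_gram\<close>, and the factorials cancel.\<close>
  have detL: "\<bar>det (matrix (L y))\<bar> \<le> J * (\<Sum>\<kappa>\<in>?K. \<bar>det (matrix (g' \<kappa> y))\<bar>)" if "y \<in> Ed n" for y n
  proof -
    let ?A = "\<lambda>a c. pd c (G a) (x y)" and ?B = "\<lambda>c b. X y c (axis b 1)"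
    have mg: "matrix (g' \<kappa> y) = (\<chi> a b. ?B (\<kappa> a) b)" for \<kappa>
      by (simp add: matrix_def g'_def vec_eq_iff)
    have "matrix (L y) = (\<chi> a b. \<Sum>c\<in>C. ?A a c * ?B c b)"
      by (simp add: matrix_def L_def vec_eq_iff)
    then have "fact CARD('k) * det (matrix (L y)) = (\<Sum>\<kappa>\<in>?K. det (\<chi> a b. ?A a (\<kappa> b)) * det (matrix (g' \<kappa> y)))"
      using cauchy_binet[OF C, of ?A ?B] by (simp add: mg)
    then have "fact CARD('k) * \<bar>det (matrix (L y))\<bar> = \<bar>\<Sum>\<kappa>\<in>?K. det (\<chi> a b. ?A a (\<kappa> b)) * det (matrix (g' \<kappa> y))\<bar>"
      by (metis abs_mult abs_of_nonneg fact_ge_zero)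
    also have "\<dots> \<le> (\<Sum>\<kappa>\<in>?K. \<bar>det (\<chi> a b. ?A a (\<kappa> b)) * det (matrix (g' \<kappa> y))\<bar>)" by (rule sum_abs)
    also have "\<dots> \<le> (\<Sum>\<kappa>\<in>?K. (fact CARD('k) * J) * \<bar>det (matrix (g' \<kappa> y))\<bar>)"
      unfolding abs_mult using J x(1)[OF that]
      by (intro sum_mono mult_right_mono minor_le_gram[OF C]) auto
    also have "\<dots> = fact CARD('k) * (J * (\<Sum>\<kappa>\<in>?K. \<bar>det (matrix (g' \<kappa> y))\<bar>))"
      by (simp add: sum_distrib_left mult.assoc)
    finally show ?thesis by (simp del: fact_Suc)
  qed
  have Edm: "emeasure lebesgue (Ed n) \<le> (\<Sum>\<kappa>\<in>?K. ennreal J * (\<integral>\<^sup>+ y. ennreal \<bar>det (matrix (g' \<kappa> y))\<bar> * indicator (Ed n) y \<partial>lborel))" for n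
  proof -
    have Em: "Ed n \<in> lmeasurable"
      using Edb bounded_subset[OF compact_imp_bounded[OF Ecomp] EdE] by (intro bounded_set_imp_lmeasurable) auto
    \<comment> \<open>Change of variables for the identity map with derivative \<open>L\<close>
      turns the measure of \<open>Ed n\<close> into an integral of the determinant.\<close>
    then have "((\<lambda>y. \<bar>det (matrix (L y))\<bar>) has_integral measure lebesgue (Ed n)) (Ed n)"
      using has_measure_differentiable_image[of "Ed n" "\<lambda>y. y" L "measure lebesgue (Ed n)"] derL Edb by auto
    then have "(\<integral>\<^sup>+ y. ennreal \<bar>det (matrix (L y))\<bar> * indicator (Ed n) y \<partial>lborel) = ennreal (measure lebesgue (Ed n))"
      by (intro nn_integral_has_integral_lebesgue') auto
    then have "emeasure lebesgue (Ed n) = (\<integral>\<^sup>+ y. ennreal \<bar>det (matrix (L y))\<bar> * indicator (Ed n) y \<partial>lebesgue)"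
      using Em by (simp add: emeasure_eq_measure2 fmeasurableD nn_integral_completion)
    also have "\<dots> \<le> (\<integral>\<^sup>+ y. (\<Sum>\<kappa>\<in>?K. ennreal J * (ennreal \<bar>det (matrix (g' \<kappa> y))\<bar> * indicator (Ed n) y)) \<partial>lebesgue)"
    proof (rule nn_integral_mono)
      fix y
      show "ennreal \<bar>det (matrix (L y))\<bar> * indicator (Ed n) y \<le> (\<Sum>\<kappa>\<in>?K. ennreal J * (ennreal \<bar>det (matrix (g' \<kappa> y))\<bar> * indicator (Ed n) y))"
      proof (cases "y \<in> Ed n")
        case True
        have "ennreal \<bar>det (matrix (L y))\<bar> \<le> ennreal (J * (\<Sum>\<kappa>\<in>?K. \<bar>det (matrix (g' \<kappa> y))\<bar>))"
          using detL[OF True] by (rule ennreal_leI)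
        also have "\<dots> = (\<Sum>\<kappa>\<in>?K. ennreal J * ennreal \<bar>det (matrix (g' \<kappa> y))\<bar>)"
          using J by (simp add: ennreal_mult' sum_distrib_left[symmetric] sum_ennreal sum_nonneg)
        finally show ?thesis using True by simp
      qed simp
    qed
    also have "\<dots> = (\<Sum>\<kappa>\<in>?K. ennreal J * (\<integral>\<^sup>+ y. ennreal \<bar>det (matrix (g' \<kappa> y))\<bar> * indicator (Ed n) y \<partial>lebesgue))"
    proof -
      have m: "(\<lambda>y. ennreal \<bar>det (matrix (g' \<kappa> y))\<bar> * indicator (Ed n) y) \<in> borel_measurable lebesgue" if "\<kappa> \<in> ?K" for \<kappa>
        using derg that Edb by (intro borel_measurable_abs_det[of _ "g \<kappa>"]) auto
      then show ?thesis by (subst nn_integral_sum) (auto simp: nn_integral_cmult)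
    qed
    finally show ?thesis by (simp only: nn_integral_completion)
  qed
  have "Gv ` \<Gamma> \<in> sets borel"
    using compact_continuous_image[OF continuous_on_subset[OF contG] \<Gamma>] by (simp add: compact_imp_closed)
  then have "emeasure lborel (Gv ` \<Gamma>) = emeasure lebesgue (Gv ` \<Gamma>)" by simp
  also have "\<dots> \<le> emeasure lebesgue (Nn \<union> (\<Union>n. Ed n))"
  proof (rule emeasure_mono)
    show "Gv ` \<Gamma> \<subseteq> Nn \<union> (\<Union>n. Ed n)"
    proof
      fix y assume "y \<in> Gv ` \<Gamma>"
      then obtain \<xi> where \<xi>: "\<xi> \<in> \<Gamma>" "y = Gv \<xi>" by blast
      show "y \<in> Nn \<union> (\<Union>n. Ed n)"
      proof (cases "y \<in> Nn")
        case False
        then obtain \<theta> where "\<theta> \<in> \<Theta>" "\<xi> \<in> \<Gamma>t \<theta>" using cover \<xi> by blast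
        moreover then obtain n where "\<theta>s n = \<theta>" using \<theta>s by blast
        ultimately have "y \<in> E (\<theta>s n)" using \<xi> by (auto simp: E_def)
        then show ?thesis using EdU by blast
      qed simp
    qed
    show "Nn \<union> (\<Union>n. Ed n) \<in> sets lebesgue"
      by (intro sets.Un negligible_imp_sets Nn EdUl)
  qed
  also have "\<dots> \<le> emeasure lebesgue Nn + emeasure lebesgue (\<Union>n. Ed n)"
  proof (rule emeasure_subadditive)
    show "Nn \<in> sets lebesgue" by (rule negligible_imp_sets[OF Nn(1)])
    show "(\<Union>n. Ed n) \<in> sets lebesgue" by (rule EdUl)
  qed
  also have "\<dots> = (\<Sum>n. emeasure lebesgue (Ed n))"
  proof -
    have "emeasure lebesgue Nn = 0" using Nn(1) negligible_iff_emeasure0 negligible_imp_sets by blast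
    moreover have "(\<Sum>n. emeasure lebesgue (Ed n)) = emeasure lebesgue (\<Union>n. Ed n)" by (rule suminf_emeasure[OF EdR Edd])
    ultimately show ?thesis by simp
  qed
  also have "\<dots> \<le> (\<Sum>n. \<Sum>\<kappa>\<in>?K. ennreal J * (\<integral>\<^sup>+ y. ennreal \<bar>det (matrix (g' \<kappa> y))\<bar> * indicator (Ed n) y \<partial>lborel))"
    by (intro suminf_le Edm) auto
  also have "\<dots> = (\<Sum>\<kappa>\<in>?K. ennreal J * (\<Sum>n. \<integral>\<^sup>+ y. ennreal \<bar>det (matrix (g' \<kappa> y))\<bar> * indicator (Ed n) y \<partial>lborel))"
    by (subst suminf_sum) auto
  also have "\<dots> \<le> (\<Sum>\<kappa>\<in>?K. ennreal J * (of_nat P * emeasure lebesgue Bx))"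
    using area by (intro sum_mono mult_left_mono) auto
  also have "\<dots> = ennreal (J * real (card C) ^ CARD('k) * (real P * (2 * \<rho>) ^ CARD('k)))"
    unfolding Bx using J \<rho>(2) by (simp add: card_maps[OF C] ennreal_of_nat_eq_real_of_nat ennreal_mult'[symmetric] mult_ac ennreal_power)
  finally show ?thesis by (simp add: Gv_def[abs_def])
qed

section \<open>Approximation by generic curves\<close>

lemma thin_zeros: "\<alpha> \<in> exps V K \<Longrightarrow> u \<alpha> \<noteq> 0 \<Longrightarrow> thin V {\<tau>. (\<Sum>\<alpha>\<in>exps V K. u \<alpha> * pwr V \<alpha> \<tau>) = 0}"
  unfolding thin_def by (intro exI[of _ "{(K, u)}"]) auto

lemma emb_has_derivative:
  fixes N :: "'k::finite \<Rightarrow> 'v"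
  shows "((\<lambda>y. emb N \<tau> y v) has_derivative (\<lambda>d. if v \<in> range N then d $ inv N v else 0)) (at y within E)"
proof (cases "v \<in> range N")
  case True
  have "((\<lambda>y. y $ inv N v) has_derivative (\<lambda>d. d $ inv N v)) (at y within E)"
    by (intro bounded_linear_imp_has_derivative bounded_linear_vec_nth)
  then show ?thesis using True by (simp add: emb_def)
qed (simp add: emb_def)

text \<open>The equations \<open>f v = \<tau> v\<close> are \<open>CARD('k)\<close> short of the
  number of unknowns. Completing them by \<open>G\<close> gives the algebraic relations for the
  coordinates; completing them by coordinates gives the multiplicity of a projection. All
  exceptional sets are thin in the joint space of \<tau> and the slice, so one \<tau> serves them
  all.\<close>

lemma generic_curve_image:
  fixes f :: "'v::countable \<Rightarrow> ('v \<Rightarrow> real) \<Rightarrow> real" and G :: "'k::{finite,wellorder} \<Rightarrow> ('v \<Rightarrow> real) \<Rightarrow> real" and N :: "'k \<Rightarrow> 'v"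
  assumes V: "finite V" and N: "inj N" "V \<inter> range N = {}" and D: "1 \<le> D"
    and f: "\<And>v. v \<in> V \<Longrightarrow> polyf (V \<union> range N) D (f v)"
    and C: "C \<subseteq> V \<union> range N" and G: "\<And>a. polyf C D (G a)"
    and \<Omega>: "compact \<Omega>" "\<Omega> \<subseteq> RV (V \<union> range N)"
    and \<rho>: "\<And>\<xi> c. \<xi> \<in> \<Omega> \<Longrightarrow> c \<in> C \<Longrightarrow> \<bar>\<xi> c\<bar> \<le> \<rho>" "0 \<le> \<rho>"
    and J: "0 \<le> J" "\<And>\<xi>. \<xi> \<in> \<Omega> \<Longrightarrow> det (\<chi> a b. \<Sum>c\<in>C. pd c (G a) \<xi> * pd c (G b) \<xi>) \<le> J\<^sup>2"
    and A: "\<And>v. infinite (A v)"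
  shows "\<exists>\<tau>\<in>RV V. (\<forall>v\<in>V. \<tau> v \<in> A v) \<and> emeasure lborel ((\<lambda>\<xi>. \<chi> a. G a \<xi>) ` {\<xi>\<in>\<Omega>. \<forall>v\<in>V. f v \<xi> = \<tau> v})
    \<le> ennreal (J * real (card C) ^ CARD('k) * (real (D ^ card (V \<union> range N)) * (2 * \<rho>) ^ CARD('k)))"
proof -
  let ?W = "V \<union> range N"
  have W: "finite ?W" using V by simp
  have finC: "finite C" using C W finite_subset by blast
  \<comment> \<open>The square system: the indices in \<open>range N\<close> carry the components of
    \<open>G\<close>.\<close>
  define F where "F v = (if v \<in> range N then G (inv N v) else f v)" for v
  define P where "P = D ^ card ?W"
  have GW: "polyf ?W D (G a)" for a using G C by (rule polyf_mono[OF _ order_refl])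
  have F: "polyf ?W D (F v)" if "v \<in> ?W" for v using that f GW by (auto simp: F_def)
  have "\<exists>K w. (\<exists>\<alpha>\<in>exps ?W K. \<exists>b\<le>P. w \<alpha> b \<noteq> 0) \<and>
      (\<forall>x. (\<Sum>\<alpha>\<in>exps ?W K. \<Sum>b\<le>P. w \<alpha> b * (pwr ?W \<alpha> (\<lambda>v. F v x) * x c ^ b)) = 0)" if "c \<in> C" for c
    unfolding P_def
  proof (rule algebraic_dependence[OF W D F])
    show "polyf ?W 1 (\<lambda>x. x c)" using that C by (intro polyf_var') auto
  qed
  then have "\<forall>c\<in>C. \<exists>K w. (\<exists>\<alpha>\<in>exps ?W K. \<exists>b\<le>P. w \<alpha> b \<noteq> 0) \<and>
      (\<forall>x. (\<Sum>\<alpha>\<in>exps ?W K. \<Sum>b\<le>P. w \<alpha> b * (pwr ?W \<alpha> (\<lambda>v. F v x) * x c ^ b)) = 0)" by blast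
  then obtain K where "\<forall>c\<in>C. \<exists>w. (\<exists>\<alpha>\<in>exps ?W (K c). \<exists>b\<le>P. w \<alpha> b \<noteq> 0) \<and>
      (\<forall>x. (\<Sum>\<alpha>\<in>exps ?W (K c). \<Sum>b\<le>P. w \<alpha> b * (pwr ?W \<alpha> (\<lambda>v. F v x) * x c ^ b)) = 0)" by (rule bchoice[THEN exE])
  then obtain w where w: "\<forall>c\<in>C. (\<exists>\<alpha>\<in>exps ?W (K c). \<exists>b\<le>P. w c \<alpha> b \<noteq> 0) \<and>
      (\<forall>x. (\<Sum>\<alpha>\<in>exps ?W (K c). \<Sum>b\<le>P. w c \<alpha> b * (pwr ?W \<alpha> (\<lambda>v. F v x) * x c ^ b)) = 0)" by (rule bchoice[THEN exE])
  have "\<forall>c\<in>C. \<exists>b. b \<le> P \<and> (\<exists>\<alpha>\<in>exps ?W (K c). w c \<alpha> b \<noteq> 0)"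
  proof
    fix c assume "c \<in> C"
    from bspec[OF w this] show "\<exists>b. b \<le> P \<and> (\<exists>\<alpha>\<in>exps ?W (K c). w c \<alpha> b \<noteq> 0)" by blast
  qed
  \<comment> \<open>For each coordinate, one coefficient polynomial that is not identically zero;
    its zero set is avoided.\<close>
  then obtain b where b: "\<forall>c\<in>C. b c \<le> P \<and> (\<exists>\<alpha>\<in>exps ?W (K c). w c \<alpha> (b c) \<noteq> 0)" by (rule bchoice[THEN exE])
  define Zc where "Zc c = {\<tau>. (\<Sum>\<alpha>\<in>exps ?W (K c). w c \<alpha> (b c) * pwr ?W \<alpha> \<tau>) = 0}" for c
  have Zc: "thin ?W (Zc c)" if c: "c \<in> C" for c
  proof -
    obtain \<alpha> where "\<alpha> \<in> exps ?W (K c)" "w c \<alpha> (b c) \<noteq> 0" using bspec[OF b c] by blast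
    then show ?thesis unfolding Zc_def by (rule thin_zeros)
  qed
  \<comment> \<open>The same system with the coordinates selected by \<kappa> in place of
    \<open>G\<close>; its fibres contain those of the projection.\<close>
  define Fk where "Fk \<kappa> v = (if v \<in> range N then (\<lambda>\<xi>. \<xi> (\<kappa> (inv N v))) else f v)" for \<kappa> :: "'k \<Rightarrow> 'v" and v
  define Zk where "Zk \<kappa> = {\<tau>. \<not> (finite {x\<in>RV ?W. \<forall>v\<in>?W. Fk \<kappa> v x = \<tau> v} \<and> card {x\<in>RV ?W. \<forall>v\<in>?W. Fk \<kappa> v x = \<tau> v} \<le> D ^ card ?W)}" for \<kappa>
  let ?K = "{\<kappa>. \<forall>a::'k. \<kappa> a \<in> C}"
  have Zk: "thin ?W (Zk \<kappa>)" if \<kappa>: "\<kappa> \<in> ?K" for \<kappa>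
    unfolding Zk_def
  proof (rule generic_fibre[OF W D])
    fix v assume v: "v \<in> ?W"
    show "polyf ?W D (Fk \<kappa> v)"
    proof (cases "v \<in> range N")
      case True
      then show ?thesis unfolding Fk_def using D \<kappa> C by (auto intro!: polyf_var')
    next
      case False
      then show ?thesis unfolding Fk_def using v f by simp
    qed
  qed
  define Z where "Z = (\<Union>c\<in>C. Zc c) \<union> (\<Union>\<kappa>\<in>?K. Zk \<kappa>)"
  have thinZ: "thin ?W Z" unfolding Z_def
    by (intro thin_Un thin_UN Zc Zk finC finite_maps)
  obtain \<tau> where \<tau>: "\<tau> \<in> RV V" "\<forall>v\<in>V. \<tau> v \<in> A v" "negligible {y. emb N \<tau> y \<in> Z}"
    using generic_slice[OF V N thinZ, of A] A by blast
  let ?\<Gamma> = "{\<xi>\<in>\<Omega>. \<forall>v\<in>V. f v \<xi> = \<tau> v}"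
  let ?Nn = "{y. emb N \<tau> y \<in> Z}"
  \<comment> \<open>With \<tau> fixed, the coefficients are polynomials in the target alone.\<close>
  define co where "co c b y = (\<Sum>\<alpha>\<in>exps ?W (K c). w c \<alpha> b * pwr ?W \<alpha> (emb N \<tau> y))" for c b y
  have notN: "v \<notin> range N" if "v \<in> V" for v using that N(2) by blast
  have "emeasure lborel ((\<lambda>\<xi>. \<chi> a. G a \<xi>) ` ?\<Gamma>) \<le> ennreal (J * real (card C) ^ CARD('k) * (real P * (2 * \<rho>) ^ CARD('k)))"
  proof (rule curve_image_bound[where co = co and B = P and Nn = ?Nn])
    have "?\<Gamma> = \<Omega> \<inter> (\<Inter>v\<in>V. {\<xi>. f v \<xi> = \<tau> v})" by auto
    moreover have "compact (\<Omega> \<inter> (\<Inter>v\<in>V. {\<xi>. f v \<xi> = \<tau> v}))"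
      by (intro compact_Int_closed \<Omega> closed_INT ballI closed_Collect_eq continuous_intros polyf_continuous[OF f])
    ultimately show "compact ?\<Gamma>" by simp
    show "finite C" by (rule finC)
    show "polyf C D (G a)" for a by (rule G)
    show "\<bar>\<xi> c\<bar> \<le> \<rho>" if "\<xi> \<in> ?\<Gamma>" "c \<in> C" for \<xi> c using \<rho>(1) that by blast
    show "det (\<chi> a b. \<Sum>c\<in>C. pd c (G a) \<xi> * pd c (G b) \<xi>) \<le> J\<^sup>2" if "\<xi> \<in> ?\<Gamma>" for \<xi> using J(2) that by blast
    show "co c b differentiable_on UNIV" for c b
      unfolding differentiable_on_def
    proof
      fix y :: "real^'k::{finite,wellorder}"
      have p: "polyf ?W (1 * K c) (\<lambda>x. pwr ?W \<alpha> x)" if "\<alpha> \<in> exps ?W (K c)" for \<alpha>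
        by (rule polyf_pwr[OF W that]) (rule polyf_var', auto)
      have "(\<lambda>y. pwr ?W \<alpha> (emb N \<tau> y)) differentiable (at y)" if "\<alpha> \<in> exps ?W (K c)" for \<alpha>
        unfolding differentiable_def
        by (rule exI, rule has_derivative_polyf[OF p[OF that] W]) (rule emb_has_derivative)
      then have "(\<lambda>y. \<Sum>\<alpha>\<in>exps ?W (K c). w c \<alpha> b * pwr ?W \<alpha> (emb N \<tau> y)) differentiable (at y)"
        using W by (intro differentiable_sum ballI differentiable_mult) auto
      moreover have "co c b = (\<lambda>y. \<Sum>\<alpha>\<in>exps ?W (K c). w c \<alpha> b * pwr ?W \<alpha> (emb N \<tau> y))"
        by (simp add: fun_eq_iff co_def)
      ultimately show "co c b differentiable (at y)" by simp
    qed
    show "hd_poly (co c) P 0 (\<chi> a. G a \<xi>) (\<xi> c) = 0" if "\<xi> \<in> ?\<Gamma>" "c \<in> C" for \<xi> c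
    proof -
      have F': "F v \<xi> = emb N \<tau> (\<chi> a. G a \<xi>) v" if "v \<in> ?W" for v
        using \<open>\<xi> \<in> ?\<Gamma>\<close> that N(1) notN by (auto simp: F_def emb_def)
      then have "pwr ?W \<alpha> (\<lambda>v. F v \<xi>) = pwr ?W \<alpha> (emb N \<tau> (\<chi> a. G a \<xi>))" for \<alpha>
        unfolding pwr_def by (intro prod.cong refl) simp
      moreover have "(\<Sum>\<alpha>\<in>exps ?W (K c). \<Sum>b\<le>P. w c \<alpha> b * (pwr ?W \<alpha> (\<lambda>v. F v \<xi>) * \<xi> c ^ b)) = 0"
        using bspec[OF w \<open>c \<in> C\<close>] by blast
      ultimately have "(\<Sum>\<alpha>\<in>exps ?W (K c). \<Sum>b\<le>P. w c \<alpha> b * (pwr ?W \<alpha> (emb N \<tau> (\<chi> a. G a \<xi>)) * \<xi> c ^ b)) = 0"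
        by simp
      then show ?thesis unfolding hd_poly_0 co_def sum_distrib_right
        by (subst sum.swap) (simp add: mult.assoc)
    qed
    show "negligible ?Nn" by (rule \<tau>(3))
    show "\<exists>b\<le>P. co c b y \<noteq> 0" if "y \<notin> ?Nn" "c \<in> C" for y c
    proof -
      have "emb N \<tau> y \<notin> Zc c" using that by (auto simp: Z_def)
      then have "co c (b c) y \<noteq> 0" by (simp add: Zc_def co_def)
      then show ?thesis using bspec[OF b that(2)] by blast
    qed
    show "\<exists>Nk. negligible Nk \<and> (\<forall>z. z \<notin> Nk \<longrightarrow>
      finite {\<xi>\<in>?\<Gamma>. (\<chi> a. \<xi> (\<kappa> a)) = z} \<and> card {\<xi>\<in>?\<Gamma>. (\<chi> a. \<xi> (\<kappa> a)) = z} \<le> P)" if \<kappa>: "\<And>a. \<kappa> a \<in> C" for \<kappa> :: "'k \<Rightarrow> 'v"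
    proof (intro exI[of _ ?Nn] conjI allI impI)
      show "negligible ?Nn" by (rule \<tau>(3))
      fix z assume "z \<notin> ?Nn"
      then have "emb N \<tau> z \<notin> Zk \<kappa>" using \<kappa> by (auto simp: Z_def)
      then have fin: "finite {x\<in>RV ?W. \<forall>v\<in>?W. Fk \<kappa> v x = emb N \<tau> z v}" "card {x\<in>RV ?W. \<forall>v\<in>?W. Fk \<kappa> v x = emb N \<tau> z v} \<le> P"
        by (auto simp: Zk_def P_def)
      have sub: "{\<xi>\<in>?\<Gamma>. (\<chi> a. \<xi> (\<kappa> a)) = z} \<subseteq> {x\<in>RV ?W. \<forall>v\<in>?W. Fk \<kappa> v x = emb N \<tau> z v}"
        using \<Omega>(2) N(1) notN by (auto simp: Fk_def emb_def)
      show "finite {\<xi>\<in>?\<Gamma>. (\<chi> a. \<xi> (\<kappa> a)) = z}" by (rule finite_subset[OF sub fin(1)])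
      show "card {\<xi>\<in>?\<Gamma>. (\<chi> a. \<xi> (\<kappa> a)) = z} \<le> P" using card_mono[OF fin(1) sub] fin(2) by simp
    qed
  qed (use \<rho> J in auto)
  then show ?thesis using \<tau> unfolding P_def by blast
qed

lemma pd_notin: "polyf C D f \<Longrightarrow> c \<notin> C \<Longrightarrow> pd c f x = 0"
proof -
  assume f: "polyf C D f" and c: "c \<notin> C"
  have "f (x(c := t)) = f x" for t by (rule polyf_cong[OF f]) (use c in auto)
  then show ?thesis by (simp add: pd_def)
qed

lemma ennreal_le_limit:
  fixes \<phi> :: "real \<Rightarrow> real"
  assumes "\<And>\<delta>. 0 < \<delta> \<Longrightarrow> X \<le> ennreal (\<phi> \<delta>)" "isCont \<phi> 0"
  shows "X \<le> ennreal (\<phi> 0)"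
proof (rule LIMSEQ_le_const)
  have "(\<lambda>n. \<phi> (inverse (real (Suc n)))) \<longlonglongrightarrow> \<phi> 0"
    using assms(2) by (rule isCont_tendsto_compose) (rule LIMSEQ_inverse_real_of_nat)
  then show "(\<lambda>n. ennreal (\<phi> (inverse (real (Suc n))))) \<longlonglongrightarrow> ennreal (\<phi> 0)" by (rule tendsto_ennrealI)
  show "\<exists>n0. \<forall>n\<ge>n0. X \<le> ennreal (\<phi> (inverse (real (Suc n))))" using assms(1) by simp
qed

text \<open>The points of the image are reached, up to the error \<open>\<epsilon> u\<close>, by the minima of
  \<open>h - \<tau> x + \<bar>F x - y\<bar>\<^sup>2\<close>, which lie on the curve of the equations \<open>f v = \<tau> v\<close> below.\<close>
lemma image_measure_bound:
  fixes F :: "'k::{finite,wellorder} \<Rightarrow> ('v::countable \<Rightarrow> real) \<Rightarrow> real" and N :: "'k \<Rightarrow> 'v"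
  assumes V: "finite V" and N: "inj N" "V \<inter> range N = {}" and D: "1 \<le> D"
    and h: "polyf V D h" and nonneg: "\<And>x. x \<in> RV V \<Longrightarrow> 0 \<le> h x"
    and bd: "\<And>x v. x \<in> RV V \<Longrightarrow> h x = 0 \<Longrightarrow> v \<in> V \<Longrightarrow> \<bar>x v\<bar> < R"
    and C: "C \<subseteq> V" and F: "\<And>a. polyf C D (F a)"
    and \<rho>: "\<And>x c. x \<in> RV V \<Longrightarrow> h x = 0 \<Longrightarrow> c \<in> C \<Longrightarrow> \<bar>x c\<bar> \<le> \<rho>" "1 \<le> \<rho>"
    and J: "0 \<le> J" "\<And>x. x \<in> RV V \<Longrightarrow> h x = 0 \<Longrightarrow> det (\<chi> a b. \<Sum>c\<in>C. pd c (F a) x * pd c (F b) x) \<le> J\<^sup>2"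
  shows "emeasure lborel ((\<lambda>x. \<chi> a. F a x) ` {x\<in>RV V. h x = 0})
    \<le> ennreal (J * real (card C + CARD('k)) ^ CARD('k) * (real ((2 * D) ^ (card V + CARD('k))) * (2 * \<rho>) ^ CARD('k)))"
proof -
  let ?W = "V \<union> range N"
  let ?k = "CARD('k)"
  let ?S = "{x\<in>RV V. h x = 0}"
  \<comment> \<open>The claimed bound with \<open>J\<close> and \<open>\<rho>\<close> relaxed by
    \<delta>, which is all that the perturbed curve satisfies; \<delta> tends to 0 at the
    end.\<close>
  define \<phi> where "\<phi> \<delta> = (J + \<delta>) * real (card C + ?k) ^ ?k * (real ((2 * D) ^ (card V + ?k)) * (2 * (\<rho> + \<delta>)) ^ ?k)" for \<delta>
  have finC: "finite C" using C V finite_subset by blast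
  have cardW: "card ?W = card V + ?k" using N V by (simp add: card_Un_disjoint card_image)
  have cardC: "card (C \<union> range N) = card C + ?k" using N V C finC by (subst card_Un_disjoint) (auto simp: card_image)
  have FV: "polyf V D (F a)" for a using F C by (rule polyf_mono[OF _ order_refl])
  have ch: "continuous_on A h" for A by (rule polyf_continuous[OF h])
  have cF: "continuous_on A (F a)" for A a by (rule polyf_continuous[OF F])
  have cpF: "continuous_on A (pd c (F a))" for A a c by (rule polyf_continuous[OF polyf_pd[OF F]])
  have cc: "continuous_on A (\<lambda>x :: 'v \<Rightarrow> real. x c)" for A c
    by (rule continuous_on_subset[OF continuous_on_product_coordinates]) auto
  have main: "emeasure lborel ((\<lambda>x. \<chi> a. F a x) ` ?S) \<le> ennreal (\<phi> \<delta>)" if \<delta>: "0 < \<delta>" for \<delta>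
  proof -
    define R' where "R' = \<bar>R\<bar> + 1"
    have R': "1 \<le> R'" by (simp add: R'_def)
    have SR': "\<bar>x v\<bar> < R'" if "x \<in> ?S" "v \<in> V" for x v using bd that by (force simp: R'_def)
    \<comment> \<open>The Gram determinant after the error variables are adjoined with factor
      \<open>t\<close>, which adds \<open>t\<^sup>2\<close> on the diagonal.\<close>
    define M where "M t x = det (\<chi> a b. (\<Sum>c\<in>C. pd c (F a) x * pd c (F b) x) + (if a = b then t\<^sup>2 else 0))" for t x
    \<comment> \<open>\<open>t\<close> is treated as a further variable, so that one compactness
      argument yields an \<epsilon> for which the relaxed bounds hold wherever \<open>h\<close> is
      small. At \<open>t = 0\<close> and \<open>h = 0\<close> the hypotheses exclude this
      set.\<close>
    define bad where "bad = ({0..1} \<times> boxV V R') \<inter> ({z. (J + \<delta>)\<^sup>2 \<le> M (fst z) (snd z)} \<union>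
      (\<Union>c\<in>C. {z. \<rho> + \<delta> \<le> \<bar>snd z c\<bar>}) \<union> (\<Union>v\<in>V. {z. R' \<le> \<bar>snd z v\<bar>}))"
    have cif: "continuous_on A (\<lambda>z. if P then (fst z)\<^sup>2 else 0)" for A :: "(real \<times> ('v \<Rightarrow> real)) set" and P
      by (cases P) (auto intro!: continuous_intros)
    have cM: "continuous_on A (\<lambda>z. M (fst z) (snd z))" for A :: "(real \<times> ('v \<Rightarrow> real)) set"
      unfolding M_def det_def
      by (intro continuous_on_sum continuous_on_mult continuous_on_const continuous_on_prod)
         (auto intro!: cif continuous_intros continuous_on_compose2[OF cpF[of UNIV] continuous_on_snd[OF continuous_on_id]])
    have "compact bad" unfolding bad_def
      by (intro compact_Int_closed compact_Times compact_boxV compact_Icc closed_Un closed_UN finC V ballI closed_Collect_le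
        continuous_intros cM continuous_on_compose2[OF cc[of UNIV] continuous_on_snd[OF continuous_on_id]]) auto
    have pos: "0 < h (snd z) + fst z" if "z \<in> bad" for z
    proof -
      have z: "0 \<le> fst z" "snd z \<in> RV V" using that by (auto simp: bad_def boxV_def)
      show ?thesis
      proof (rule ccontr)
        assume "\<not> ?thesis"
        then have "h (snd z) = 0" "fst z = 0" using z nonneg[OF z(2)] by linarith+
        then have S: "snd z \<in> ?S" using z by simp
        have "J\<^sup>2 < (J + \<delta>)\<^sup>2" using J(1) \<delta> by (intro power_strict_mono) auto
        then have "M (fst z) (snd z) < (J + \<delta>)\<^sup>2" using J(2)[OF z(2)] S \<open>fst z = 0\<close> by (simp add: M_def cong: if_cong)
        moreover have "\<bar>snd z c\<bar> < \<rho> + \<delta>" if "c \<in> C" for c using \<rho>(1)[OF z(2) _ that] S \<delta> by force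
        moreover have "\<bar>snd z v\<bar> < R'" if "v \<in> V" for v using SR'[OF S that] .
        ultimately show False using that by (force simp: bad_def)
      qed
    qed
    obtain \<eta> where \<eta>: "0 < \<eta>" "\<And>z. z \<in> bad \<Longrightarrow> \<eta> \<le> h (snd z) + fst z"
    proof (cases "bad = {}")
      case False
      have "continuous_on bad (\<lambda>z. h (snd z) + fst z)"
        by (intro continuous_intros continuous_on_compose2[OF ch[of UNIV] continuous_on_snd[OF continuous_on_id]]) auto
      then obtain z where "z \<in> bad" "\<forall>y\<in>bad. h (snd z) + fst z \<le> h (snd y) + fst y"
        using continuous_attains_inf[OF \<open>compact bad\<close> False] by blast
      then show ?thesis using pos that by blast
    qed (use that[of 1] in auto)
    define \<epsilon> where "\<epsilon> = min 1 (\<eta> / 2)"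
    have \<epsilon>: "0 < \<epsilon>" "\<epsilon> \<le> 1" "\<epsilon> \<le> \<eta> / 2" using \<eta> by (auto simp: \<epsilon>_def)
    \<comment> \<open>The bound by \<open>\<epsilon>\<^sup>2\<close> makes the residual at most
      \<epsilon>, hence the error variables at most 1; the bound by \<eta> keeps the minimum out of
      \<open>bad\<close>.\<close>
    define s where "s = min (\<eta> / 4) (\<epsilon>\<^sup>2)"
    have s: "0 < s" "s \<le> \<eta> / 4" "s \<le> \<epsilon>\<^sup>2" using \<eta> \<epsilon> by (auto simp: s_def)
    have good: "M \<epsilon> x < (J + \<delta>)\<^sup>2 \<and> (\<forall>c\<in>C. \<bar>x c\<bar> < \<rho> + \<delta>) \<and> (\<forall>v\<in>V. \<bar>x v\<bar> < R')"
      if "x \<in> boxV V R'" "h x \<le> s" for x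
    proof -
      have "h (snd (\<epsilon>, x)) + fst (\<epsilon>, x) < \<eta>" using that s \<epsilon> \<eta> by simp
      then have "(\<epsilon>, x) \<notin> bad" using \<eta>(2)[of "(\<epsilon>, x)"] by fastforce
      then show ?thesis using that \<epsilon> by (auto simp: bad_def not_le)
    qed
    \<comment> \<open>Keeps the linear perturbation within \<open>s / 2\<close> on the box.\<close>
    define r where "r = s / 2 / ((real (card V) + 1) * R')"
    have r: "0 < r" using s R' by (simp add: r_def)
    \<comment> \<open>With error variables \<open>(y $ a - F a x) / \<epsilon>\<close>,
      \<open>G\<close> takes the value \<open>y\<close> exactly, and \<open>f v = \<tau> v\<close>
      below becomes the critical equation of the penalised function.\<close>
    define G where "G a \<xi> = F a \<xi> + \<epsilon> * \<xi> (N a)" for a \<xi>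
    define f where "f v \<xi> = pd v h \<xi> - 2 * \<epsilon> * (\<Sum>a\<in>UNIV. \<xi> (N a) * pd v (F a) \<xi>)" for v \<xi>
    let ?C = "C \<union> range N"
    have G: "polyf ?C (2 * D) (G a)" for a
      unfolding G_def
      by (intro polyf_add polyf_cmult polyf_var' polyf_mono[OF F]) (use D in auto)
    have f: "polyf ?W (2 * D) (f v)" for v
      unfolding f_def
    proof (intro polyf_diff polyf_cmult polyf_sum)
      show "polyf ?W (2 * D) (pd v h)" by (rule polyf_mono[OF polyf_pd[OF h]]) auto
      show "polyf ?W (2 * D) (\<lambda>x. x (N a) * pd v (F a) x)" for a
        by (rule polyf_mult'[of _ 1 _ D]) (use D in \<open>auto intro: polyf_var' polyf_mono[OF polyf_pd[OF FV]]\<close>)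
    qed
    have pdG: "pd c (G a) \<xi> = pd c (F a) \<xi> + \<epsilon> * (if c = N a then 1 else 0)" for c a \<xi>
    proof -
      have 1: "polyf UNIV D (F a)" by (rule polyf_mono[OF F]) auto
      have 2: "polyf UNIV D (\<lambda>\<xi>. \<xi> (N a))" by (rule polyf_var'[OF _ D]) simp
      show ?thesis
        unfolding G_def[abs_def] pd_add[OF 1 polyf_cmult[OF 2]] pd_cmult[OF 2] pd_var ..
    qed
    \<comment> \<open>The variable \<open>N e\<close> occurs in \<open>G e\<close> only, with
      coefficient \<epsilon>, so the extra columns form \<epsilon> times the identity.\<close>
    have gram: "det (\<chi> a b. \<Sum>c\<in>?C. pd c (G a) \<xi> * pd c (G b) \<xi>) = M \<epsilon> \<xi>" for \<xi>
    proof -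
      have "(\<Sum>c\<in>?C. pd c (G a) \<xi> * pd c (G b) \<xi>) = (\<Sum>c\<in>C. pd c (F a) \<xi> * pd c (F b) \<xi>) + (if a = b then \<epsilon>\<^sup>2 else 0)" for a b
      proof -
        have "(\<Sum>c\<in>?C. pd c (G a) \<xi> * pd c (G b) \<xi>) = (\<Sum>c\<in>C. pd c (G a) \<xi> * pd c (G b) \<xi>) + (\<Sum>c\<in>range N. pd c (G a) \<xi> * pd c (G b) \<xi>)"
          using finC N C by (intro sum.union_disjoint) auto
        also have "(\<Sum>c\<in>C. pd c (G a) \<xi> * pd c (G b) \<xi>) = (\<Sum>c\<in>C. pd c (F a) \<xi> * pd c (F b) \<xi>)"
          using N C by (intro sum.cong refl) (auto simp: pdG)
        also have "(\<Sum>c\<in>range N. pd c (G a) \<xi> * pd c (G b) \<xi>) = (\<Sum>e\<in>UNIV. pd (N e) (G a) \<xi> * pd (N e) (G b) \<xi>)"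
          using N by (simp add: sum.reindex)
        also have "\<dots> = (\<Sum>e\<in>UNIV. if e = a then (if a = b then \<epsilon>\<^sup>2 else 0) else 0)"
        proof (intro sum.cong refl)
          fix e
          have "N e \<notin> C" using N C by auto
          then have "pd (N e) (F a) \<xi> = 0" "pd (N e) (F b) \<xi> = 0" using pd_notin[OF F] by auto
          then show "pd (N e) (G a) \<xi> * pd (N e) (G b) \<xi> = (if e = a then (if a = b then \<epsilon>\<^sup>2 else 0) else 0)"
            using N(1) by (auto simp: pdG inj_eq power2_eq_square)
        qed
        also have "\<dots> = (if a = b then \<epsilon>\<^sup>2 else 0)" by simp
        finally show ?thesis .
      qed
      then show ?thesis by (simp add: M_def)
    qed
    define \<Omega> where "\<Omega> = boxV ?W R' \<inter> (\<Inter>c\<in>C. {\<xi>. \<bar>\<xi> c\<bar> \<le> \<rho> + \<delta>}) \<inter> (\<Inter>a\<in>UNIV. {\<xi>. \<bar>\<xi> (N a)\<bar> \<le> 1}) \<inter> {\<xi>. M \<epsilon> \<xi> \<le> (J + \<delta>)\<^sup>2}"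
    have cM1: "continuous_on UNIV (M \<epsilon>)"
      using continuous_on_compose2[OF cM[of UNIV], of UNIV "\<lambda>x. (\<epsilon>, x)"] by (simp add: continuous_intros)
    have \<Omega>: "compact \<Omega>" unfolding \<Omega>_def
      by (intro compact_Int_closed compact_boxV closed_INT ballI closed_Collect_le continuous_intros cc cM1)
    have "\<exists>\<tau>\<in>RV V. (\<forall>v\<in>V. \<tau> v \<in> {0<..<r}) \<and> emeasure lborel ((\<lambda>\<xi>. \<chi> a. G a \<xi>) ` {\<xi>\<in>\<Omega>. \<forall>v\<in>V. f v \<xi> = \<tau> v})
      \<le> ennreal ((J + \<delta>) * real (card ?C) ^ ?k * (real ((2 * D) ^ card ?W) * (2 * (\<rho> + \<delta>)) ^ ?k))"
    proof (rule generic_curve_image[OF V N _ f _ G \<Omega>])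
      show "\<bar>\<xi> c\<bar> \<le> \<rho> + \<delta>" if "\<xi> \<in> \<Omega>" "c \<in> ?C" for \<xi> c
      proof (cases "c \<in> C")
        case False
        then obtain a where "c = N a" using \<open>c \<in> ?C\<close> by auto
        then have "\<bar>\<xi> c\<bar> \<le> 1" using \<open>\<xi> \<in> \<Omega>\<close> by (auto simp: \<Omega>_def)
        then show ?thesis using \<rho> \<delta> by linarith
      qed (use that in \<open>auto simp: \<Omega>_def\<close>)
      show "det (\<chi> a b. \<Sum>c\<in>?C. pd c (G a) \<xi> * pd c (G b) \<xi>) \<le> (J + \<delta>)\<^sup>2" if "\<xi> \<in> \<Omega>" for \<xi>
        using that unfolding gram by (simp add: \<Omega>_def)
      show "\<Omega> \<subseteq> RV ?W" by (auto simp: \<Omega>_def boxV_def)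
      show "infinite {0<..<r}" using r by (simp add: infinite_Ioo)
    qed (use D C J \<delta> \<rho> in auto)
    then obtain \<tau> where \<tau>: "\<tau> \<in> RV V" "\<And>v. v \<in> V \<Longrightarrow> 0 < \<tau> v \<and> \<tau> v < r"
      and le: "emeasure lborel ((\<lambda>\<xi>. \<chi> a. G a \<xi>) ` {\<xi>\<in>\<Omega>. \<forall>v\<in>V. f v \<xi> = \<tau> v}) \<le> ennreal (\<phi> \<delta>)"
      unfolding \<phi>_def cardW cardC by auto
    have "(\<lambda>x. \<chi> a. F a x) ` ?S \<subseteq> (\<lambda>\<xi>. \<chi> a. G a \<xi>) ` {\<xi>\<in>\<Omega>. \<forall>v\<in>V. f v \<xi> = \<tau> v}"
    proof
      fix y assume "y \<in> (\<lambda>x. \<chi> a. F a x) ` ?S"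
      then obtain x0 where x0: "x0 \<in> ?S" "y = (\<chi> a. F a x0)" by blast
      define l where "l x = (\<Sum>v\<in>V. - \<tau> v * x v)" for x
      define q where "q x = (\<Sum>a\<in>UNIV. (F a x - y $ a)\<^sup>2)" for x
      define g where "g x = h x + l x + q x" for x
      have l: "polyf V (2 * D) l" unfolding l_def using D by (intro polyf_sum polyf_cmult polyf_var') auto
      have h2: "polyf V (2 * D) h" by (rule polyf_mono[OF h]) auto
      have Fy: "polyf V D (\<lambda>x. F a x - y $ a)" for a by (intro polyf_diff FV polyf_const)
      have q1: "polyf V (2 * D) (\<lambda>x. (F a x - y $ a) * (F a x - y $ a))" for a
        by (rule polyf_mult'[OF Fy Fy]) simp
      have q: "polyf V (2 * D) q" unfolding q_def power2_eq_square by (intro polyf_sum q1)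
      have g: "polyf V (2 * D) g" unfolding g_def by (intro polyf_add h2 l q)
      have pdl: "pd v l = (\<lambda>x. - \<tau> v)" if "v \<in> V" for v
      proof -
        have "pd v l = (\<lambda>x. \<Sum>w\<in>V. pd v (\<lambda>x. - \<tau> w * x w) x)"
          unfolding l_def by (intro pd_sum[of V V D] polyf_cmult polyf_var' D)
        also have "\<dots> = (\<lambda>x. \<Sum>w\<in>V. if w = v then - \<tau> v else 0)"
          by (intro ext sum.cong refl, subst pd_cmult[of V 1]) (auto intro: polyf_var' simp: pd_var)
        finally show ?thesis using that V by (simp add: sum.delta)
      qed
      have pdq: "pd v q x = (\<Sum>a\<in>UNIV. 2 * ((F a x - y $ a) * pd v (F a) x))" for v x
      proof -
        have "pd v (\<lambda>x. F a x - y $ a) x = pd v (F a) x" for a x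
          using pd_add[OF FV[of a] polyf_const[of V D "- y $ a"], of v] by (simp add: pd_const)
        then have "pd v (\<lambda>x. (F a x - y $ a) * (F a x - y $ a)) x = 2 * ((F a x - y $ a) * pd v (F a) x)" for a x
          by (simp add: pd_mult[OF Fy Fy])
        then show ?thesis unfolding q_def power2_eq_square by (simp add: pd_sum[OF q1])
      qed
      have pdg: "pd v g x = pd v h x - \<tau> v + (\<Sum>a\<in>UNIV. 2 * ((F a x - y $ a) * pd v (F a) x))" if "v \<in> V" for v x
        unfolding g_def pd_add[OF polyf_add[OF h2 l] q] pd_add[OF h2 l] pdl[OF that] pdq by simp
      have lb: "\<bar>l x\<bar> \<le> s / 2" if "x \<in> boxV V R'" for x
      proof -
        have "\<bar>l x\<bar> \<le> (\<Sum>v\<in>V. \<bar>- \<tau> v * x v\<bar>)" unfolding l_def by (rule sum_abs)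
        also have "\<dots> \<le> (\<Sum>v\<in>V. r * R')"
          using that \<tau> R' r by (intro sum_mono) (force simp: abs_mult boxV_def intro!: mult_mono)
        also have "\<dots> = real (card V) * (r * R')" by simp
        also have "\<dots> \<le> (real (card V) + 1) * (r * R')" using r R' by (intro mult_right_mono) auto
        also have "\<dots> = r * ((real (card V) + 1) * R')" by (simp only: mult_ac)
        also have "\<dots> = s / 2"
        proof -
          have "(real (card V) + 1) * R' \<noteq> 0" using R' by simp
          then show ?thesis unfolding r_def by (rule nonzero_eq_divide_eq[THEN iffD1, OF _ refl])
        qed
        finally show ?thesis .
      qed
      have x0b: "x0 \<in> boxV V R'" using x0(1) SR'[OF x0(1)] by (auto simp: boxV_def intro: less_imp_le)
      then obtain x where x: "x \<in> boxV V R'" "\<And>z. z \<in> boxV V R' \<Longrightarrow> g x \<le> g z"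
        using continuous_attains_inf[OF compact_boxV _ polyf_continuous[OF g], of V R'] by blast
      have xV: "x \<in> RV V" using x by (simp add: boxV_def)
      have q0: "0 \<le> q x" unfolding q_def by (intro sum_nonneg) auto
      have "g x \<le> g x0" using x x0b by blast
      also have "g x0 = l x0" using x0 by (simp add: g_def q_def)
      \<comment> \<open>At \<open>x0\<close> both \<open>h\<close> and the penalty vanish, and each
        of the two linear terms contributes at most \<open>s / 2\<close>.\<close>
      finally have hq: "h x + q x \<le> s" using lb[OF x0b] lb[OF x(1)] by (simp add: g_def)
      then have "h x \<le> s" using q0 by linarith
      from good[OF x(1) this] have gd: "M \<epsilon> x < (J + \<delta>)\<^sup>2" "\<And>c. c \<in> C \<Longrightarrow> \<bar>x c\<bar> < \<rho> + \<delta>" "\<And>v. v \<in> V \<Longrightarrow> \<bar>x v\<bar> < R'" by auto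
      have "pd v g x = 0" if v: "v \<in> V" for v
      proof -
        have "\<forall>t. \<bar>x v - t\<bar> < R' - \<bar>x v\<bar> \<longrightarrow> g (x(v := x v)) \<le> g (x(v := t))"
        proof (intro allI impI)
          fix t assume that: "\<bar>x v - t\<bar> < R' - \<bar>x v\<bar>"
          have "\<bar>t\<bar> \<le> R'" using that by linarith
          then have "x(v := t) \<in> boxV V R'" using x(1) v by (auto simp: boxV_def RV_def)
          then show "g (x(v := x v)) \<le> g (x(v := t))" using x(2) by simp
        qed
        moreover have "0 < R' - \<bar>x v\<bar>" using gd(3)[OF v] by simp
        ultimately have "pd v g (x(v := x v)) = 0"
          using DERIV_local_min[OF has_derivative_pd[OF g, of x v "x v"]] by blast
        then show ?thesis by simp
      qed
      define u where "u = (\<chi> a. (y $ a - F a x) / \<epsilon>)"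
      define \<xi> where "\<xi> = emb N x u"
      have \<xi>N: "\<xi> (N a) = (y $ a - F a x) / \<epsilon>" for a using N(1) by (simp add: \<xi>_def emb_N u_def)
      have \<xi>V: "\<xi> v = x v" if "v \<notin> range N" for v using that by (simp add: \<xi>_def emb_notin)
      have \<xi>VV: "\<xi> v = x v" if "v \<in> V" for v using that N \<xi>V by blast
      have e1: "F a \<xi> = F a x" for a by (rule polyf_cong[OF FV]) (rule \<xi>VV)
      have e2: "pd v (F a) \<xi> = pd v (F a) x" for v a by (rule polyf_cong[OF polyf_pd[OF FV]]) (rule \<xi>VV)
      have e3: "pd v h \<xi> = pd v h x" for v by (rule polyf_cong[OF polyf_pd[OF h]]) (rule \<xi>VV)
      have u1: "\<bar>\<xi> (N a)\<bar> \<le> 1" for a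
      proof -
        have "(F a x - y $ a)\<^sup>2 \<le> q x" unfolding q_def by (rule member_le_sum) auto
        also have "\<dots> \<le> \<epsilon>\<^sup>2" using hq nonneg[OF xV] s by linarith
        finally have "\<bar>F a x - y $ a\<bar> \<le> \<epsilon>" using \<epsilon> by (simp add: abs_le_square_iff[symmetric])
        then show ?thesis using \<epsilon> by (simp add: \<xi>N abs_divide abs_minus_commute)
      qed
      have "M \<epsilon> \<xi> = M \<epsilon> x" by (simp add: M_def e2)
      moreover have "\<xi> \<in> boxV ?W R'"
        unfolding boxV_def RV_def
      proof (intro CollectI conjI allI impI ballI)
        fix v assume "v \<notin> ?W"
        then show "\<xi> v = 0" using \<xi>V xV by (simp add: RV_def)
      next
        fix v assume "v \<in> ?W"
        then show "\<bar>\<xi> v\<bar> \<le> R'"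
        proof
          assume "v \<in> V"
          then show ?thesis using gd(3)[of v] \<xi>VV[of v] by simp
        next
          assume "v \<in> range N"
          then obtain a where "v = N a" by blast
          then show ?thesis using u1[of a] R' by simp
        qed
      qed
      moreover have "\<bar>\<xi> c\<bar> \<le> \<rho> + \<delta>" if "c \<in> C" for c
      proof -
        have "\<xi> c = x c" using that C by (intro \<xi>VV) auto
        then show ?thesis using gd(2)[OF that] by simp
      qed
      ultimately have "\<xi> \<in> \<Omega>" using gd(1) u1 by (auto simp: \<Omega>_def)
      moreover have "f v \<xi> = \<tau> v" if "v \<in> V" for v
      proof -
        have "2 * \<epsilon> * (\<Sum>a\<in>UNIV. \<xi> (N a) * pd v (F a) \<xi>) = - (\<Sum>a\<in>UNIV. 2 * ((F a x - y $ a) * pd v (F a) x))"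
        proof -
          have "2 * \<epsilon> * (\<xi> (N a) * pd v (F a) \<xi>) = - (2 * ((F a x - y $ a) * pd v (F a) x))" for a
          proof -
            have "\<epsilon> * \<xi> (N a) = y $ a - F a x" using \<epsilon> by (simp add: \<xi>N)
            then have "2 * \<epsilon> * (\<xi> (N a) * pd v (F a) \<xi>) = 2 * ((y $ a - F a x) * pd v (F a) x)"
              by (simp add: e2 mult.assoc[symmetric])
            then show ?thesis by (simp add: algebra_simps)
          qed
          then show ?thesis unfolding sum_distrib_left sum_negf[symmetric] by (intro sum.cong refl)
        qed
        then show ?thesis using \<open>\<And>v. v \<in> V \<Longrightarrow> pd v g x = 0\<close>[OF that] pdg[OF that, of x] by (simp add: f_def e3)
      qed
      moreover have "(\<chi> a. G a \<xi>) = y" using \<epsilon> by (simp add: vec_eq_iff G_def e1 \<xi>N)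
      ultimately show "y \<in> (\<lambda>\<xi>. \<chi> a. G a \<xi>) ` {\<xi>\<in>\<Omega>. \<forall>v\<in>V. f v \<xi> = \<tau> v}" by (intro image_eqI[of _ _ \<xi>]) auto
    qed
    moreover have "(\<lambda>\<xi>. \<chi> a. G a \<xi>) ` {\<xi>\<in>\<Omega>. \<forall>v\<in>V. f v \<xi> = \<tau> v} \<in> sets lborel"
    proof -
      have "{\<xi>\<in>\<Omega>. \<forall>v\<in>V. f v \<xi> = \<tau> v} = \<Omega> \<inter> (\<Inter>v\<in>V. {\<xi>. f v \<xi> = \<tau> v})" by auto
      moreover have "compact (\<Omega> \<inter> (\<Inter>v\<in>V. {\<xi>. f v \<xi> = \<tau> v}))"
        by (intro compact_Int_closed \<Omega> closed_INT ballI closed_Collect_eq continuous_intros polyf_continuous[OF f])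
      ultimately have "compact ((\<lambda>\<xi>. \<chi> a. G a \<xi>) ` {\<xi>\<in>\<Omega>. \<forall>v\<in>V. f v \<xi> = \<tau> v})"
        by (intro compact_continuous_image continuous_on_vec_lambda polyf_continuous[OF G]) simp
      then show ?thesis using borel_compact by simp
    qed
    ultimately show ?thesis using le by (meson emeasure_mono order_trans)
  qed
  have "isCont \<phi> 0" unfolding \<phi>_def by (intro continuous_intros)
  from ennreal_le_limit[OF main this] show ?thesis by (simp add: \<phi>_def)
qed

section \<open>Singular values\<close>

definition orthonormal :: "'a::euclidean_space set \<Rightarrow> bool" where
  "orthonormal B \<longleftrightarrow> pairwise orthogonal B \<and> (\<forall>b\<in>B. norm b = 1)"

lemma orthonormal_independent: "orthonormal B \<Longrightarrow> independent B"
  by (rule pairwise_orthogonal_independent) (auto simp: orthonormal_def)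

lemma orthonormal_finite: "orthonormal B \<Longrightarrow> finite B"
  using orthonormal_independent independent_bound by blast

lemma orthonormal_insert:
  assumes "orthonormal B" "norm x = 1" "\<And>b. b \<in> B \<Longrightarrow> x \<bullet> b = 0"
  shows "orthonormal (insert x B)" "x \<notin> B"
proof -
  show "orthonormal (insert x B)"
    using assms by (auto simp: orthonormal_def pairwise_insert orthogonal_def inner_commute)
  show "x \<notin> B"
  proof
    assume "x \<in> B"
    then have "x \<bullet> x = 0" by (rule assms(3))
    then show False using assms(2) by simp
  qed
qed

text \<open>Unit vectors are added one at a time under an invariant: the trivial one completes
  bases, that of being an eigenvector gives the spectral theorem.\<close>

lemma orthonormal_extend:
  fixes B :: "'a::euclidean_space set"
  assumes "orthonormal B" "Inv B"
    and step: "\<And>B. orthonormal B \<Longrightarrow> Inv B \<Longrightarrow> card B < DIM('a) \<Longrightarrow>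
      \<exists>x. norm x = 1 \<and> (\<forall>b\<in>B. x \<bullet> b = 0) \<and> Inv (insert x B)"
  shows "\<exists>B'. B \<subseteq> B' \<and> orthonormal B' \<and> Inv B' \<and> card B' = DIM('a)"
  using assms(1,2)
proof (induction "DIM('a) - card B" arbitrary: B)
  case 0
  then have "card B = DIM('a)"
    using independent_bound[OF orthonormal_independent[OF 0(2)]] by simp
  then show ?case using 0 by blast
next
  case (Suc d)
  then have "card B < DIM('a)" by simp
  then obtain x where x: "norm x = 1" "\<forall>b\<in>B. x \<bullet> b = 0" "Inv (insert x B)"
    using step[OF Suc.prems] by blast
  have o: "orthonormal (insert x B)" "x \<notin> B" using orthonormal_insert[OF Suc.prems(1) x(1)] x(2) by auto
  have "d = DIM('a) - card (insert x B)"
    using Suc.hyps(2) o(2) orthonormal_finite[OF Suc.prems(1)] by simp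
  then obtain B' where "insert x B \<subseteq> B' \<and> orthonormal B' \<and> Inv B' \<and> card B' = DIM('a)"
    using Suc.hyps(1)[OF _ o(1) x(3)] by blast
  then show ?case by blast
qed

lemma exists_orthogonal_unit:
  fixes B :: "'a::euclidean_space set"
  assumes "orthonormal B" "card B < DIM('a)"
  shows "\<exists>x. norm x = 1 \<and> (\<forall>b\<in>B. x \<bullet> b = 0)"
proof -
  have "dim B < DIM('a)" using assms dim_le_card'[OF orthonormal_finite[OF assms(1)]] by linarith
  then obtain x where x: "x \<noteq> 0" "\<And>y. y \<in> span B \<Longrightarrow> orthogonal x y"
    using orthogonal_to_subspace_exists by blast
  have "(x /\<^sub>R norm x) \<bullet> b = 0" if "b \<in> B" for b
    using x(2)[OF span_base[OF that]] by (simp add: orthogonal_def)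
  moreover have "norm (x /\<^sub>R norm x) = 1" using x(1) by simp
  ultimately show ?thesis by blast
qed

lemma orthonormal_enum:
  fixes B :: "(real^'m::finite) set"
  assumes "orthonormal B" "card B = CARD('m)"
  shows "\<exists>u. bij_betw u UNIV B \<and> (\<forall>a b::'m. u a \<bullet> u b = (if a = b then 1 else 0))"
proof -
  obtain u where u: "bij_betw u (UNIV::'m set) B"
    using finite_same_card_bij[of "UNIV::'m set" B] orthonormal_finite[OF assms(1)] assms(2) by auto
  have "u a \<bullet> u b = (if a = b then 1 else 0)" for a b
  proof (cases "a = b")
    case True
    have "norm (u b) = 1" using assms(1) u by (auto simp: orthonormal_def bij_betw_def)
    then show ?thesis using True by (simp add: norm_eq_1)
  next
    case False
    then have "u a \<noteq> u b" using u by (auto simp: bij_betw_def inj_on_def)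
    moreover have "u a \<in> B" "u b \<in> B" using u by (auto simp: bij_betw_def)
    ultimately show ?thesis using False assms(1) by (auto simp: orthonormal_def pairwise_def orthogonal_def)
  qed
  then show ?thesis using u by blast
qed

lemma orthonormal_frame:
  fixes Z :: "(real^'m::finite) set"
  assumes "subspace Z"
  shows "\<exists>u J. (\<forall>a b::'m. u a \<bullet> u b = (if a = b then 1 else 0)) \<and> card J = dim Z \<and> span (u ` J) = Z"
proof -
  obtain B where B: "B \<subseteq> Z" "pairwise orthogonal B" "\<And>x. x \<in> B \<Longrightarrow> norm x = 1"
    "independent B" "card B = dim Z" "span B = Z"
    using orthonormal_basis_subspace[OF assms] by blast
  have "orthonormal B" using B by (simp add: orthonormal_def)
  then have "\<exists>B'. B \<subseteq> B' \<and> orthonormal B' \<and> True \<and> card B' = DIM(real^'m)"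
    by (rule orthonormal_extend[where Inv = "\<lambda>_. True"]) (use exists_orthogonal_unit[where 'a = "real^'m"] in auto)
  then obtain B' where B': "B \<subseteq> B'" "orthonormal B'" "card B' = CARD('m)" by auto
  then obtain u where u: "bij_betw u UNIV B'" "\<forall>a b::'m. u a \<bullet> u b = (if a = b then 1 else 0)"
    using orthonormal_enum by blast
  define J where "J = {a. u a \<in> B}"
  have "u ` J = B" using u(1) B'(1) by (auto simp: J_def bij_betw_def)
  moreover have "inj_on u J" using u(1) by (auto simp: bij_betw_def inj_on_def)
  ultimately have "card J = dim Z" using B(5) card_image by metis
  then show ?thesis using u(2) \<open>u ` J = B\<close> B(6) by blast
qed

section \<open>Spectral theorem and ordered eigenvalues\<close>

lemma quadratic_nonpos_linear_zero:
  fixes c d :: real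
  assumes "\<And>t. 2 * t * c + t\<^sup>2 * d \<le> 0"
  shows "c = 0"
proof -
  define e where "e = \<bar>d\<bar> + 1"
  have e: "0 < e" "0 < 2 * e + d" by (simp_all add: e_def)
  have "2 * (c / e) * c + (c / e)\<^sup>2 * d = c\<^sup>2 * (2 * e + d) / e\<^sup>2"
    using e by (simp add: field_simps power2_eq_square)
  then have "c\<^sup>2 * (2 * e + d) / e\<^sup>2 \<le> 0" using assms[of "c / e"] by linarith
  then have "c\<^sup>2 * (2 * e + d) \<le> 0" using e by (simp add: divide_le_0_iff)
  then have "c\<^sup>2 \<le> 0" using e by (simp add: mult_le_0_iff)
  then show ?thesis by simp
qed

text \<open>A maximum \<open>x\<close> of the quadratic form on the unit sphere of \<open>W\<close>
  is an eigenvector: \<open>\<mu> * (y \<bullet> y) - f y \<bullet> y\<close> is nonnegative on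
  \<open>W\<close> and vanishes at \<open>x\<close>, so its first variation along the residual is
  0.\<close>

lemma eigenvector_exists:
  fixes f :: "'a::euclidean_space \<Rightarrow> 'a"
  assumes f: "linear f" and sa: "\<And>x y. f x \<bullet> y = x \<bullet> f y" and W: "subspace W"
    and inv: "\<And>x. x \<in> W \<Longrightarrow> f x \<in> W" and ne: "\<exists>x\<in>W. x \<noteq> 0"
  shows "\<exists>x\<in>W. norm x = 1 \<and> (\<exists>\<mu>. f x = \<mu> *\<^sub>R x)"
proof -
  let ?S = "sphere 0 1 \<inter> W"
  obtain x0 where "x0 \<in> W" "x0 \<noteq> 0" using ne by blast
  then have "x0 /\<^sub>R norm x0 \<in> ?S" using W by (simp add: subspace_mul)
  then have "?S \<noteq> {}" by blast
  moreover have "compact ?S" using closed_subspace[OF W] by (intro compact_Int_closed) auto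
  moreover have "continuous_on ?S (\<lambda>x. f x \<bullet> x)"
    using f by (intro continuous_on_inner linear_continuous_on continuous_on_id) (simp add: linear_linear)
  ultimately have "\<exists>x\<in>?S. \<forall>y\<in>?S. f y \<bullet> y \<le> f x \<bullet> x" by (intro continuous_attains_sup)
  then obtain x where x: "x \<in> ?S" "\<And>y. y \<in> ?S \<Longrightarrow> f y \<bullet> y \<le> f x \<bullet> x" by blast
  define \<mu> where "\<mu> = f x \<bullet> x"
  have xx: "x \<bullet> x = 1" using x(1) by (simp add: norm_eq_1)
  have le: "f y \<bullet> y \<le> \<mu> * (y \<bullet> y)" if "y \<in> W" for y
  proof (cases "y = 0")
    case False
    have "f (y /\<^sub>R norm y) \<bullet> (y /\<^sub>R norm y) \<le> \<mu>"
      unfolding \<mu>_def using False that W by (intro x(2)) (simp add: subspace_mul)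
    moreover have "f (y /\<^sub>R norm y) \<bullet> (y /\<^sub>R norm y) = (f y \<bullet> y) / (norm y)\<^sup>2"
      unfolding linear_cmul[OF f] by (simp add: power2_eq_square divide_inverse)
    ultimately have "(f y \<bullet> y) / (norm y)\<^sup>2 \<le> \<mu>" by simp
    moreover have "0 < (norm y)\<^sup>2" using False by simp
    ultimately show ?thesis by (simp add: pos_divide_le_eq dot_square_norm)
  qed (use f in \<open>simp add: linear_0\<close>)
  \<comment> \<open>The residual is orthogonal to \<open>x\<close>, so moving \<open>x\<close> along
    it changes the norm to second order only.\<close>
  define v where "v = f x - \<mu> *\<^sub>R x"
  have v: "v \<in> W" unfolding v_def using x(1) inv W by (intro subspace_diff subspace_mul) auto
  have vx: "v \<bullet> x = 0" by (simp add: v_def \<mu>_def inner_diff_left xx)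
  have "2 * t * (v \<bullet> f x) + t\<^sup>2 * (f v \<bullet> v - \<mu> * (v \<bullet> v)) \<le> 0" for t
  proof -
    have "x + t *\<^sub>R v \<in> W" using x(1) v W by (intro subspace_add subspace_mul) auto
    from le[OF this] have "f x \<bullet> x + t * (f x \<bullet> v) + t * (f v \<bullet> x) + t * t * (f v \<bullet> v)
      \<le> \<mu> * (x \<bullet> x + t * (x \<bullet> v) + t * (v \<bullet> x) + t * t * (v \<bullet> v))"
      using f by (simp add: linear_add linear_cmul inner_add_left inner_add_right algebra_simps)
    moreover have "f v \<bullet> x = v \<bullet> f x" "f x \<bullet> v = v \<bullet> f x" "x \<bullet> v = 0"
      using sa vx by (auto simp: inner_commute)
    ultimately show ?thesis using xx vx by (simp add: \<mu>_def[symmetric] power2_eq_square algebra_simps)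
  qed
  then have "v \<bullet> f x = 0" by (rule quadratic_nonpos_linear_zero)
  then have "v \<bullet> v = 0" using vx by (simp add: v_def inner_diff_right)
  then have "f x = \<mu> *\<^sub>R x" by (simp add: v_def)
  then show ?thesis using x(1) by auto
qed

lemma spectral_theorem:
  fixes M :: "real^'m::finite^'m"
  assumes sym: "transpose M = M"
  shows "\<exists>u ev. (\<forall>a b::'m. u a \<bullet> u b = (if a = b then 1 else 0)) \<and> (\<forall>a. M *v u a = ev a *\<^sub>R u a)"
proof -
  let ?Inv = "\<lambda>B. \<forall>b\<in>B. \<exists>\<mu>. M *v b = \<mu> *\<^sub>R b"
  have sa: "(M *v x) \<bullet> y = x \<bullet> (M *v y)" for x y using sym by (metis dot_lmul_matrix transpose_matrix_vector)
  have "\<exists>B. {} \<subseteq> B \<and> orthonormal B \<and> ?Inv B \<and> card B = DIM(real^'m)"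
  proof (rule orthonormal_extend)
    fix B :: "(real^'m) set"
    assume B: "orthonormal B" "?Inv B" "card B < DIM(real^'m)"
    \<comment> \<open>By symmetry of \<open>M\<close>, the complement of the eigenvectors found so
      far is invariant.\<close>
    define W where "W = {x. \<forall>b\<in>B. x \<bullet> b = 0}"
    obtain y where y: "norm y = 1" "\<forall>b\<in>B. y \<bullet> b = 0" using exists_orthogonal_unit[OF B(1,3)] by blast
    have "\<exists>x\<in>W. norm x = 1 \<and> (\<exists>\<mu>. M *v x = \<mu> *\<^sub>R x)"
    proof (rule eigenvector_exists[OF _ sa])
      show "subspace W" by (auto simp: W_def subspace_def inner_add_left)
      show "M *v x \<in> W" if "x \<in> W" for x
      proof -
        have "(M *v x) \<bullet> b = 0" if "b \<in> B" for b
        proof -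
          obtain \<mu> where "M *v b = \<mu> *\<^sub>R b" using bspec[OF B(2) \<open>b \<in> B\<close>] by blast
          moreover have "x \<bullet> b = 0" using \<open>x \<in> W\<close> that by (simp add: W_def)
          ultimately show ?thesis unfolding sa by simp
        qed
        then show ?thesis by (simp add: W_def)
      qed
      show "\<exists>x\<in>W. x \<noteq> 0" using y by (intro bexI[of _ y]) (auto simp: W_def)
    qed (rule matrix_vector_mul_linear)
    then show "\<exists>x. norm x = 1 \<and> (\<forall>b\<in>B. x \<bullet> b = 0) \<and> ?Inv (insert x B)" using B(2) by (auto simp: W_def)
  qed (auto simp: orthonormal_def)
  then obtain B where B: "orthonormal B" "?Inv B" "card B = CARD('m)" by auto
  then obtain u where u: "bij_betw u UNIV B" "\<forall>a b::'m. u a \<bullet> u b = (if a = b then 1 else 0)"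
    using orthonormal_enum by blast
  have "\<forall>a. \<exists>\<mu>. M *v u a = \<mu> *\<^sub>R u a" using B(2) u(1) by (auto simp: bij_betw_def)
  then obtain ev where "\<forall>a. M *v u a = ev a *\<^sub>R u a" by (rule choice[THEN exE])
  then show ?thesis using u(2) by blast
qed

lemma poly_charpoly:
  fixes M :: "real^'m::finite^'m"
  shows "poly (charpoly M) t = det (\<chi> i j. (if i = j then t else 0) - M $ i $ j)"
proof -
  have "poly (\<Prod>i\<in>UNIV. ((if i = p i then [:0, 1:] else 0) - [:M $ i $ p i:])) t = (\<Prod>i\<in>UNIV. (if i = p i then t else 0) - M $ i $ p i)" for p
    unfolding poly_prod by (intro prod.cong refl) auto
  moreover have "poly (of_int (sign p)) t = (of_int (sign p) :: real)" for p :: "'m \<Rightarrow> 'm"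
    by (simp add: of_int_poly)
  ultimately show ?thesis unfolding charpoly_def det_def by (simp add: poly_sum)
qed

lemma charpoly_diagonalized:
  fixes M Q :: "real^'m::finite^'m"
  assumes Q: "transpose Q ** Q = mat 1" and D: "transpose Q ** M ** Q = (\<chi> a b. if a = b then ev a else 0)"
  shows "charpoly M = (\<Prod>a\<in>UNIV. [:- ev a, 1:])"
proof (rule poly_eq_poly_eq_iff[THEN iffD1], rule ext)
  fix t
  define A where "A = (\<chi> i j. (if i = j then t else 0) - M $ i $ j)"
  have A: "A = t *\<^sub>R mat 1 - M" by (simp add: A_def vec_eq_iff mat_def)
  have "transpose Q ** A ** Q = t *\<^sub>R (transpose Q ** Q) - transpose Q ** M ** Q"
    by (simp add: A vec_eq_iff matrix_matrix_mult_def mat_def sum_distrib_left sum_distrib_right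
       right_diff_distrib left_diff_distrib sum_subtractf algebra_simps if_distrib[of "\<lambda>x. x * _"] if_distrib[of "\<lambda>x. _ * x"] sum.delta sum.delta' cong: if_cong)
  then have eq: "transpose Q ** A ** Q = (\<chi> a b. if a = b then t - ev a else 0)"
    unfolding Q D by (simp add: vec_eq_iff mat_def)
  have "det (transpose Q) * det Q = 1" using arg_cong[OF Q, of det] by (simp add: det_mul)
  then have "det A = det (transpose Q ** A ** Q)" by (simp add: det_mul)
  also have "\<dots> = (\<Prod>a\<in>UNIV. t - ev a)"
    unfolding eq by (subst det_diagonal) auto
  finally show "poly (charpoly M) t = poly (\<Prod>a\<in>UNIV. [:- ev a, 1:]) t"
    by (simp add: poly_charpoly A_def[symmetric] poly_prod)
qed

lemma eigs_desc_diagonalized: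
  fixes M :: "real^'m::finite^'m" and ev :: "'m \<Rightarrow> real"
  assumes "charpoly M = (\<Prod>a\<in>UNIV. [:- ev a, 1:])"
  shows "eigs_desc M = rev (sorted_list_of_multiset (image_mset ev (mset_set UNIV)))"
proof -
  have "proots (\<Prod>a\<in>A. [:- ev a, 1:]) = image_mset ev (mset_set A)" if "finite A" for A
  proof -
    have "(\<Sum>a\<in>A. {#ev a#}) = image_mset ev (mset_set A)"
      using that by (induction rule: finite_induct) auto
    then show ?thesis by (subst proots_prod) auto
  qed
  then show ?thesis unfolding eigs_desc_def assms by simp
qed

text \<open>If the k-th entry exceeded \<open>c\<close>, so would the first k entries, and with them
  at least k labels.\<close>

lemma sorted_desc_nth_le:
  fixes ev :: "'m::finite \<Rightarrow> real"
  assumes l: "l = rev (sorted_list_of_multiset (image_mset ev (mset_set UNIV)))"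
    and k: "1 \<le> k" "k \<le> CARD('m)" and c: "card {a. c < ev a} < k"
  shows "l ! (k - 1) \<le> c"
proof (rule ccontr)
  assume "\<not> ?thesis"
  then have lt: "c < l ! (k - 1)" by simp
  have ms: "mset l = image_mset ev (mset_set UNIV)" unfolding l by simp
  then have len: "length l = CARD('m)" by (metis size_image_mset size_mset size_mset_set)
  have "sorted (rev l)" unfolding l by simp
  have "c < x" if "x \<in> set (take k l)" for x
  proof -
    obtain j where j: "j < k" "x = l ! j"
      using \<open>x \<in> set (take k l)\<close> by (auto simp: in_set_conv_nth)
    have "l ! (k - 1) \<le> l ! j"
      using \<open>sorted (rev l)\<close> j k len by (intro sorted_rev_nth_mono) auto
    then show ?thesis using lt j by simp
  qed
  then have "filter (\<lambda>x. c < x) (take k l) = take k l" by (simp add: filter_id_conv)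
  then have "k \<le> length (filter (\<lambda>x. c < x) (take k l))" using k len by simp
  also have "\<dots> \<le> length (filter (\<lambda>x. c < x) (take k l @ drop k l))" by (simp only: filter_append length_append)
  also have "\<dots> = size (filter_mset (\<lambda>x. c < x) (mset l))" by (simp flip: mset_filter size_mset)
  also have "\<dots> = card {a. c < ev a}"
    unfolding ms by (simp add: filter_mset_image_mset flip: Collect_conj_eq)
  finally show False using c by simp
qed

text \<open>Sorting the labels by their values, instead of sorting the values, gives a bijection
  even when eigenvalues repeat.\<close>

lemma sorted_desc_arrange:
  fixes ev :: "'m::finite \<Rightarrow> real"
  assumes l: "l = rev (sorted_list_of_multiset (image_mset ev (mset_set UNIV)))"
    and e: "bij_betw e (UNIV::'m set) {1..CARD('m)}"
  shows "\<exists>\<pi>. bij \<pi> \<and> (\<forall>a. ev (\<pi> a) = l ! (e a - 1))"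
proof -
  obtain as where as: "set as = (UNIV::'m set)" "distinct as" using finite_distinct_list[of "UNIV::'m set"] by auto
  have "mset_set UNIV = mset as" using as by (metis mset_set_set)
  then have "l = rev (sort (map ev as))" unfolding l by (simp flip: mset_map)
  also have "sort (map ev as) = map ev (sort_key ev as)"
    by (rule properties_for_sort) (simp_all add: sorted_sort_key)
  finally have lb: "l = map ev (rev (sort_key ev as))" by (simp add: rev_map)
  define bs where "bs = rev (sort_key ev as)"
  have bs: "distinct bs" "set bs = UNIV" "length bs = CARD('m)" "l = map ev bs"
    using as lb distinct_card[OF as(2)] by (auto simp: bs_def)
  define \<pi> where "\<pi> a = bs ! (e a - 1)" for a
  have ea: "1 \<le> e a" "e a - 1 < CARD('m)" for a
  proof -
    have "e a \<in> {1..CARD('m)}" using e by (auto simp: bij_betw_def)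
    then show "1 \<le> e a" "e a - 1 < CARD('m)" by auto
  qed
  have "inj \<pi>"
  proof (rule injI)
    fix a b assume "\<pi> a = \<pi> b"
    then have "e a - 1 = e b - 1" using bs ea by (simp add: \<pi>_def nth_eq_iff_index_eq)
    then have "e a = e b" using ea[of a] ea[of b] by simp
    then show "a = b" using e by (auto simp: bij_betw_def inj_on_def)
  qed
  then have "bij \<pi>" by (simp add: finite_UNIV_inj_surj bij_def)
  moreover have "ev (\<pi> a) = l ! (e a - 1)" for a using bs ea by (simp add: \<pi>_def)
  ultimately show ?thesis by blast
qed

text \<open>Induction removes the largest element of \<open>E\<close>, which is at least the number
  of elements, so that its factor is at most \<open>g (Suc i)\<close>.\<close>

lemma prod_decreasing_le:
  fixes g :: "nat \<Rightarrow> real"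
  assumes "finite E" "card E = i" "E \<subseteq> {1..}" "\<And>k. 0 \<le> g k" "\<And>j k. 1 \<le> j \<Longrightarrow> j \<le> k \<Longrightarrow> g k \<le> g j"
  shows "(\<Prod>k\<in>E. g k) \<le> (\<Prod>k\<in>{1..i}. g k)"
  using assms(1-3)
proof (induction i arbitrary: E)
  case (Suc i)
  then have "E \<noteq> {}" by auto
  define x where "x = Max E"
  have x: "x \<in> E" using Suc \<open>E \<noteq> {}\<close> by (simp add: x_def)
  have "E \<subseteq> {1..x}" using Suc by (auto simp: x_def)
  then have "Suc i \<le> x" using card_mono[of "{1..x}" E] Suc by simp
  then have gx: "g x \<le> g (Suc i)" by (intro assms(5)) auto
  have "(\<Prod>k\<in>E. g k) = g x * (\<Prod>k\<in>E - {x}. g k)" using Suc x by (simp add: prod.remove)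
  also have "\<dots> \<le> g (Suc i) * (\<Prod>k\<in>{1..i}. g k)"
    using Suc x gx by (intro mult_mono Suc.IH) (auto intro: assms(4) prod_nonneg)
  also have "\<dots> = (\<Prod>k\<in>{1..Suc i}. g k)" by (simp add: atLeastAtMostSuc_conv)
  finally show ?case .
qed auto

section \<open>The lifted set\<close>

text \<open>Coordinates of the lifted space: the point \<open>x\<close>, an orthogonal matrix diagonalizing \<open>gram\<close>, the
  slacks of the eigenvalue bounds and of the ball, cylinder coordinates with their slacks, and the
  error variables.\<close>
datatype 'm idx = Xc nat | Qc 'm 'm | Sc 'm | Tc | Wc 'm | Yc 'm | Uc 'm

instance idx :: (countable) countable
  by countable_datatype

definition liftV :: "nat \<Rightarrow> 'm::finite idx set" where
  "liftV n = Xc ` {..<n} \<union> case_prod Qc ` UNIV \<union> range Sc \<union> {Tc} \<union> range Wc \<union> range Yc"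

lemma finite_liftV: "finite (liftV n :: 'm::finite idx set)"
  unfolding liftV_def by simp

lemma card_liftV: "card (liftV n :: 'm::finite idx set) \<le> n + CARD('m) * CARD('m) + 3 * CARD('m) + 1"
proof -
  let ?A = "Xc ` {..<n} :: 'm idx set"
  have "card (liftV n :: 'm idx set) \<le> card ?A + card (case_prod Qc ` (UNIV :: ('m \<times> 'm) set)) + card (range (Sc :: 'm \<Rightarrow> _)) + card {Tc :: 'm idx} + card (range (Wc :: 'm \<Rightarrow> _)) + card (range (Yc :: 'm \<Rightarrow> _))"
    unfolding liftV_def by (intro order_trans[OF card_Un_le] add_mono order_refl)
  also have "\<dots> \<le> n + CARD('m \<times> 'm) + CARD('m) + 1 + CARD('m) + CARD('m)"
    by (intro add_mono) (auto intro: card_image_le[THEN order_trans])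
  finally show ?thesis by (simp add: card_prod)
qed

definition pX :: "nat \<Rightarrow> nat \<Rightarrow> ('m \<Rightarrow> (nat \<Rightarrow> nat) \<Rightarrow> real) \<Rightarrow> 'm \<Rightarrow> ('m idx \<Rightarrow> real) \<Rightarrow> real" where
  "pX n d c j \<xi> = peval n d (c j) (\<lambda>k. \<xi> (Xc k))"

lemma polyf_pX: "polyf (Xc ` {..<n}) d (pX n d c j)"
proof -
  have "polyf (Xc ` {..<n}) d (\<lambda>\<xi>. \<Prod>k<n. \<xi> (Xc k) ^ \<alpha> k)" if "\<alpha> \<in> monomials_le n d" for \<alpha>
  proof (rule polyf_mono)
    show "polyf (Xc ` {..<n}) (\<Sum>k<n. \<alpha> k * 1) (\<lambda>\<xi>. \<Prod>k<n. \<xi> (Xc k) ^ \<alpha> k)"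
      by (intro polyf_prod polyf_power polyf_var') auto
    show "(\<Sum>k<n. \<alpha> k * 1) \<le> d" using that by (simp add: monomials_le_def)
  qed simp
  then show ?thesis unfolding pX_def[abs_def] peval_def by (intro polyf_sum polyf_cmult)
qed

lemma jac_pd: "jac n d c (\<lambda>k. \<xi> (Xc k)) j k = pd (Xc k) (pX n d c j) \<xi>"
proof -
  have eq: "pX n d c j (\<xi>(Xc k := t)) = peval n d (c j) ((\<lambda>k. \<xi> (Xc k))(k := t))" for t
    unfolding pX_def by (rule arg_cong[where f = "peval n d (c j)"]) (auto simp: fun_eq_iff)
  have "((\<lambda>t. pX n d c j (\<xi>(Xc k := t))) has_real_derivative pd (Xc k) (pX n d c j) (\<xi>(Xc k := \<xi> (Xc k)))) (at (\<xi> (Xc k)))"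
    by (rule has_derivative_pd[OF polyf_pX])
  then have "((\<lambda>t. peval n d (c j) ((\<lambda>k. \<xi> (Xc k))(k := t))) has_real_derivative pd (Xc k) (pX n d c j) \<xi>) (at (0 + \<xi> (Xc k)))"
    unfolding eq by simp
  then have "((\<lambda>t. peval n d (c j) ((\<lambda>k. \<xi> (Xc k))(k := t + \<xi> (Xc k)))) has_real_derivative pd (Xc k) (pX n d c j) \<xi>) (at 0)"
    unfolding DERIV_shift .
  then show ?thesis unfolding jac_def by (simp add: DERIV_imp_deriv add.commute)
qed

definition gramP :: "nat \<Rightarrow> nat \<Rightarrow> ('m \<Rightarrow> (nat \<Rightarrow> nat) \<Rightarrow> real) \<Rightarrow> ('m idx \<Rightarrow> real) \<Rightarrow> 'm \<Rightarrow> 'm \<Rightarrow> real" where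
  "gramP n d c \<xi> a b = (\<Sum>k<n. pd (Xc k) (pX n d c a) \<xi> * pd (Xc k) (pX n d c b) \<xi>)"

lemma gram_gramP: "gram n d c (\<lambda>k. \<xi> (Xc k)) $ a $ b = gramP n d c \<xi> a b"
  by (simp add: gram_def gramP_def jac_pd)

definition liftB :: "nat \<Rightarrow> nat \<Rightarrow> ('m::finite \<Rightarrow> (nat \<Rightarrow> nat) \<Rightarrow> real) \<Rightarrow> ('m idx \<Rightarrow> real) \<Rightarrow> 'm \<Rightarrow> 'm \<Rightarrow> real" where
  "liftB n d c \<xi> a b = (\<Sum>e\<in>UNIV. \<Sum>f\<in>UNIV. \<xi> (Qc e a) * gramP n d c \<xi> e f * \<xi> (Qc f b))"

definition liftQ :: "('m idx \<Rightarrow> real) \<Rightarrow> real^'m::finite^'m" where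
  "liftQ \<xi> = (\<chi> e a. \<xi> (Qc e a))"

lemma liftQ_orth: "transpose (liftQ \<xi>) ** liftQ \<xi> = (\<chi> a b. \<Sum>e\<in>UNIV. \<xi> (Qc e a) * \<xi> (Qc e b))"
  by (simp add: vec_eq_iff matrix_matrix_mult_def transpose_def liftQ_def)

lemma liftB_eq: "transpose (liftQ \<xi>) ** gram n d c (\<lambda>k. \<xi> (Xc k)) ** liftQ \<xi> = (\<chi> a b. liftB n d c \<xi> a b)"
proof -
  have "(\<Sum>f\<in>UNIV. (\<Sum>e\<in>UNIV. \<xi> (Qc e a) * gramP n d c \<xi> e f) * \<xi> (Qc f b)) = liftB n d c \<xi> a b" for a b
    unfolding liftB_def sum_distrib_right by (rule sum.swap)
  then show ?thesis
    by (simp add: vec_eq_iff matrix_matrix_mult_def transpose_def liftQ_def gram_gramP)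
qed

text \<open>The second group makes the conjugated Gram matrix diagonal with entries
  \<open>L a - (\<xi> (Sc a))\<^sup>2\<close>, so it encodes diagonalisation and eigenvalue bounds
  together. The last group confines \<open>Wc a\<close> to the interval from -1 to 1.\<close>

definition liftH :: "nat \<Rightarrow> nat \<Rightarrow> ('m::finite \<Rightarrow> (nat \<Rightarrow> nat) \<Rightarrow> real) \<Rightarrow> ('m \<Rightarrow> real) \<Rightarrow> real \<Rightarrow> ('m idx \<Rightarrow> real) \<Rightarrow> real" where
  "liftH n d c L r \<xi> =
    (\<Sum>a\<in>UNIV. \<Sum>b\<in>UNIV. ((\<Sum>e\<in>UNIV. \<xi> (Qc e a) * \<xi> (Qc e b)) - (if a = b then 1 else 0))\<^sup>2) +
    (\<Sum>a\<in>UNIV. \<Sum>b\<in>UNIV. (liftB n d c \<xi> a b + (if a = b then (\<xi> (Sc a))\<^sup>2 - L a else 0))\<^sup>2) +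
    ((\<Sum>k<n. (\<xi> (Xc k))\<^sup>2) + (\<xi> Tc)\<^sup>2 - r\<^sup>2)\<^sup>2 +
    (\<Sum>a\<in>UNIV. ((\<xi> (Wc a))\<^sup>2 + (\<xi> (Yc a))\<^sup>2 - 1)\<^sup>2)"

lemma liftV_simps:
  "k < n \<Longrightarrow> Xc k \<in> liftV n" "Qc a b \<in> liftV n" "Sc a \<in> liftV n" "Tc \<in> liftV n" "Wc a \<in> liftV n" "Yc a \<in> liftV n"
  unfolding liftV_def by auto

lemma liftV_notin: "Uc a \<notin> liftV n" "n \<le> k \<Longrightarrow> Xc k \<notin> liftV n"
  unfolding liftV_def by auto

lemma polyf_pX': "polyf (liftV n) d (pX n d c j)"
  by (rule polyf_mono[OF polyf_pX]) (auto simp: liftV_simps)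

text \<open>Entries of the Gram matrix have degree at most \<open>2 * d\<close>, conjugation adds 2,
  and squaring doubles.\<close>

lemma polyf_liftH: "polyf (liftV n) (4 * d + 4) (liftH n d c L r)"
proof -
  let ?V = "liftV n"
  have g: "polyf ?V (2 * d) (\<lambda>\<xi>. gramP n d c \<xi> a b)" for a b
    unfolding gramP_def by (intro polyf_sum polyf_mult'[OF polyf_pd polyf_pd]) (auto intro: polyf_pX')
  have q: "polyf ?V 1 (\<lambda>\<xi>. \<xi> (Qc a b))" for a b by (rule polyf_var') (auto simp: liftV_simps)
  have B: "polyf ?V (2 * d + 2) (\<lambda>\<xi>. liftB n d c \<xi> a b)" for a b
    unfolding liftB_def
    by (intro polyf_sum polyf_mult'[OF polyf_mult'[OF q g order_refl] q]) auto
  have sq: "polyf ?V (2 * d + 2) (\<lambda>\<xi>. (\<xi> v)\<^sup>2)" if "v \<in> ?V" for v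
    by (rule polyf_power2[where D = 1]) (auto intro: polyf_var' that)
  have 1: "polyf ?V (2 * d + 2) (\<lambda>\<xi>. (\<Sum>e\<in>UNIV. \<xi> (Qc e a) * \<xi> (Qc e b)) - (if a = b then 1 else 0))" for a b
    by (intro polyf_diff polyf_const polyf_sum polyf_mult'[OF q q]) auto
  have 2: "polyf ?V (2 * d + 2) (\<lambda>\<xi>. liftB n d c \<xi> a b + (if a = b then (\<xi> (Sc a))\<^sup>2 - L a else 0))" for a b
    by (cases "a = b") (auto intro!: polyf_add polyf_diff polyf_const B[unfolded add_2_eq_Suc'] sq[unfolded add_2_eq_Suc'] simp: liftV_simps)
  have 3: "polyf ?V (2 * d + 2) (\<lambda>\<xi>. (\<Sum>k<n. (\<xi> (Xc k))\<^sup>2) + (\<xi> Tc)\<^sup>2 - r\<^sup>2)"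
    by (intro polyf_add polyf_diff polyf_const polyf_sum sq) (auto simp: liftV_simps)
  have 4: "polyf ?V (2 * d + 2) (\<lambda>\<xi>. (\<xi> (Wc a))\<^sup>2 + (\<xi> (Yc a))\<^sup>2 - 1)" for a
    by (intro polyf_add polyf_diff polyf_const sq) (auto simp: liftV_simps)
  have le: "2 * (2 * d + 2) \<le> 4 * d + 4" by simp
  show ?thesis unfolding liftH_def[abs_def]
    by (intro polyf_add polyf_sum polyf_power2[OF 1 le] polyf_power2[OF 2 le] polyf_power2[OF 3 le] polyf_power2[OF 4 le])
qed

lemma liftH_nonneg: "0 \<le> liftH n d c L r \<xi>"
  unfolding liftH_def by (intro add_nonneg_nonneg sum_nonneg) auto

lemma liftH_zero_iff: "liftH n d c L r \<xi> = 0 \<longleftrightarrow>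
  (\<forall>a b. (\<Sum>e\<in>UNIV. \<xi> (Qc e a) * \<xi> (Qc e b)) = (if a = b then 1 else 0)) \<and>
  (\<forall>a b. liftB n d c \<xi> a b = (if a = b then L a - (\<xi> (Sc a))\<^sup>2 else 0)) \<and>
  (\<Sum>k<n. (\<xi> (Xc k))\<^sup>2) + (\<xi> Tc)\<^sup>2 = r\<^sup>2 \<and> (\<forall>a. (\<xi> (Wc a))\<^sup>2 + (\<xi> (Yc a))\<^sup>2 = 1)"
proof -
  let ?A = "\<lambda>a b. (\<Sum>e\<in>UNIV. \<xi> (Qc e a) * \<xi> (Qc e b)) - (if a = b then 1 else 0)"
  let ?B = "\<lambda>a b. liftB n d c \<xi> a b + (if a = b then (\<xi> (Sc a))\<^sup>2 - L a else 0)"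
  let ?C = "(\<Sum>k<n. (\<xi> (Xc k))\<^sup>2) + (\<xi> Tc)\<^sup>2 - r\<^sup>2"
  let ?D = "\<lambda>a. (\<xi> (Wc a))\<^sup>2 + (\<xi> (Yc a))\<^sup>2 - 1"
  have "liftH n d c L r \<xi> = 0 \<longleftrightarrow> (\<Sum>a\<in>UNIV. \<Sum>b\<in>UNIV. (?A a b)\<^sup>2) = 0 \<and> (\<Sum>a\<in>UNIV. \<Sum>b\<in>UNIV. (?B a b)\<^sup>2) = 0 \<and>
    ?C\<^sup>2 = 0 \<and> (\<Sum>a\<in>UNIV. (?D a)\<^sup>2) = 0"
    unfolding liftH_def by (simp only: add_nonneg_eq_0_iff sum_nonneg zero_le_power2 add_nonneg_nonneg conj_assoc)
  also have "\<dots> \<longleftrightarrow> (\<forall>a b. ?A a b = 0) \<and> (\<forall>a b. ?B a b = 0) \<and> ?C = 0 \<and> (\<forall>a. ?D a = 0)"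
    by (simp only: sum_nonneg_eq_0_iff finite UNIV_I sum_nonneg zero_le_power2 power_eq_0_iff zero_less_numeral simp_thms ball_UNIV)
  also have "\<dots> \<longleftrightarrow> (\<forall>a b. (\<Sum>e\<in>UNIV. \<xi> (Qc e a) * \<xi> (Qc e b)) = (if a = b then 1 else 0)) \<and>
    (\<forall>a b. liftB n d c \<xi> a b = (if a = b then L a - (\<xi> (Sc a))\<^sup>2 else 0)) \<and>
    (\<Sum>k<n. (\<xi> (Xc k))\<^sup>2) + (\<xi> Tc)\<^sup>2 = r\<^sup>2 \<and> (\<forall>a. (\<xi> (Wc a))\<^sup>2 + (\<xi> (Yc a))\<^sup>2 = 1)"
    by (intro conj_cong all_cong1) (auto split: if_splits)
  finally show ?thesis .
qed

lemma sum_product3: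
  fixes x y :: "'a \<Rightarrow> 'b \<Rightarrow> real"
  shows "(\<Sum>k\<in>A. (\<Sum>f\<in>B. x f k) * (\<Sum>g\<in>C. y g k)) = (\<Sum>f\<in>B. \<Sum>g\<in>C. \<Sum>k\<in>A. x f k * y g k)"
  unfolding sum_product by (subst sum.swap, intro sum.cong refl, rule sum.swap)

text \<open>\<open>e\<close> numbers the diagonal slots: the bound in slot \<open>a\<close> is the
  one for the singular value of index \<open>e a\<close>. This ties the unordered type to the
  decreasing order.\<close>

locale lifted =
  fixes n d :: nat and c :: "'m::finite \<Rightarrow> (nat \<Rightarrow> nat) \<Rightarrow> real" and \<Lambda> :: "nat \<Rightarrow> real" and r :: real and e :: "'m \<Rightarrow> nat"
  assumes \<Lambda>: "\<And>k. k \<in> {1..CARD('m)} \<Longrightarrow> 0 \<le> \<Lambda> k" and e: "bij_betw e (UNIV::'m set) {1..CARD('m)}"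
begin

text \<open>The bounds may be replaced by their running minimum, because singular values are decreasing.\<close>
definition mL :: "nat \<Rightarrow> real" where
  "mL k = Min (\<Lambda> ` {1..max 1 (min k CARD('m))})"

definition L :: "'m \<Rightarrow> real" where
  "L a = (mL (e a))\<^sup>2"

abbreviation "H \<equiv> liftH n d c L r"
abbreviation "V \<equiv> liftV n :: 'm idx set"

lemma m_pos: "1 \<le> CARD('m)"
  by (simp add: Suc_le_eq)

lemma e_range: "1 \<le> e a" "e a \<le> CARD('m)"
proof -
  have "e a \<in> {1..CARD('m)}" using e by (auto simp: bij_betw_def)
  then show "1 \<le> e a" "e a \<le> CARD('m)" by auto
qed

lemma mL_nonneg: "0 \<le> mL k"
proof -
  have "max 1 (min k CARD('m)) \<le> CARD('m)" using m_pos by simp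
  then have "0 \<le> \<Lambda> j" if "j \<in> {1..max 1 (min k CARD('m))}" for j
    using that order_trans[OF _ \<open>max 1 (min k CARD('m)) \<le> CARD('m)\<close>, of j] by (intro \<Lambda>) (simp only: atLeastAtMost_iff)
  then show ?thesis unfolding mL_def by (intro Min.boundedI) (auto simp del: max.cobounded1)
qed

lemma mL_le: "k \<in> {1..CARD('m)} \<Longrightarrow> j \<in> {1..k} \<Longrightarrow> mL k \<le> \<Lambda> j"
  unfolding mL_def by (intro Min_le) (auto simp: max_def min_def)

text \<open>It holds for all indices because \<open>mL\<close> clamps its argument to the range from
  1 to \<open>CARD('m)\<close>; \<open>prod_decreasing_le\<close> asks for monotonicity at all
  positive indices.\<close>

lemma mL_antimono: "j \<le> k \<Longrightarrow> mL k \<le> mL j"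
  unfolding mL_def by (intro Min_antimono image_mono) (auto simp: max_def min_def)

lemma mL_ex: "k \<in> {1..CARD('m)} \<Longrightarrow> \<exists>j\<in>{1..k}. mL k = \<Lambda> j"
proof -
  assume k: "k \<in> {1..CARD('m)}"
  have "Min (\<Lambda> ` {1..k}) \<in> \<Lambda> ` {1..k}" using k by (intro Min_in) auto
  moreover have "max 1 (min k CARD('m)) = k" using k by auto
  ultimately show ?thesis unfolding mL_def by (metis imageE)
qed

lemma Q_orth: "H \<xi> = 0 \<Longrightarrow> transpose (liftQ \<xi>) ** liftQ \<xi> = mat 1"
  unfolding liftQ_orth liftH_zero_iff by (simp add: vec_eq_iff mat_def)

lemma Q_orth': "H \<xi> = 0 \<Longrightarrow> (\<Sum>t\<in>UNIV. \<xi> (Qc a t) * \<xi> (Qc b t)) = (if a = b then 1 else 0)"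
proof -
  assume "H \<xi> = 0"
  then have "liftQ \<xi> ** transpose (liftQ \<xi>) = mat 1" using Q_orth matrix_left_right_inverse by blast
  then have "(liftQ \<xi> ** transpose (liftQ \<xi>)) $ a $ b = mat 1 $ a $ b" by simp
  then show ?thesis by (simp add: matrix_matrix_mult_def transpose_def liftQ_def mat_def)
qed

lemma B_diag: "liftB n d c \<xi> a a = (\<Sum>k<n. (\<Sum>f\<in>UNIV. \<xi> (Qc f a) * pd (Xc k) (pX n d c f) \<xi>)\<^sup>2)"
  by (simp add: liftB_def gramP_def power2_eq_square sum_product sum_distrib_left sum_distrib_right mult_ac
      sum.swap[of _ "{..<n}"])

text \<open>The diagonal entries of a conjugated Gram matrix are sums of squares. This bounds the
  slack variables and gives the weights in \<open>lift_gram_bound\<close> their sign.\<close>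

lemma D_nonneg: "H \<xi> = 0 \<Longrightarrow> 0 \<le> L a - (\<xi> (Sc a))\<^sup>2"
proof -
  assume "H \<xi> = 0"
  then have "liftB n d c \<xi> a a = L a - (\<xi> (Sc a))\<^sup>2" unfolding liftH_zero_iff by simp
  moreover have "0 \<le> liftB n d c \<xi> a a" unfolding B_diag by (intro sum_nonneg) auto
  ultimately show ?thesis by simp
qed

lemma lift_bounded:
  assumes "H \<xi> = 0" "v \<in> V"
  shows "\<bar>\<xi> v\<bar> < 2 + \<bar>r\<bar> + (\<Sum>a\<in>UNIV. L a)"
proof -
  have L0: "0 \<le> L a" for a by (simp add: L_def)
  then have sL: "0 \<le> (\<Sum>a\<in>UNIV. L a)" by (intro sum_nonneg) auto
  have sq: "\<bar>t\<bar> \<le> s" if "t\<^sup>2 \<le> s\<^sup>2" "0 \<le> s" for t s :: real using that by (simp add: abs_le_square_iff[symmetric])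
  note z = assms(1)[unfolded liftH_zero_iff]
  have X: "(\<Sum>k<n. (\<xi> (Xc k))\<^sup>2) + (\<xi> Tc)\<^sup>2 = \<bar>r\<bar>\<^sup>2" using z by simp
  have sX: "0 \<le> (\<Sum>k<n. (\<xi> (Xc k))\<^sup>2)" by (intro sum_nonneg) auto
  have r: "\<bar>\<xi> Tc\<bar> \<le> \<bar>r\<bar>" using X sX by (intro sq) auto
  have x: "\<bar>\<xi> (Xc k)\<bar> \<le> \<bar>r\<bar>" if "k < n" for k
  proof (rule sq)
    have "(\<xi> (Xc k))\<^sup>2 \<le> (\<Sum>k<n. (\<xi> (Xc k))\<^sup>2)" using that by (intro member_le_sum) auto
    also have "\<dots> \<le> \<bar>r\<bar>\<^sup>2" using X zero_le_power2[of "\<xi> Tc"] by linarith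
    finally show "(\<xi> (Xc k))\<^sup>2 \<le> \<bar>r\<bar>\<^sup>2" .
  qed simp
  have w: "\<bar>\<xi> (Wc a)\<bar> \<le> 1" "\<bar>\<xi> (Yc a)\<bar> \<le> 1" for a
  proof -
    have "(\<xi> (Wc a))\<^sup>2 + (\<xi> (Yc a))\<^sup>2 = 1" using z by blast
    then have "(\<xi> (Wc a))\<^sup>2 \<le> 1\<^sup>2" "(\<xi> (Yc a))\<^sup>2 \<le> 1\<^sup>2"
      using zero_le_power2[of "\<xi> (Wc a)"] zero_le_power2[of "\<xi> (Yc a)"] unfolding one_power2 by linarith+
    then show "\<bar>\<xi> (Wc a)\<bar> \<le> 1" "\<bar>\<xi> (Yc a)\<bar> \<le> 1" by (auto intro: sq)
  qed
  have q: "\<bar>\<xi> (Qc f a)\<bar> \<le> 1" for f a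
  proof (rule sq)
    have "(\<xi> (Qc f a))\<^sup>2 \<le> (\<Sum>f\<in>UNIV. \<xi> (Qc f a) * \<xi> (Qc f a))"
      unfolding power2_eq_square by (intro member_le_sum) auto
    then show "(\<xi> (Qc f a))\<^sup>2 \<le> 1\<^sup>2" using z by simp
  qed simp
  \<comment> \<open>The summand 1 covers sums below 1, whose square would be smaller than the
    sum.\<close>
  have s: "\<bar>\<xi> (Sc a)\<bar> \<le> 1 + (\<Sum>a\<in>UNIV. L a)" for a
  proof (rule sq)
    have "(\<xi> (Sc a))\<^sup>2 \<le> L a" using D_nonneg[OF assms(1), of a] by simp
    also have "L a \<le> (\<Sum>a\<in>UNIV. L a)" by (intro member_le_sum) (auto simp: L0)
    also have "\<dots> \<le> (1 + (\<Sum>a\<in>UNIV. L a))\<^sup>2" using sL by (simp add: power2_sum)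
    finally show "(\<xi> (Sc a))\<^sup>2 \<le> (1 + (\<Sum>a\<in>UNIV. L a))\<^sup>2" .
  qed (use sL in simp)
  consider (X) k where "v = Xc k" "k < n" | (Q) f a where "v = Qc f a" | (S) a where "v = Sc a" | (T) "v = Tc"
    | (W) a where "v = Wc a" | (Y) a where "v = Yc a"
    using assms(2) unfolding liftV_def by auto
  then show ?thesis
  proof cases
    case X then show ?thesis using x[of k] sL by simp
  next
    case Q then show ?thesis using q[of f a] sL by simp
  next
    case S then show ?thesis using s[of a] sL by simp
  next
    case T then show ?thesis using r sL by simp
  next
    case W then show ?thesis using w(1)[of a] sL by simp
  next
    case Y then show ?thesis using w(2)[of a] sL by simp
  qed
qed

text \<open>The diagonal entries need not be ordered. Only slots with \<open>e a < k\<close> can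
  exceed \<open>(\<Lambda> k)\<^sup>2\<close>, so fewer than \<open>k\<close> eigenvalues do, and
  the k-th largest one does not.\<close>

lemma lift_sub:
  assumes "\<xi> \<in> RV V" "H \<xi> = 0"
  shows "(\<lambda>k. \<xi> (Xc k)) \<in> CLam n d c \<Lambda> \<inter> ballRn n r"
proof -
  let ?x = "\<lambda>k. \<xi> (Xc k)"
  have xn: "?x \<in> Rn n" using assms(1) liftV_notin(2) unfolding Rn_def RV_def by blast
  note z = assms(2)[unfolded liftH_zero_iff]
  have "(\<Sum>k<n. (?x k)\<^sup>2) \<le> r\<^sup>2" using z zero_le_power2[of "\<xi> Tc"] by linarith
  then have ball: "?x \<in> ballRn n r" using xn by (simp add: ballRn_def)
  let ?D = "\<lambda>a. L a - (\<xi> (Sc a))\<^sup>2"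
  have "charpoly (gram n d c ?x) = (\<Prod>a\<in>UNIV. [:- ?D a, 1:])"
  proof (rule charpoly_diagonalized[OF Q_orth[OF assms(2)]])
    show "transpose (liftQ \<xi>) ** gram n d c ?x ** liftQ \<xi> = (\<chi> a b. if a = b then ?D a else 0)"
      unfolding liftB_eq using z by (simp add: vec_eq_iff)
  qed
  then have eigs: "eigs_desc (gram n d c ?x) = rev (sorted_list_of_multiset (image_mset ?D (mset_set UNIV)))"
    by (rule eigs_desc_diagonalized)
  have "sing_val n d c ?x k \<le> \<Lambda> k" if k: "k \<in> {1..CARD('m)}" for k
  proof -
    have "eigs_desc (gram n d c ?x) ! (k - 1) \<le> (\<Lambda> k)\<^sup>2"
    proof (rule sorted_desc_nth_le[OF eigs])
      have "{a. (\<Lambda> k)\<^sup>2 < ?D a} \<subseteq> {a. e a \<in> {1..<k}}"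
      proof
        fix a assume "a \<in> {a. (\<Lambda> k)\<^sup>2 < ?D a}"
        then have "(\<Lambda> k)\<^sup>2 < ?D a" by simp
        then have "(\<Lambda> k)\<^sup>2 < (mL (e a))\<^sup>2" using zero_le_power2[of "\<xi> (Sc a)"] unfolding L_def by linarith
        then have "\<Lambda> k < mL (e a)" using mL_nonneg power_less_imp_less_base by blast
        then have "\<not> k \<le> e a" using mL_le[of "e a" k] k e_range[of a] by auto
        then show "a \<in> {a. e a \<in> {1..<k}}" using e_range by simp
      qed
      then have "card {a. (\<Lambda> k)\<^sup>2 < ?D a} \<le> card {a. e a \<in> {1..<k}}" by (intro card_mono) auto
      also have "\<dots> \<le> card {1..<k}"
        using e by (intro card_inj_on_le[where f = e]) (auto simp: bij_betw_def inj_on_def)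
      also have "\<dots> < k" using k by simp
      finally show "card {a. (\<Lambda> k)\<^sup>2 < ?D a} < k" .
    qed (use k in auto)
    then have "sqrt (eigs_desc (gram n d c ?x) ! (k - 1)) \<le> sqrt ((\<Lambda> k)\<^sup>2)" by (simp only: real_sqrt_le_iff)
    then show ?thesis using \<Lambda>[OF k] by (simp add: sing_val_def)
  qed
  then show ?thesis using xn ball by (simp add: CLam_def)
qed

lemma conjugate_entry:
  fixes G :: "real^'m^'m" and q :: "'m \<Rightarrow> real^'m"
  shows "(transpose (\<chi> f a. q a $ f) ** G ** (\<chi> f a. q a $ f)) $ a $ b = q a \<bullet> (G *v q b)"
proof -
  have "(transpose (\<chi> f a. q a $ f) ** (G ** (\<chi> f a. q a $ f))) $ a $ b = q a \<bullet> (G *v q b)"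
    by (simp add: matrix_matrix_mult_def matrix_vector_mult_def transpose_def inner_vec_def)
  then show ?thesis by (simp only: matrix_mul_assoc)
qed

text \<open>Eigenvectors are permuted so that slot \<open>a\<close> carries the eigenvalue at place
  \<open>e a\<close>, and the slacks are square roots. The cylinder coordinates can be prescribed
  freely.\<close>

lemma lift_ex:
  assumes x: "x \<in> CLam n d c \<Lambda>" "x \<in> ballRn n r" and w: "\<And>a. \<bar>w a\<bar> \<le> 1"
  shows "\<exists>\<xi>\<in>RV V. H \<xi> = 0 \<and> (\<lambda>k. \<xi> (Xc k)) = x \<and> (\<forall>a. \<xi> (Wc a) = w a)"
proof -
  let ?G = "gram n d c x"
  have "transpose ?G = ?G" by (simp add: gram_def transpose_def vec_eq_iff mult.commute)
  then obtain u ev where u: "\<And>a b::'m. u a \<bullet> u b = (if a = b then 1 else 0)" "\<And>a. ?G *v u a = ev a *\<^sub>R u a"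
    using spectral_theorem by metis
  have conj: "(transpose (\<chi> f a. u (p a) $ f) ** ?G ** (\<chi> f a. u (p a) $ f)) $ a $ b = (if a = b then ev (p a) else 0)"
    if "inj p" for p :: "'m \<Rightarrow> 'm" and a b
    unfolding conjugate_entry[of "\<lambda>a. u (p a)"] using that by (simp add: u inj_eq)
  have "charpoly ?G = (\<Prod>a\<in>UNIV. [:- ev a, 1:])"
  proof (rule charpoly_diagonalized)
    show "transpose (\<chi> f a. u a $ f) ** (\<chi> f a. u a $ f) = mat 1"
      using u(1) by (simp add: vec_eq_iff matrix_matrix_mult_def transpose_def mat_def inner_vec_def)
    show "transpose (\<chi> f a. u a $ f) ** ?G ** (\<chi> f a. u a $ f) = (\<chi> a b. if a = b then ev a else 0)"
      using conj[of "\<lambda>a. a"] by (simp add: vec_eq_iff inj_on_def)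
  qed
  then have eigs: "eigs_desc ?G = rev (sorted_list_of_multiset (image_mset ev (mset_set UNIV)))"
    by (rule eigs_desc_diagonalized)
  let ?l = "eigs_desc ?G"
  obtain p where p: "bij p" "\<And>a. ev (p a) = ?l ! (e a - 1)" using sorted_desc_arrange[OF eigs e] by blast
  have "mset ?l = image_mset ev (mset_set UNIV)" unfolding eigs by simp
  then have len: "length ?l = CARD('m)" by (metis size_image_mset size_mset size_mset_set)
  have sorted: "sorted (rev ?l)" unfolding eigs by simp
  have le: "ev (p a) \<le> L a" for a
  proof -
    \<comment> \<open>An index at which the running minimum is attained; the eigenvalue at the later
      place \<open>e a\<close> is at most the one at place \<open>j\<close>.\<close>
    obtain j where j: "j \<in> {1..e a}" "mL (e a) = \<Lambda> j" using mL_ex[of "e a"] e_range by auto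
    have jm: "j \<in> {1..CARD('m)}" using j(1) e_range(2)[of a] by auto
    have "ev (p a) \<le> ?l ! (j - 1)"
      unfolding p(2) using j(1) e_range[of a] len by (intro sorted_rev_nth_mono[OF sorted]) auto
    moreover have "sqrt (?l ! (j - 1)) \<le> \<Lambda> j" using x(1) jm by (auto simp: CLam_def sing_val_def)
    then have "?l ! (j - 1) \<le> (\<Lambda> j)\<^sup>2" using sqrt_le_D by blast
    ultimately show ?thesis by (simp add: L_def j(2))
  qed
  define \<xi> where "\<xi> v = (case v of Xc k \<Rightarrow> x k | Qc f a \<Rightarrow> u (p a) $ f | Sc a \<Rightarrow> sqrt (L a - ev (p a))
    | Tc \<Rightarrow> sqrt (r\<^sup>2 - (\<Sum>k<n. (x k)\<^sup>2)) | Wc a \<Rightarrow> w a | Yc a \<Rightarrow> sqrt (1 - (w a)\<^sup>2) | Uc a \<Rightarrow> 0)" for v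
  have Xx: "(\<lambda>k. \<xi> (Xc k)) = x" by (simp add: \<xi>_def)
  have xn: "x k = 0" if "n \<le> k" for k using x(1) that by (simp add: CLam_def Rn_def)
  have "\<xi> \<in> RV V"
    unfolding RV_def
  proof (intro CollectI allI impI)
    fix v assume "v \<notin> V"
    show "\<xi> v = 0"
    proof (cases v)
      case (Xc k)
      then have "\<not> k < n" using liftV_simps(1) \<open>v \<notin> V\<close> by blast
      then show ?thesis using xn Xc by (simp add: \<xi>_def)
    qed (use \<open>v \<notin> V\<close> in \<open>auto simp: \<xi>_def liftV_simps\<close>)
  qed
  moreover have "H \<xi> = 0"
    unfolding liftH_zero_iff
  proof (intro conjI allI)
    show "(\<Sum>f\<in>UNIV. \<xi> (Qc f a) * \<xi> (Qc f b)) = (if a = b then 1 else 0)" for a b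
      using u(1)[of "p a" "p b"] p(1) by (simp add: \<xi>_def inner_vec_def bij_def inj_eq)
    have "liftQ \<xi> = (\<chi> f a. u (p a) $ f)" by (simp add: liftQ_def \<xi>_def)
    then have "liftB n d c \<xi> a b = (if a = b then ev (p a) else 0)" for a b
      using arg_cong[OF liftB_eq[of \<xi> n d c], of "\<lambda>M. M $ a $ b"] conj[of p a b] p(1) by (simp add: Xx bij_def)
    then show "liftB n d c \<xi> a b = (if a = b then L a - (\<xi> (Sc a))\<^sup>2 else 0)" for a b
      using le by (simp add: \<xi>_def)
    have "(\<Sum>k<n. (x k)\<^sup>2) \<le> r\<^sup>2" using x(2) by (simp add: ballRn_def)
    then show "(\<Sum>k<n. (\<xi> (Xc k))\<^sup>2) + (\<xi> Tc)\<^sup>2 = r\<^sup>2" by (simp add: \<xi>_def)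
    have "(w a)\<^sup>2 \<le> 1" for a using w[of a] by (simp add: abs_square_le_1)
    then show "(\<xi> (Wc a))\<^sup>2 + (\<xi> (Yc a))\<^sup>2 = 1" for a by (simp add: \<xi>_def)
  qed
  moreover have "\<xi> (Wc a) = w a" for a by (simp add: \<xi>_def)
  ultimately show ?thesis using Xx by blast
qed

text \<open>The components along \<open>u\<close> indexed by \<open>J\<close>, completed by free coordinates in \<open>[-1, 1]\<close>: the
  \<open>card J\<close>-dimensional measure becomes a volume.\<close>
definition cylF :: "('k \<Rightarrow> real^'m) \<Rightarrow> 'k set \<Rightarrow> ('k \<Rightarrow> 'm) \<Rightarrow> 'k \<Rightarrow> ('m idx \<Rightarrow> real) \<Rightarrow> real" where
  "cylF u J \<eta> a \<xi> = (if a \<in> J then \<Sum>b\<in>UNIV. u a $ b * pX n d c b \<xi> else \<xi> (Wc (\<eta> a)))"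

abbreviation cylC :: "'m idx set" where
  "cylC \<equiv> Xc ` {..<n} \<union> range Wc"

lemma polyf_cylF: "polyf cylC (4 * d + 4) (cylF u J \<eta> a)"
proof (cases "a \<in> J")
  case True
  have "polyf cylC (4 * d + 4) (\<lambda>\<xi>. \<Sum>b\<in>UNIV. u a $ b * pX n d c b \<xi>)"
    by (intro polyf_sum polyf_cmult polyf_mono[OF polyf_pX]) auto
  then show ?thesis using True by (simp add: cylF_def[abs_def])
next
  case False
  have "polyf cylC (4 * d + 4) (\<lambda>\<xi>. \<xi> (Wc (\<eta> a)))" by (rule polyf_var') auto
  then show ?thesis using False by (simp add: cylF_def[abs_def])
qed

lemma pd_cylF_X: "pd (Xc k) (cylF u J \<eta> a) \<xi> = (if a \<in> J then \<Sum>b\<in>UNIV. u a $ b * pd (Xc k) (pX n d c b) \<xi> else 0)"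
proof (cases "a \<in> J")
  case True
  have "pd (Xc k) (\<lambda>\<xi>. \<Sum>b\<in>UNIV. u a $ b * pX n d c b \<xi>) \<xi> = (\<Sum>b\<in>UNIV. pd (Xc k) (\<lambda>\<xi>. u a $ b * pX n d c b \<xi>) \<xi>)"
    by (subst pd_sum[OF polyf_cmult[OF polyf_pX]]) auto
  then show ?thesis using True by (simp add: cylF_def[abs_def] pd_cmult[OF polyf_pX])
qed (simp add: cylF_def[abs_def] pd_var)

lemma pd_cylF_W: "pd (Wc f) (cylF u J \<eta> a) \<xi> = (if a \<notin> J \<and> f = \<eta> a then 1 else 0)"
proof (cases "a \<in> J")
  case True
  have "polyf (Xc ` {..<n}) d (\<lambda>\<xi>. \<Sum>b\<in>UNIV. u a $ b * pX n d c b \<xi>)"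
    by (intro polyf_sum polyf_cmult polyf_pX)
  then have "pd (Wc f) (\<lambda>\<xi>. \<Sum>b\<in>UNIV. u a $ b * pX n d c b \<xi>) \<xi> = 0" by (rule pd_notin) auto
  then show ?thesis using True by (simp add: cylF_def[abs_def])
qed (simp add: cylF_def[abs_def] pd_var)

lemma gram_spectral:
  assumes "H \<xi> = 0"
  shows "gramP n d c \<xi> f g = (\<Sum>t\<in>UNIV. \<xi> (Qc f t) * (L t - (\<xi> (Sc t))\<^sup>2) * \<xi> (Qc g t))"
proof -
  let ?Q = "liftQ \<xi>" and ?G = "gram n d c (\<lambda>k. \<xi> (Xc k))"
  let ?D = "\<chi> a b. if a = b then L a - (\<xi> (Sc a))\<^sup>2 else 0"
  have D: "transpose ?Q ** ?G ** ?Q = ?D"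
    unfolding liftB_eq using assms[unfolded liftH_zero_iff] by (simp add: vec_eq_iff)
  have QQ: "?Q ** transpose ?Q = mat 1" using Q_orth[OF assms] matrix_left_right_inverse by blast
  have "?Q ** ?D ** transpose ?Q = (?Q ** transpose ?Q) ** ?G ** (?Q ** transpose ?Q)"
    unfolding D[symmetric] by (simp only: matrix_mul_assoc)
  then have "?G = ?Q ** ?D ** transpose ?Q" by (simp add: QQ)
  then have "?G $ f $ g = (?Q ** ?D ** transpose ?Q) $ f $ g" by simp
  also have "\<dots> = (\<Sum>t\<in>UNIV. \<xi> (Qc f t) * (L t - (\<xi> (Sc t))\<^sup>2) * \<xi> (Qc g t))"
    by (simp add: matrix_matrix_mult_def transpose_def liftQ_def if_distrib[of "\<lambda>x. _ * x"] sum.delta cong: if_cong)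
  finally show ?thesis by (simp add: gram_gramP)
qed

text \<open>The Gram matrix of \<open>cylF\<close> is \<open>A\<close> times a diagonal matrix times
  the transpose of \<open>A\<close>, where \<open>A\<close> has orthonormal rows. A nonzero minor of
  \<open>A\<close> must use the free columns of all rows outside \<open>J\<close>, hence exactly
  \<open>i\<close> columns weighted by eigenvalues, and these weights multiply to at most the first
  \<open>i\<close> squared bounds.\<close>

lemma lift_gram_bound:
  fixes u :: "'k::finite \<Rightarrow> real^'m" and \<eta> :: "'k \<Rightarrow> 'm"
  assumes \<xi>: "H \<xi> = 0" and u: "\<And>a b. u a \<bullet> u b = (if a = b then 1 else 0)" and \<eta>: "bij \<eta>"
    and i: "card J = i" "i \<le> CARD('m)"
  shows "det (\<chi> a b. \<Sum>c\<in>cylC. pd c (cylF u J \<eta> a) \<xi> * pd c (cylF u J \<eta> b) \<xi>) \<le> (\<Prod>k\<in>{1..i}. \<Lambda> k)\<^sup>2"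
proof -
  define D where "D t = L t - (\<xi> (Sc t))\<^sup>2" for t
  have D: "0 \<le> D t" "D t \<le> L t" for t using D_nonneg[OF \<xi>, of t] by (simp_all add: D_def)
  define R where "R a t = (\<Sum>f\<in>UNIV. u a $ f * \<xi> (Qc f t))" for a t
  \<comment> \<open>\<open>Inl\<close> columns hold the coordinates of \<open>u a\<close> in the
    eigenbasis, \<open>Inr\<close> columns the free coordinates with weight 1.\<close>
  define A where "A a z = (case z of Inl t \<Rightarrow> if a \<in> J then R a t else 0 | Inr f \<Rightarrow> if a \<notin> J \<and> f = \<eta> a then 1 else 0)"
    for a and z :: "'m + 'm"
  define \<omega> where "\<omega> z = (case z of Inl t \<Rightarrow> D t | Inr f \<Rightarrow> 1)" for z :: "'m + 'm"
  have sumU: "(\<Sum>z\<in>(UNIV :: ('m + 'm) set). g z) = (\<Sum>t\<in>UNIV. g (Inl t)) + (\<Sum>f\<in>UNIV. g (Inr f))" for g :: "_ \<Rightarrow> real"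
    unfolding UNIV_Plus_UNIV[symmetric] by (subst sum.Plus) (auto simp: comp_def)
  have inr: "(\<Sum>f\<in>UNIV. A a (Inr f) * A b (Inr f)) = (if a \<notin> J \<and> a = b then 1 else 0)" for a b
  proof -
    have "(\<Sum>f\<in>UNIV. A a (Inr f) * A b (Inr f)) = (\<Sum>f\<in>UNIV. if f = \<eta> a then (if a \<notin> J \<and> a = b then 1 else 0) else 0)"
      using \<eta> by (intro sum.cong) (auto simp: A_def bij_def inj_eq)
    then show ?thesis by simp
  qed
  have gram: "(\<Sum>c\<in>cylC. pd c (cylF u J \<eta> a) \<xi> * pd c (cylF u J \<eta> b) \<xi>) = (\<Sum>z\<in>UNIV. A a z * (\<omega> z * A b z))" for a b
  proof -
    let ?p = "\<lambda>c. pd c (cylF u J \<eta> a) \<xi> * pd c (cylF u J \<eta> b) \<xi>"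
    have "(\<Sum>c\<in>cylC. ?p c) = (\<Sum>c\<in>Xc ` {..<n}. ?p c) + (\<Sum>c\<in>range Wc. ?p c)"
      by (intro sum.union_disjoint) auto
    also have "(\<Sum>c\<in>range Wc. ?p c) = (\<Sum>f\<in>UNIV. A a (Inr f) * A b (Inr f))"
      by (subst sum.reindex) (auto simp: inj_on_def pd_cylF_W A_def intro!: sum.cong)
    also have "(\<Sum>c\<in>Xc ` {..<n}. ?p c) = (\<Sum>k<n. ?p (Xc k))"
      by (subst sum.reindex) (auto simp: inj_on_def)
    also have "\<dots> = (if a \<in> J \<and> b \<in> J then \<Sum>k<n. (\<Sum>f\<in>UNIV. u a $ f * pd (Xc k) (pX n d c f) \<xi>) * (\<Sum>g\<in>UNIV. u b $ g * pd (Xc k) (pX n d c g) \<xi>) else 0)"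
      by (auto simp: pd_cylF_X)
    also have "(\<Sum>k<n. (\<Sum>f\<in>UNIV. u a $ f * pd (Xc k) (pX n d c f) \<xi>) * (\<Sum>g\<in>UNIV. u b $ g * pd (Xc k) (pX n d c g) \<xi>)) =
      (\<Sum>f\<in>UNIV. \<Sum>g\<in>UNIV. u a $ f * u b $ g * gramP n d c \<xi> f g)"
      by (subst sum_product3) (simp add: gramP_def sum_distrib_left mult_ac)
    also have "\<dots> = (\<Sum>t\<in>UNIV. R a t * (D t * R b t))"
    proof -
      have eq: "R a t * (D t * R b t) = (\<Sum>f\<in>UNIV. u a $ f * \<xi> (Qc f t)) * (\<Sum>g\<in>UNIV. D t * (u b $ g * \<xi> (Qc g t)))" for t
        unfolding R_def by (simp only: sum_distrib_left)
      show ?thesis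
        unfolding eq sum_product3 gram_spectral[OF \<xi>] D_def[symmetric] by (simp add: sum_distrib_left mult_ac)
    qed
    finally have "(\<Sum>c\<in>cylC. ?p c) = (if a \<in> J \<and> b \<in> J then \<Sum>t\<in>UNIV. R a t * (D t * R b t) else 0) + (\<Sum>f\<in>UNIV. A a (Inr f) * A b (Inr f))" .
    also have "\<dots> = (\<Sum>z\<in>UNIV. A a z * (\<omega> z * A b z))"
      unfolding sumU by (cases "a \<in> J"; cases "b \<in> J") (simp_all add: A_def \<omega>_def)
    finally show ?thesis .
  qed
  \<comment> \<open>Rows in \<open>J\<close> stay orthonormal because the matrix
    \<open>liftQ \<xi>\<close> is orthogonal.\<close>
  have orth: "(\<Sum>z\<in>UNIV. A a z * A b z) = (if a = b then 1 else 0)" for a b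
  proof -
    have "(\<Sum>t\<in>UNIV. R a t * R b t) = (\<Sum>f\<in>UNIV. \<Sum>g\<in>UNIV. u a $ f * u b $ g * (\<Sum>t\<in>UNIV. \<xi> (Qc f t) * \<xi> (Qc g t)))"
      unfolding R_def by (subst sum_product3) (simp add: sum_distrib_left mult_ac)
    also have "\<dots> = u a \<bullet> u b"
      unfolding Q_orth'[OF \<xi>] by (simp add: inner_vec_def if_distrib[of "\<lambda>x. _ * x"] sum.delta cong: if_cong)
    finally have "(\<Sum>t\<in>UNIV. R a t * R b t) = (if a = b then 1 else 0)" by (simp add: u)
    moreover have "(\<Sum>t\<in>UNIV. A a (Inl t) * A b (Inl t)) = (if a \<in> J \<and> b \<in> J then \<Sum>t\<in>UNIV. R a t * R b t else 0)"
      by (cases "a \<in> J"; cases "b \<in> J") (simp_all add: A_def)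
    ultimately show ?thesis unfolding sumU inr by auto
  qed
  have W: "(\<Prod>a\<in>UNIV. \<omega> (\<kappa> a)) \<le> (\<Prod>k\<in>{1..i}. \<Lambda> k)\<^sup>2" if nz: "det (\<chi> a b. A a (\<kappa> b)) \<noteq> 0" for \<kappa>
  proof -
    have inj: "inj \<kappa>"
    proof (rule injI, rule ccontr)
      fix b b' assume b: "\<kappa> b = \<kappa> b'" "b \<noteq> b'"
      then have "det (\<chi> a b. A a (\<kappa> b)) = 0" by (intro det_identical_columns[OF b(2)]) (simp add: column_def)
      then show False using nz by simp
    qed
    have row: "\<exists>b. \<kappa> b = Inr (\<eta> a)" if "a \<notin> J" for a
    proof (rule ccontr)
      assume no: "\<not> ?thesis"
      have "A a (\<kappa> b) = 0" for b
        using that no by (cases "\<kappa> b") (auto simp: A_def)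
      then have "row a (\<chi> a b. A a (\<kappa> b)) = 0" by (simp add: row_def vec_eq_iff)
      then show False using nz det_zero_row(1) by blast
    qed
    have col: "a \<notin> J" if "\<kappa> b = Inr (\<eta> a)" for a b
    proof
      assume "a \<in> J"
      then have "A a' (\<kappa> b) = 0" for a' using that \<eta> by (auto simp: A_def bij_def inj_eq)
      then have "column b (\<chi> a b. A a (\<kappa> b)) = 0" by (simp add: column_def vec_eq_iff)
      then show False using nz det_zero_column(1) by blast
    qed
    define B where "B = {b. isl (\<kappa> b)}"
    \<comment> \<open>The selected free columns correspond to the rows outside \<open>J\<close>;
      comparing complements gives \<open>card B = i\<close>.\<close>
    have img: "\<kappa> ` (- B) = (Inr \<circ> \<eta>) ` (- J)"
    proof (intro equalityI subsetI)
      fix z assume "z \<in> \<kappa> ` (- B)"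
      then obtain b where b: "z = \<kappa> b" "\<not> isl (\<kappa> b)" by (auto simp: B_def)
      then obtain f where f: "\<kappa> b = Inr f" by (cases "\<kappa> b") auto
      obtain a where "f = \<eta> a" using \<eta> by (metis bij_pointE)
      then show "z \<in> (Inr \<circ> \<eta>) ` (- J)" using b f col by auto
    next
      fix z :: "'m + 'm" assume "z \<in> (Inr \<circ> \<eta>) ` (- J)"
      then obtain a where a: "a \<notin> J" "z = Inr (\<eta> a)" by auto
      then obtain b where b: "\<kappa> b = Inr (\<eta> a)" using row by blast
      then have "b \<in> - B" by (simp add: B_def)
      then show "z \<in> \<kappa> ` (- B)" using a(2) b by (metis imageI)
    qed
    have "inj_on (Inr \<circ> \<eta> :: 'k \<Rightarrow> 'm + 'm) (- J)" using \<eta> by (auto simp: inj_on_def bij_def)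
    then have "card (- B) = card (- J)"
      using card_image[of \<kappa> "- B"] card_image[of "Inr \<circ> \<eta> :: 'k \<Rightarrow> 'm + 'm" "- J"] img inj by (metis inj_on_subset subset_UNIV)
    moreover have "card B \<le> CARD('k)" "card J \<le> CARD('k)" by (auto intro: card_mono)
    ultimately have cB: "card B = i" using i by (simp add: Compl_eq_Diff_UNIV card_Diff_subset)
    have Bl: "\<kappa> b = Inl (projl (\<kappa> b))" if "b \<in> B" for b using that by (auto simp: B_def)
    have injB: "inj_on (\<lambda>b. e (projl (\<kappa> b))) B"
    proof (rule inj_onI)
      fix b b' assume b: "b \<in> B" "b' \<in> B" "e (projl (\<kappa> b)) = e (projl (\<kappa> b'))"
      then have "projl (\<kappa> b) = projl (\<kappa> b')" using e by (auto simp: bij_betw_def inj_on_def)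
      then have "\<kappa> b = \<kappa> b'" using Bl[OF b(1)] Bl[OF b(2)] by metis
      then show "b = b'" using inj by (simp add: inj_eq)
    qed
    have "(\<Prod>a\<in>UNIV. \<omega> (\<kappa> a)) = (\<Prod>b\<in>B. \<omega> (\<kappa> b))"
    proof (rule prod.mono_neutral_right)
      show "\<forall>b\<in>UNIV - B. \<omega> (\<kappa> b) = 1"
      proof
        fix b assume "b \<in> UNIV - B"
        then show "\<omega> (\<kappa> b) = 1" by (cases "\<kappa> b") (auto simp: B_def \<omega>_def)
      qed
    qed auto
    also have "\<dots> = (\<Prod>b\<in>B. D (projl (\<kappa> b)))"
    proof (rule prod.cong[OF refl])
      fix b assume "b \<in> B"
      then show "\<omega> (\<kappa> b) = D (projl (\<kappa> b))" using Bl by (cases "\<kappa> b") (auto simp: \<omega>_def B_def)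
    qed
    also have "\<dots> \<le> (\<Prod>b\<in>B. (mL (e (projl (\<kappa> b))))\<^sup>2)"
      using D by (intro prod_mono) (simp add: L_def)
    also have "\<dots> = (\<Prod>k\<in>(\<lambda>b. e (projl (\<kappa> b))) ` B. (mL k)\<^sup>2)"
      by (simp add: prod.reindex[OF injB])
    \<comment> \<open>The selected slots occupy \<open>i\<close> distinct places, and
      \<open>mL\<close> does not increase.\<close>
    also have "\<dots> \<le> (\<Prod>k\<in>{1..i}. (mL k)\<^sup>2)"
    proof (rule prod_decreasing_le)
      show "card ((\<lambda>b. e (projl (\<kappa> b))) ` B) = i" using cB card_image[OF injB] by simp
      show "(\<lambda>b. e (projl (\<kappa> b))) ` B \<subseteq> {1..}" using e_range(1) by auto
      show "(mL k)\<^sup>2 \<le> (mL j)\<^sup>2" if "1 \<le> j" "j \<le> k" for j k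
        using that by (intro power_mono mL_antimono mL_nonneg)
    qed auto
    also have "\<dots> \<le> (\<Prod>k\<in>{1..i}. (\<Lambda> k)\<^sup>2)"
      using i by (intro prod_mono conjI power_mono mL_le mL_nonneg) auto
    also have "\<dots> = (\<Prod>k\<in>{1..i}. \<Lambda> k)\<^sup>2" by (simp add: prod_power_distrib)
    finally show ?thesis .
  qed
  have "det (\<chi> a b. \<Sum>c\<in>cylC. pd c (cylF u J \<eta> a) \<xi> * pd c (cylF u J \<eta> b) \<xi>) \<le>
    (\<Prod>k\<in>{1..i}. \<Lambda> k)\<^sup>2 * det (\<chi> a b. \<Sum>z\<in>UNIV. A a z * A b z)"
    unfolding gram by (rule det_weighted_gram_le) (use W in auto)
  also have "(\<chi> a b. \<Sum>z\<in>UNIV. A a z * A b z) = (mat 1 :: real^'k^'k)"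
    by (simp add: orth mat_def)
  finally show ?thesis by simp
qed

end

section \<open>Hausdorff measure and Gaussian planes\<close>

text \<open>A well-ordered copy of a finite type, because the change of variables formula of the library
  is restricted to \<open>real^'n\<close> with a well-ordered index type.\<close>
typedef 'a wo = "UNIV :: 'a set" by auto

lemma inj_Rep_wo: "inj Rep_wo"
  by (simp add: inj_on_def Rep_wo_inject)

lemma bij_Rep_wo: "bij Rep_wo"
  using inj_Rep_wo by (metis Abs_wo_inverse UNIV_I bij_def surj_def)

instance wo :: (finite) finite
  by standard (metis bij_Rep_wo bij_betw_finite finite)

lemma card_wo: "CARD('a wo) = CARD('a)"
  using bij_betw_same_card[OF bij_Rep_wo] .

instantiation wo :: (finite) wellorder
begin

definition less_eq_wo :: "'a wo \<Rightarrow> 'a wo \<Rightarrow> bool" where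
  "less_eq_wo x y \<longleftrightarrow> to_nat (Rep_wo x) \<le> to_nat (Rep_wo y)"

definition less_wo :: "'a wo \<Rightarrow> 'a wo \<Rightarrow> bool" where
  "less_wo x y \<longleftrightarrow> to_nat (Rep_wo x) < to_nat (Rep_wo y)"

instance
proof
  fix P :: "'a wo \<Rightarrow> bool" and a
  assume step: "\<And>x. (\<And>y. y < x \<Longrightarrow> P y) \<Longrightarrow> P x"
  show "P a"
    by (rule measure_induct_rule[where f = "\<lambda>x. to_nat (Rep_wo x)"]) (use step in \<open>auto simp: less_wo_def\<close>)
qed (auto simp: less_eq_wo_def less_wo_def Rep_wo_inject)

end

lemma orthonormal_expansion:
  fixes u :: "'k::finite \<Rightarrow> 'a::euclidean_space"
  assumes u: "\<And>a b. u a \<bullet> u b = (if a = b then 1 else 0)" and x: "x \<in> span (u ` J)"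
  shows "x = (\<Sum>a\<in>J. (u a \<bullet> x) *\<^sub>R u a)"
proof -
  have inj: "inj_on u J"
  proof (rule inj_onI)
    fix a b assume "u a = u b"
    then show "a = b" using u[of a b] u[of b b] by (auto split: if_splits)
  qed
  obtain c' where "x = (\<Sum>v\<in>u ` J. c' v *\<^sub>R v)"
    using x unfolding span_finite[OF finite_imageI[OF finite[of J]]] by auto
  then have x: "x = (\<Sum>a\<in>J. c' (u a) *\<^sub>R u a)" using inj by (simp add: sum.reindex)
  have "u a \<bullet> x = c' (u a)" if "a \<in> J" for a
    unfolding x using that by (simp add: inner_sum_right u if_distrib[of "\<lambda>t. _ * t"] sum.delta' cong: if_cong)
  then show ?thesis using x by simp
qed

text \<open>\<open>Eh\<close> contains the cylinder over \<open>E\<close>, so the number of small cubes that are needed to cover \<open>E\<close>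
  is controlled by the volume of \<open>Eh\<close>.\<close>
lemma hausdorff_outer_le:
  fixes E :: "(real^'m::finite) set" and u :: "'k::finite \<Rightarrow> real^'m"
  assumes u: "\<And>a b. u a \<bullet> u b = (if a = b then 1 else 0)" and i: "card J = i" "1 \<le> i"
    and E: "bounded E" "E \<subseteq> span (u ` J)"
    and Eh: "compact Eh" "\<And>y x. x \<in> E \<Longrightarrow> (\<forall>a\<in>J. y $ a = u a \<bullet> x) \<Longrightarrow> (\<forall>a. a \<notin> J \<longrightarrow> \<bar>y $ a\<bar> \<le> 1) \<Longrightarrow> y \<in> Eh"
  shows "hausdorff_outer i E \<le> ennreal (pi powr (real i / 2) / Gamma (real i / 2 + 1) * (real i / 2) ^ i) * emeasure lborel (Eh :: (real^'k) set)"
proof -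
  define \<omega> where "\<omega> = pi powr (real i / 2) / Gamma (real i / 2 + 1)"
  have \<omega>: "0 \<le> \<omega>" unfolding \<omega>_def by (intro divide_nonneg_nonneg less_imp_le Gamma_real_pos) auto
  obtain \<mu> where \<mu>: "emeasure lborel Eh = ennreal \<mu>" "0 \<le> \<mu>"
    using emeasure_compact_finite[OF Eh(1)] by (cases "emeasure lborel Eh") auto
  have expand: "norm x \<le> (\<Sum>a\<in>J. \<bar>u a \<bullet> x\<bar>)" if "x \<in> span (u ` J)" for x
  proof -
    have "norm x \<le> (\<Sum>a\<in>J. norm ((u a \<bullet> x) *\<^sub>R u a))"
      using orthonormal_expansion[OF u that] norm_sum by metis
    also have "\<dots> = (\<Sum>a\<in>J. \<bar>u a \<bullet> x\<bar>)" using u by (simp add: norm_eq_sqrt_inner)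
    finally show ?thesis .
  qed
  have main: "(INF C\<in>{C :: nat \<Rightarrow> (real^'m) set. E \<subseteq> (\<Union>j. C j) \<and> (\<forall>j. bounded (C j) \<and> diameter (C j) \<le> \<delta>)}.
      (\<Sum>j. ennreal (\<omega> * (diameter (C j) / 2) ^ i))) \<le> ennreal (\<omega> * (real i / 2) ^ i * (\<mu> + e))"
    if \<delta>: "0 < \<delta>" and e: "0 < e" for \<delta> e
  proof -
    have Eb: "Eh \<in> sets borel" using Eh(1) by (rule borel_compact)
    then have "Eh \<in> sets lebesgue" by simp
    then obtain T where T: "open T" "Eh \<subseteq> T" "emeasure lebesgue (T - Eh) < ennreal e"
      using e by (rule sets_lebesgue_outer_open)
    have T\<mu>: "emeasure lborel T \<le> ennreal (\<mu> + e)"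
    proof -
      have "T = Eh \<union> (T - Eh)" using T by blast
      then have "emeasure lborel T \<le> emeasure lborel Eh + emeasure lborel (T - Eh)"
        using emeasure_subadditive[of Eh lborel "T - Eh"] Eb T(1) by simp
      also have "\<dots> \<le> ennreal \<mu> + ennreal e"
      proof (rule add_mono)
        have "T - Eh \<in> sets borel" using Eb T(1) by auto
        then have "emeasure lborel (T - Eh) = emeasure lebesgue (T - Eh)" by simp
        then show "emeasure lborel (T - Eh) \<le> ennreal e" using T(3) by simp
      qed (simp add: \<mu>)
      finally show ?thesis using \<mu> e by (simp add: ennreal_plus)
    qed
    obtain s where s: "0 < s" "(\<Union>x\<in>Eh. ball x s) \<subseteq> T"
      using compact_subset_open_imp_ball_epsilon_subset[OF Eh(1) T(1,2)] by blast
    \<comment> \<open>Mesh size: cells of side below \<open>b\<close> have diameter at most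
      \<delta>, and the boxes over them stay within distance \<open>s\<close> of
      \<open>Eh\<close>.\<close>
    define b where "b = min s \<delta> / real (CARD('k) + i + 1)"
    have b0: "0 < b" using s \<delta> by (simp add: b_def)
    obtain K where K: "inverse (real (Suc K)) < b" using reals_Archimedean[OF b0] by blast
    define \<epsilon> where "\<epsilon> = inverse (real (Suc K))"
    have \<epsilon>: "0 < \<epsilon>" "\<epsilon> < b" using K by (simp_all add: \<epsilon>_def)
    have bb: "b * real (CARD('k) + i + 1) = min s \<delta>" by (simp add: b_def)
    have i\<epsilon>: "real i * \<epsilon> \<le> \<delta>" "real CARD('k) * \<epsilon> < s"
    proof -
      have "real i * \<epsilon> \<le> real (CARD('k) + i + 1) * b" using \<epsilon> by (intro mult_mono) auto
      then show "real i * \<epsilon> \<le> \<delta>" using bb by (simp add: mult.commute)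
      have "real CARD('k) * \<epsilon> < real (CARD('k) + i + 1) * b" using \<epsilon> by (intro mult_strict_mono) auto
      then show "real CARD('k) * \<epsilon> < s" using bb by (simp add: mult.commute)
    qed
    define fl where "fl x = restrict (\<lambda>a. \<lfloor>(u a \<bullet> x) / \<epsilon>\<rfloor>) J" for x
    have fl: "\<epsilon> * of_int (fl x a) \<le> u a \<bullet> x" "u a \<bullet> x < \<epsilon> * (of_int (fl x a) + 1)" if "a \<in> J" for x a
    proof -
      have "of_int \<lfloor>(u a \<bullet> x) / \<epsilon>\<rfloor> \<le> (u a \<bullet> x) / \<epsilon>" "(u a \<bullet> x) / \<epsilon> < of_int \<lfloor>(u a \<bullet> x) / \<epsilon>\<rfloor> + 1" by linarith+
      then have "of_int (fl x a) * \<epsilon> \<le> u a \<bullet> x" "u a \<bullet> x < (of_int (fl x a) + 1) * \<epsilon>"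
        using that unfolding pos_le_divide_eq[OF \<epsilon>(1)] pos_divide_less_eq[OF \<epsilon>(1)] by (simp_all add: fl_def)
      then show "\<epsilon> * of_int (fl x a) \<le> u a \<bullet> x" "u a \<bullet> x < \<epsilon> * (of_int (fl x a) + 1)"
        by (simp_all only: mult.commute)
    qed
    define \<G> where "\<G> = fl ` E"
    have "finite \<G>"
    proof -
      obtain M where M: "\<And>x. x \<in> E \<Longrightarrow> norm x \<le> M" using E(1) bounded_iff by metis
      have "\<G> \<subseteq> PiE J (\<lambda>_. {\<lfloor>- M / \<epsilon>\<rfloor>..\<lfloor>M / \<epsilon>\<rfloor>})"
      proof
        fix g assume "g \<in> \<G>"
        then obtain x where x: "x \<in> E" "g = fl x" by (auto simp: \<G>_def)
        have "\<bar>u a \<bullet> x\<bar> \<le> M" for a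
          using Cauchy_Schwarz_ineq2[of "u a" x] u[of a a] M[OF x(1)] by (simp add: norm_eq_sqrt_inner)
        then have lu: "- M \<le> u a \<bullet> x" "u a \<bullet> x \<le> M" for a by (simp_all add: abs_le_iff minus_le_iff)
        have du: "- M / \<epsilon> \<le> (u a \<bullet> x) / \<epsilon>" "(u a \<bullet> x) / \<epsilon> \<le> M / \<epsilon>" for a
          by (rule divide_right_mono[OF lu(1) less_imp_le[OF \<epsilon>(1)]], rule divide_right_mono[OF lu(2) less_imp_le[OF \<epsilon>(1)]])
        show "g \<in> PiE J (\<lambda>_. {\<lfloor>- M / \<epsilon>\<rfloor>..\<lfloor>M / \<epsilon>\<rfloor>})"
          using floor_mono[OF du(1)] floor_mono[OF du(2)] by (simp add: x(2) fl_def PiE_iff)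
      qed
      then show ?thesis by (rule finite_subset) (auto intro: finite_PiE)
    qed
    \<comment> \<open>A box over the cell of \<open>g\<close>, of length 1 in each free direction,
      so that its volume is \<open>\<epsilon> ^ i\<close>.\<close>
    define Bx where "Bx g = box (\<chi> a. if a \<in> J then \<epsilon> * of_int (g a) else 0) (\<chi> a. if a \<in> J then \<epsilon> * (of_int (g a) + 1) else (1::real))" for g :: "'k \<Rightarrow> int"
    have emB: "emeasure lborel (Bx g) = ennreal (\<epsilon> ^ i)" for g
    proof -
      have "emeasure lborel (Bx g) = ennreal (\<Prod>b\<in>Basis. ((\<chi> a. if a \<in> J then \<epsilon> * (of_int (g a) + 1) else (1::real)) - (\<chi> a. if a \<in> J then \<epsilon> * of_int (g a) else 0)) \<bullet> (b :: real^'k))"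
        unfolding Bx_def using \<epsilon>(1) by (intro emeasure_lborel_box) (auto simp: Basis_vec_def inner_axis)
      also have "(\<Prod>b\<in>Basis. ((\<chi> a. if a \<in> J then \<epsilon> * (of_int (g a) + 1) else (1::real)) - (\<chi> a. if a \<in> J then \<epsilon> * of_int (g a) else 0)) \<bullet> (b :: real^'k)) =
        (\<Prod>a\<in>UNIV. if a \<in> J then \<epsilon> else 1)"
      proof -
        have B: "Basis = (\<lambda>a. axis a (1::real)) ` (UNIV :: 'k set)" by (auto simp: Basis_vec_def)
        have inj: "inj (\<lambda>a :: 'k. axis a (1::real))" by (simp add: inj_on_def axis_eq_axis)
        show ?thesis
          unfolding B prod.reindex[OF inj] comp_def by (intro prod.cong) (auto simp: inner_axis algebra_simps)
      qed
      also have "\<dots> = \<epsilon> ^ i" using i by (simp add: prod.If_cases)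
      finally show ?thesis .
    qed
    have disj: "disjoint_family_on Bx \<G>"
      unfolding disjoint_family_on_def
    proof (intro ballI impI, rule ccontr)
      fix g g' assume g: "g \<in> \<G>" "g' \<in> \<G>" "g \<noteq> g'" "Bx g \<inter> Bx g' \<noteq> {}"
      then obtain y where y: "y \<in> Bx g" "y \<in> Bx g'" by blast
      have "g a = g' a" if "a \<in> J" for a
      proof -
        have "\<epsilon> * of_int (g a) < y $ a" "y $ a < \<epsilon> * (of_int (g a) + 1)" "\<epsilon> * of_int (g' a) < y $ a" "y $ a < \<epsilon> * (of_int (g' a) + 1)"
          using y that unfolding Bx_def mem_box_cart by (auto dest!: spec[of _ a])
        then have "\<epsilon> * of_int (g a) < \<epsilon> * (of_int (g' a) + 1)" "\<epsilon> * of_int (g' a) < \<epsilon> * (of_int (g a) + 1)" by linarith+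
        then have "of_int (g a) < of_int (g' a) + (1::real)" "of_int (g' a) < of_int (g a) + (1::real)" using \<epsilon>(1) by simp_all
        then show ?thesis by linarith
      qed
      moreover have "g a = undefined" "g' a = undefined" if "a \<notin> J" for a
        using g(1,2) that by (auto simp: \<G>_def fl_def)
      ultimately have "g = g'" by (intro ext) metis
      then show False using g by simp
    qed
    have sub: "(\<Union>g\<in>\<G>. Bx g) \<subseteq> T"
    proof
      fix y assume "y \<in> (\<Union>g\<in>\<G>. Bx g)"
      then obtain x where x: "x \<in> E" "y \<in> Bx (fl x)" by (auto simp: \<G>_def)
      \<comment> \<open>The nearby point of \<open>Eh\<close> that has the exact components of
        \<open>x\<close> along \<open>J\<close>.\<close>
      define z where "z = (\<chi> a. if a \<in> J then u a \<bullet> x else y $ a)"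
      have y0: "0 < y $ a" "y $ a < 1" if "a \<notin> J" for a
        using x(2) that unfolding Bx_def mem_box_cart by (auto dest!: spec[of _ a])
      have "\<bar>y $ a\<bar> \<le> 1" if "a \<notin> J" for a using y0[OF that] by linarith
      then have z: "z \<in> Eh" by (intro Eh(2)[OF x(1)]) (auto simp: z_def)
      have "norm (z - y) \<le> (\<Sum>a\<in>UNIV. \<bar>(z - y) $ a\<bar>)" by (rule norm_le_l1_cart)
      also have "\<dots> \<le> (\<Sum>a\<in>(UNIV :: 'k set). \<epsilon>)"
      proof (rule sum_mono)
        fix a
        show "\<bar>(z - y) $ a\<bar> \<le> \<epsilon>"
        proof (cases "a \<in> J")
          case True
          have "\<epsilon> * of_int (fl x a) < y $ a" "y $ a < \<epsilon> * (of_int (fl x a) + 1)"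
            using x(2) True unfolding Bx_def mem_box_cart by (auto dest!: spec[of _ a])
          then show ?thesis using fl[OF True, of x] True by (simp add: z_def abs_le_iff algebra_simps)
        qed (use \<epsilon>(1) in \<open>simp add: z_def\<close>)
      qed
      also have "\<dots> < s" using i\<epsilon>(2) by simp
      finally have "y \<in> ball z s" by (simp add: dist_norm)
      then show "y \<in> T" using s(2) z by blast
    qed
    have "of_nat (card \<G>) * ennreal (\<epsilon> ^ i) = (\<Sum>g\<in>\<G>. emeasure lborel (Bx g))" by (simp add: emB)
    also have "\<dots> = emeasure lborel (\<Union>g\<in>\<G>. Bx g)"
      by (rule sum_emeasure[OF _ disj \<open>finite \<G>\<close>]) (auto simp: Bx_def)
    also have "\<dots> \<le> ennreal (\<mu> + e)"
      using emeasure_mono[OF sub, of lborel] T(1) T\<mu> by (auto intro: order_trans)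
    finally have "ennreal (real (card \<G>) * \<epsilon> ^ i) \<le> ennreal (\<mu> + e)"
      using \<epsilon>(1) by (simp add: ennreal_of_nat_eq_real_of_nat ennreal_mult')
    moreover have "0 \<le> \<mu> + e" using \<mu> e by simp
    ultimately have N: "real (card \<G>) * \<epsilon> ^ i \<le> \<mu> + e" using ennreal_le_iff by blast
    obtain h where h: "bij_betw h {..<card \<G>} \<G>" using ex_bij_betw_nat_finite[OF \<open>finite \<G>\<close>] atLeast0LessThan by metis
    define C where "C j = (if j < card \<G> then {x\<in>E. fl x = h j} else {})" for j
    have diam: "diameter (C j) \<le> real i * \<epsilon>" for j
    proof (rule diameter_le)
      show "C j \<noteq> {} \<or> 0 \<le> real i * \<epsilon>" using \<epsilon>(1) by simp
      fix x y assume xy: "x \<in> C j" "y \<in> C j"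
      then have "x \<in> E" "y \<in> E" "fl x = fl y" by (auto simp: C_def split: if_splits)
      then have "x - y \<in> span (u ` J)" using E(2) by (intro span_diff) auto
      then have "norm (x - y) \<le> (\<Sum>a\<in>J. \<bar>u a \<bullet> (x - y)\<bar>)" by (rule expand)
      also have "\<dots> \<le> (\<Sum>a\<in>J. \<epsilon>)"
      proof (rule sum_mono)
        fix a assume a: "a \<in> J"
        show "\<bar>u a \<bullet> (x - y)\<bar> \<le> \<epsilon>"
          using fl[OF a, of x] fl[OF a, of y] \<open>fl x = fl y\<close> by (simp add: inner_diff_right abs_le_iff algebra_simps)
      qed
      finally show "norm (x - y) \<le> real i * \<epsilon>" using i by simp
    qed
    have mem: "C \<in> {C :: nat \<Rightarrow> (real^'m) set. E \<subseteq> (\<Union>j. C j) \<and> (\<forall>j. bounded (C j) \<and> diameter (C j) \<le> \<delta>)}"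
    proof (intro CollectI conjI allI)
      show "E \<subseteq> (\<Union>j. C j)"
      proof
        fix x assume x: "x \<in> E"
        then have "fl x \<in> h ` {..<card \<G>}" using h by (auto simp: \<G>_def bij_betw_def)
        then show "x \<in> (\<Union>j. C j)" using x by (auto simp: C_def)
      qed
      show "bounded (C j)" for j by (rule bounded_subset[OF E(1)]) (auto simp: C_def)
      show "diameter (C j) \<le> \<delta>" for j using diam[of j] i\<epsilon> by linarith
    qed
    \<comment> \<open>Beyond \<open>card \<G>\<close> the sets are empty; \<open>1 \<le> i\<close>
      makes the power of their diameter 0.\<close>
    have "(\<Sum>j. ennreal (\<omega> * (diameter (C j) / 2) ^ i)) = (\<Sum>j<card \<G>. ennreal (\<omega> * (diameter (C j) / 2) ^ i))"
      using i(2) by (intro suminf_finite) (auto simp: C_def power_0_left)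
    also have "\<dots> \<le> (\<Sum>j<card \<G>. ennreal (\<omega> * (real i * \<epsilon> / 2) ^ i))"
    proof (intro sum_mono ennreal_leI mult_left_mono power_mono divide_right_mono \<omega> diam)
      fix j
      have "bounded (C j)" by (rule bounded_subset[OF E(1)]) (auto simp: C_def)
      then show "0 \<le> diameter (C j) / 2" using diameter_ge_0 by auto
    qed auto
    also have "\<dots> = ennreal (real (card \<G>) * (\<omega> * (real i * \<epsilon> / 2) ^ i))"
      by (simp add: ennreal_of_nat_eq_real_of_nat ennreal_mult')
    also have "real (card \<G>) * (\<omega> * (real i * \<epsilon> / 2) ^ i) = \<omega> * (real i / 2) ^ i * (real (card \<G>) * \<epsilon> ^ i)"
      by (simp add: power_mult_distrib power_divide mult_ac)
    also have "ennreal \<dots> \<le> ennreal (\<omega> * (real i / 2) ^ i * (\<mu> + e))"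
      using N \<omega> by (intro ennreal_leI mult_left_mono) auto
    finally show ?thesis by (rule INF_lower2[OF mem])
  qed
  have "hausdorff_outer i E \<le> ennreal (\<omega> * (real i / 2) ^ i * (\<mu> + e))" if "0 < e" for e
    unfolding hausdorff_outer_def \<omega>_def[symmetric] by (intro SUP_least main that) auto
  then have "hausdorff_outer i E \<le> ennreal (\<omega> * (real i / 2) ^ i * (\<mu> + 0))"
    by (rule ennreal_le_limit) (auto intro!: continuous_intros)
  also have "\<dots> = ennreal (\<omega> * (real i / 2) ^ i) * emeasure lborel Eh"
    using \<mu> by (simp add: ennreal_mult'')
  finally show ?thesis unfolding \<omega>_def .
qed

text \<open>\<open>measure_of\<close> returns the given set function where it is a measure on the
  sigma algebra and 0 otherwise. The upper bound holds in both cases, so Caratheodory's theorem is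
  bypassed.\<close>

lemma emeasure_hausdorff_le: "emeasure (hausdorff_measure s) E \<le> hausdorff_outer s E"
  unfolding hausdorff_measure_def by (simp add: emeasure_measure_of_conv)

lemma sets_hausdorff: "sets (hausdorff_measure s) = sets borel"
  unfolding hausdorff_measure_def by (metis sets_measure_of_conv sets.sigma_sets_eq space_borel sets.space_closed)

section \<open>Gaussian planes\<close>

lemma emeasure_std_gauss: "emeasure (std_gauss :: (real^'m::finite) measure) UNIV = 1"
proof -
  have f: "(2 * pi) powr (- real CARD('m) / 2) * exp (- ((norm x)\<^sup>2) / 2) = (\<Prod>b\<in>Basis. std_normal_density (x \<bullet> b))" for x :: "real^'m"
  proof -
    have "(\<Prod>b\<in>(Basis :: (real^'m) set). std_normal_density (x \<bullet> b)) = (1 / sqrt (2 * pi)) ^ CARD('m) * exp (\<Sum>b\<in>Basis. - (x \<bullet> b)\<^sup>2 / 2)"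
    proof -
      have "(\<Prod>b\<in>(Basis :: (real^'m) set). std_normal_density (x \<bullet> b)) =
        (\<Prod>b\<in>(Basis :: (real^'m) set). 1 / sqrt (2 * pi)) * (\<Prod>b\<in>Basis. exp (- (x \<bullet> b)\<^sup>2 / 2))"
        unfolding std_normal_density_def by (rule prod.distrib)
      then show ?thesis by (simp add: exp_sum)
    qed
    also have "(\<Sum>b\<in>Basis. - (x \<bullet> b)\<^sup>2 / 2) = - ((norm x)\<^sup>2) / 2"
      by (simp add: sum_divide_distrib[symmetric] sum_negf norm_eq_sqrt_inner euclidean_inner[of x x] power2_eq_square sum_nonneg)
    also have "(1 / sqrt (2 * pi)) ^ CARD('m) = (2 * pi) powr (- real CARD('m) / 2)"
      by (simp add: powr_minus_divide powr_half_sqrt[symmetric] powr_power power_divide)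
    finally show ?thesis by simp
  qed
  have "emeasure (std_gauss :: (real^'m) measure) UNIV = (\<integral>\<^sup>+ x. ennreal (\<Prod>b\<in>Basis. std_normal_density (x \<bullet> b)) \<partial>(lborel :: (real^'m) measure))"
    unfolding std_gauss_def f by (subst emeasure_density) auto
  also have "\<dots> = (\<integral>\<^sup>+ x. (\<Prod>b\<in>Basis. ennreal (std_normal_density (x \<bullet> b))) \<partial>(lborel :: (real^'m) measure))"
    by (simp add: prod_ennreal)
  also have "\<dots> = (\<Prod>b\<in>(Basis :: (real^'m) set). \<integral>\<^sup>+ x. ennreal (std_normal_density x) \<partial>lborel)"
    by (rule nn_integral_lborel_prod) auto
  also have "(\<integral>\<^sup>+ x. ennreal (std_normal_density x) \<partial>lborel) = 1"
  proof -
    have "emeasure (density lborel std_normal_density) UNIV = 1"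
      using prob_space.emeasure_space_1[OF prob_space_normal_density[of 1 0]] by simp
    then show ?thesis by (subst (asm) emeasure_density) auto
  qed
  finally show ?thesis by simp
qed

text \<open>The bound is uniform over all planes, so only the total mass 1 of the Gaussian product
  counts. Dependent vectors, whose span is too small, are included.\<close>

lemma grass_integral_le:
  assumes "\<And>v :: nat \<Rightarrow> real^'m::finite. G (span (v ` {..<i})) \<le> B"
  shows "grass_integral i G \<le> B"
proof -
  have "finite_measure (std_gauss :: (real^'m) measure)"
    using emeasure_std_gauss[where 'm = 'm] by (intro finite_measureI) (simp add: std_gauss_def)
  then have "sigma_finite_measure (std_gauss :: (real^'m) measure)"
    by (rule finite_measure.axioms(1))
  then interpret product_sigma_finite "\<lambda>_ :: nat. std_gauss :: (real^'m) measure"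
    by (simp add: product_sigma_finite_def)
  let ?M = "PiM {..<i} (\<lambda>_. std_gauss :: (real^'m) measure)"
  have "emeasure ?M (PiE {..<i} (\<lambda>_. UNIV)) = (\<Prod>_\<in>{..<i}. emeasure (std_gauss :: (real^'m) measure) UNIV)"
    by (rule emeasure_PiM) (auto simp: std_gauss_def)
  then have one: "emeasure ?M (space ?M) = 1"
    by (simp add: space_PiM emeasure_std_gauss) (simp add: std_gauss_def)
  have "grass_integral i G \<le> (\<integral>\<^sup>+ v. B \<partial>?M)"
    unfolding grass_integral_def by (intro nn_integral_mono assms)
  also have "\<dots> = B" by (simp add: one)
  finally show ?thesis .
qed

section \<open>Vitushkin variations\<close>

lemma proj_fibre_span: "proj_fibre (span B) x = {y. \<forall>b\<in>B. (y - x) \<bullet> b = 0}"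
proof (intro equalityI subsetI)
  fix y assume y: "y \<in> {y. \<forall>b\<in>B. (y - x) \<bullet> b = 0}"
  have "(y - x) \<bullet> z = 0" if "z \<in> span B" for z
    using orthogonal_to_span[OF that, of "y - x"] y by (auto simp: orthogonal_def)
  then show "y \<in> proj_fibre (span B) x" by (simp add: proj_fibre_def)
qed (auto simp: proj_fibre_def span_base)

lemma card_vimage_Rep_wo:
  fixes J :: "'a set"
  shows "card (Rep_wo -` J) = card J"
proof -
  have "range Rep_wo = (UNIV :: 'a set)" by (rule bij_is_surj[OF bij_Rep_wo])
  then show ?thesis using card_vimage_inj[OF inj_Rep_wo, of J] by simp
qed

text \<open>The volume of the unit ball in dimension \<open>i\<close>, times the factor
  \<open>(i / 2) ^ i\<close> that arises in \<open>hausdorff_outer_le\<close> when cells of side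
  \<epsilon> are given diameter \<open>i * \<epsilon>\<close>.\<close>

definition omega :: "nat \<Rightarrow> real" where
  "omega i = pi powr (real i / 2) / Gamma (real i / 2 + 1) * (real i / 2) ^ i"

lemma omega_nonneg: "0 \<le> omega i"
  unfolding omega_def by (intro mult_nonneg_nonneg divide_nonneg_nonneg less_imp_le[OF Gamma_real_pos]) auto

lemma cNi_nonneg: "i \<le> N \<Longrightarrow> 0 \<le> cNi N i"
  unfolding cNi_def by (intro divide_nonneg_nonneg mult_nonneg_nonneg less_imp_le[OF Gamma_real_pos]) auto

context lifted
begin

definition pM :: "('m idx \<Rightarrow> real) \<Rightarrow> real^'m" where
  "pM \<xi> = (\<chi> b. pX n d c b \<xi>)"

abbreviation "A \<equiv> pmap n d c ` (CLam n d c \<Lambda> \<inter> ballRn n r)"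

lemma pmap_pM: "pmap n d c (\<lambda>k. \<xi> (Xc k)) = pM \<xi>"
  by (simp add: pmap_def pM_def pX_def)

lemma image_lift: "A = pM ` {\<xi>\<in>RV V. H \<xi> = 0}"
proof (intro equalityI subsetI)
  fix y assume "y \<in> A"
  then obtain x where x: "x \<in> CLam n d c \<Lambda>" "x \<in> ballRn n r" "y = pmap n d c x" by blast
  obtain \<xi> where "\<xi> \<in> RV V" "H \<xi> = 0" "(\<lambda>k. \<xi> (Xc k)) = x" using lift_ex[OF x(1,2), of "\<lambda>_. 0"] by auto
  then show "y \<in> pM ` {\<xi>\<in>RV V. H \<xi> = 0}" using x(3) pmap_pM[of \<xi>] by auto
next
  fix y assume "y \<in> pM ` {\<xi>\<in>RV V. H \<xi> = 0}"
  then obtain \<xi> where \<xi>: "\<xi> \<in> RV V" "H \<xi> = 0" "y = pM \<xi>" by blast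
  then show "y \<in> A" using lift_sub[OF \<xi>(1,2)] pmap_pM[of \<xi>] by (metis imageI)
qed

lemma continuous_pM: "continuous_on S pM"
  unfolding pM_def by (intro continuous_on_vec_lambda polyf_continuous[OF polyf_pX])

lemma compact_lift: "compact {\<xi>\<in>RV V. H \<xi> = 0}"
proof -
  let ?R = "2 + \<bar>r\<bar> + (\<Sum>a\<in>UNIV. L a)"
  have "{\<xi>\<in>RV V. H \<xi> = 0} = boxV V ?R \<inter> {\<xi>. H \<xi> = 0}"
    using lift_bounded by (auto simp: boxV_def intro: less_imp_le)
  moreover have "closed {\<xi>. H \<xi> = 0}"
    by (intro closed_Collect_eq polyf_continuous[OF polyf_liftH] continuous_on_const)
  ultimately show ?thesis using compact_boxV compact_Int_closed by metis
qed

lemma compact_A: "compact A"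
  unfolding image_lift by (intro compact_continuous_image continuous_pM compact_lift)

text \<open>The affine equations enter as squares of polynomials of degree at most \<open>d\<close>,
  which leaves the degree bound of the lifted polynomial unchanged. Empty \<open>J\<close> gives the
  count for the whole image.\<close>

lemma b0_slice:
  assumes "finite J"
  shows "b0 (A \<inter> {y. \<forall>a\<in>J. (y - x) \<bullet> u a = 0}) \<le> of_nat ((4 * d + 4) ^ card V)"
proof -
  define q where "q a \<xi> = (\<Sum>b\<in>UNIV. u a $ b * pX n d c b \<xi>) - u a \<bullet> x" for a \<xi>
  define h where "h \<xi> = H \<xi> + (\<Sum>a\<in>J. (q a \<xi>)\<^sup>2)" for \<xi>
  have q: "q a \<xi> = (pM \<xi> - x) \<bullet> u a" for a \<xi>
    unfolding q_def inner_diff_left by (simp add: inner_vec_def pM_def mult.commute)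
  have pq: "polyf V d (q a)" for a
    unfolding q_def by (intro polyf_diff polyf_const polyf_sum polyf_cmult polyf_pX')
  have h: "polyf V (4 * d + 4) h"
    unfolding h_def by (intro polyf_add polyf_liftH polyf_sum polyf_power2[OF pq]) auto
  have h0: "h \<xi> = 0 \<longleftrightarrow> H \<xi> = 0 \<and> (\<forall>a\<in>J. (pM \<xi> - x) \<bullet> u a = 0)" for \<xi>
  proof -
    have "h \<xi> = 0 \<longleftrightarrow> H \<xi> = 0 \<and> (\<Sum>a\<in>J. (q a \<xi>)\<^sup>2) = 0"
      unfolding h_def by (intro add_nonneg_eq_0_iff liftH_nonneg sum_nonneg) auto
    also have "(\<Sum>a\<in>J. (q a \<xi>)\<^sup>2) = 0 \<longleftrightarrow> (\<forall>a\<in>J. q a \<xi> = 0)"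
      using assms by (subst sum_nonneg_eq_0_iff) auto
    finally show ?thesis by (simp add: q)
  qed
  have "A \<inter> {y. \<forall>a\<in>J. (y - x) \<bullet> u a = 0} = pM ` {\<xi>\<in>RV V. h \<xi> = 0}"
    unfolding image_lift h0 by auto
  moreover have "b0 (pM ` {\<xi>\<in>RV V. h \<xi> = 0}) \<le> of_nat ((4 * d + 4) ^ card V)"
  proof (rule components_bound[OF finite_liftV _ h])
    show "0 \<le> h \<xi>" for \<xi> unfolding h_def by (intro add_nonneg_nonneg liftH_nonneg sum_nonneg) auto
    show "\<bar>\<xi> v\<bar> < 2 + \<bar>r\<bar> + (\<Sum>a\<in>UNIV. L a)" if "h \<xi> = 0" "v \<in> V" for \<xi> v
      using that h0 by (intro lift_bounded) auto
  qed (use continuous_pM in auto)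
  ultimately show ?thesis by simp
qed

definition cyl :: "('m \<Rightarrow> real^'m) \<Rightarrow> 'm set \<Rightarrow> (real^('m wo)) set" where
  "cyl u J = (\<lambda>\<xi>. \<chi> a. cylF (\<lambda>a. u (Rep_wo a)) (Rep_wo -` J) Rep_wo a \<xi>) ` {\<xi>\<in>RV V. H \<xi> = 0}"

lemma compact_cyl: "compact (cyl u J)"
  unfolding cyl_def
  by (intro compact_continuous_image compact_lift continuous_on_vec_lambda polyf_continuous[OF polyf_cylF])

text \<open>Coordinates outside \<open>J\<close> are absorbed by the variables \<open>Wc\<close>,
  since lifts exist for all their values in [-1, 1].\<close>

lemma in_cylI:
  assumes y: "y \<in> A" and v: "\<And>a. Rep_wo a \<in> J \<Longrightarrow> v $ a = u (Rep_wo a) \<bullet> y" "\<And>a. Rep_wo a \<notin> J \<Longrightarrow> \<bar>v $ a\<bar> \<le> 1"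
  shows "v \<in> cyl u J"
proof -
  obtain x where x: "x \<in> CLam n d c \<Lambda>" "x \<in> ballRn n r" "y = pmap n d c x" using y by blast
  define w where "w f = (if f \<in> J then 0 else v $ Abs_wo f)" for f
  have AR: "Rep_wo (Abs_wo f) = f" for f :: 'm by (simp add: Abs_wo_inverse)
  have "\<bar>w f\<bar> \<le> 1" for f using v(2)[of "Abs_wo f"] by (simp add: w_def AR)
  then obtain \<xi> where \<xi>: "\<xi> \<in> RV V" "H \<xi> = 0" "(\<lambda>k. \<xi> (Xc k)) = x" "\<And>f. \<xi> (Wc f) = w f"
    using lift_ex[OF x(1,2), of w] by auto
  have y: "y = pM \<xi>" using x(3) \<xi>(3) pmap_pM[of \<xi>] by simp
  have "cylF (\<lambda>a. u (Rep_wo a)) (Rep_wo -` J) Rep_wo a \<xi> = v $ a" for a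
  proof (cases "Rep_wo a \<in> J")
    case True
    then show ?thesis using v(1)[OF True] by (simp add: cylF_def y pM_def inner_vec_def)
  next
    case False
    then show ?thesis using \<xi>(4) by (simp add: cylF_def w_def Rep_wo_inverse)
  qed
  then have "v = (\<chi> a. cylF (\<lambda>a. u (Rep_wo a)) (Rep_wo -` J) Rep_wo a \<xi>)" by (simp add: vec_eq_iff)
  then show ?thesis using \<xi>(1,2) unfolding cyl_def by blast
qed

text \<open>The right-hand side of \<open>image_measure_bound\<close> for the degree bound
  \<open>4 * d + 4\<close>, with \<open>1 + \<bar>r\<bar>\<close> bounding the coordinates in
  \<open>cylC\<close>.\<close>

definition volB :: "nat \<Rightarrow> real" where
  "volB i = (\<Prod>k\<in>{1..i}. \<Lambda> k) * real (card cylC + CARD('m)) ^ CARD('m) *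
     (real ((2 * (4 * d + 4)) ^ (card V + CARD('m))) * (2 * (1 + \<bar>r\<bar>)) ^ CARD('m))"

lemma prod_\<Lambda>_nonneg: "i \<le> CARD('m) \<Longrightarrow> 0 \<le> (\<Prod>k\<in>{1..i}. \<Lambda> k)"
  by (intro prod_nonneg) (auto intro: \<Lambda>)

lemma volB_nonneg: "i \<le> CARD('m) \<Longrightarrow> 0 \<le> volB i"
  unfolding volB_def by (intro mult_nonneg_nonneg prod_\<Lambda>_nonneg) auto

lemma cyl_volume:
  assumes u: "\<And>a b. u a \<bullet> u b = (if a = b then 1 else 0)" and i: "card J = i" "i \<le> CARD('m)"
  shows "emeasure lborel (cyl u J) \<le> ennreal (volB i)"
  unfolding cyl_def volB_def card_wo[where 'a = 'm, symmetric]
proof (rule image_measure_bound[where N = "\<lambda>a. Uc (Rep_wo a)"])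
  show "finite V" by (rule finite_liftV)
  show "inj (\<lambda>a :: 'm wo. Uc (Rep_wo a))" by (simp add: inj_on_def Rep_wo_inject)
  show "V \<inter> range (\<lambda>a :: 'm wo. Uc (Rep_wo a)) = {}" using liftV_notin(1) by auto
  show "polyf V (4 * d + 4) H" by (rule polyf_liftH)
  show "0 \<le> H \<xi>" for \<xi> by (rule liftH_nonneg)
  show "\<bar>\<xi> v\<bar> < 2 + \<bar>r\<bar> + (\<Sum>a\<in>UNIV. L a)" if "H \<xi> = 0" "v \<in> V" for \<xi> v
    by (rule lift_bounded[OF that])
  show "cylC \<subseteq> V" by (auto simp: liftV_simps)
  show "polyf cylC (4 * d + 4) (cylF (\<lambda>a. u (Rep_wo a)) (Rep_wo -` J) Rep_wo a)" for a :: "'m wo" by (rule polyf_cylF)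
  show "\<bar>\<xi> v\<bar> \<le> 1 + \<bar>r\<bar>" if H: "H \<xi> = 0" and v: "v \<in> cylC" for \<xi> v
    using v
  proof
    assume "v \<in> Xc ` {..<n}"
    then obtain k where k: "v = Xc k" "k < n" by blast
    have "(\<xi> (Xc k))\<^sup>2 \<le> (\<Sum>k<n. (\<xi> (Xc k))\<^sup>2)" using k by (intro member_le_sum) auto
    also have "\<dots> \<le> r\<^sup>2" using H[unfolded liftH_zero_iff] zero_le_power2[of "\<xi> Tc"] by linarith
    finally have "\<bar>\<xi> (Xc k)\<bar> \<le> \<bar>r\<bar>" by (simp add: abs_le_square_iff)
    then show ?thesis using k by simp
  next
    assume "v \<in> range Wc"
    then obtain a where a: "v = Wc a" by blast
    have "(\<xi> (Wc a))\<^sup>2 + (\<xi> (Yc a))\<^sup>2 = 1" using H[unfolded liftH_zero_iff] by blast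
    then have "(\<xi> (Wc a))\<^sup>2 \<le> 1" using zero_le_power2[of "\<xi> (Yc a)"] by linarith
    then show ?thesis using a by (simp add: abs_square_le_1)
  qed
  show "0 \<le> (\<Prod>k\<in>{1..i}. \<Lambda> k)" by (rule prod_\<Lambda>_nonneg[OF i(2)])
  show "det (\<chi> a b. \<Sum>c\<in>cylC. pd c (cylF (\<lambda>a. u (Rep_wo a)) (Rep_wo -` J) Rep_wo a) \<xi> * pd c (cylF (\<lambda>a. u (Rep_wo a)) (Rep_wo -` J) Rep_wo b) \<xi>)
    \<le> (\<Prod>k\<in>{1..i}. \<Lambda> k)\<^sup>2" if "H \<xi> = 0" for \<xi>
  proof (rule lift_gram_bound[OF that])
    show "card (Rep_wo -` J) = i"
      using i by (simp add: card_vimage_Rep_wo)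
  qed (use u i bij_Rep_wo in \<open>auto simp: Rep_wo_inject\<close>)
qed auto

text \<open>A slice is nonempty only over the projection \<open>E\<close> of the image, where it has
  at most \<open>(4 * d + 4) ^ card V\<close> components; the integral is at most that number times
  the measure of \<open>E\<close>.\<close>

lemma slice_integral_le:
  assumes Z: "subspace Z" "dim Z \<le> i" and i: "1 \<le> i" "i \<le> CARD('m)"
  shows "(\<integral>\<^sup>+ x. indicator Z x * b0 (A \<inter> proj_fibre Z x) \<partial>hausdorff_measure i)
    \<le> ennreal (real ((4 * d + 4) ^ card V) * (omega i * volB i))"
proof -
  obtain u and J :: "'m set" where u: "\<And>a b. u a \<bullet> u b = (if a = b then 1 else 0)" and J: "card J = dim Z" "span (u ` J) = Z"
    using orthonormal_frame[OF Z(1)] by metis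
  define \<pi> where "\<pi> y = (\<Sum>a\<in>J. (u a \<bullet> y) *\<^sub>R u a)" for y
  define E where "E = \<pi> ` A"
  have fib: "proj_fibre Z x = {y. \<forall>a\<in>J. (y - x) \<bullet> u a = 0}" for x
    unfolding J(2)[symmetric] proj_fibre_span by auto
  have E: "compact E" unfolding E_def \<pi>_def
    by (intro compact_continuous_image compact_A continuous_intros)
  have u\<pi>: "u a \<bullet> \<pi> y = (if a \<in> J then u a \<bullet> y else 0)" for a y
    unfolding \<pi>_def by (simp add: inner_sum_right u if_distrib[of "\<lambda>t. _ * t"] sum.delta' cong: if_cong)
  have EZ: "E \<subseteq> Z" unfolding E_def \<pi>_def J(2)[symmetric] by (intro image_subsetI span_sum span_mul span_base imageI)
  have empty: "A \<inter> proj_fibre Z x = {}" if "x \<in> Z" "x \<notin> E" for x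
  proof (rule ccontr)
    assume "A \<inter> proj_fibre Z x \<noteq> {}"
    then obtain y where y: "y \<in> A" "\<forall>a\<in>J. (y - x) \<bullet> u a = 0" unfolding fib by blast
    have "x = (\<Sum>a\<in>J. (u a \<bullet> x) *\<^sub>R u a)" using orthonormal_expansion[OF u, of x J] that J by simp
    also have "\<dots> = \<pi> y" unfolding \<pi>_def using y(2) by (intro sum.cong) (auto simp: inner_diff_right inner_commute)
    finally show False using that y(1) by (auto simp: E_def)
  qed
  have pt: "indicator Z x * b0 (A \<inter> proj_fibre Z x) \<le> of_nat ((4 * d + 4) ^ card V) * indicator E x" for x
  proof (cases "x \<in> Z")
    case True
    show ?thesis
    proof (cases "x \<in> E")
      case True
      then show ?thesis using b0_slice[of J x u] \<open>x \<in> Z\<close> by (simp add: fib)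
    next
      case False
      have "b0 ({} :: (real^'m) set) = 0" by (simp add: b0_def)
      then show ?thesis using empty[OF True False] by simp
    qed
  qed simp
  have haus: "hausdorff_outer i E \<le> ennreal (omega i * volB i)"
  proof -
    have "card J \<le> i" "i \<le> card (UNIV :: 'm set)" using J Z i by auto
    \<comment> \<open>The frame is enlarged to \<open>i\<close> directions, because the covering
      argument also has to apply to planes of smaller dimension.\<close>
    then obtain J' where J': "J \<subseteq> J'" "card J' = i"
      using exists_subset_between[of J i "UNIV :: 'm set"] by auto
    let ?J = "Rep_wo -` J' :: 'm wo set"
    have cJ: "card ?J = i" using J' by (simp add: card_vimage_Rep_wo)
    have uu: "u (Rep_wo a) \<bullet> u (Rep_wo b) = (if a = b then 1 else 0)" for a b :: "'m wo" by (simp add: u Rep_wo_inject)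
    have "Rep_wo ` ?J = J'" by (rule surj_image_vimage_eq[OF bij_is_surj[OF bij_Rep_wo]])
    then have im: "(\<lambda>a. u (Rep_wo a)) ` ?J = u ` J'" by (metis image_image)
    have sub: "E \<subseteq> span ((\<lambda>a. u (Rep_wo a)) ` ?J)"
      unfolding im using EZ span_mono[of "u ` J" "u ` J'"] J(2) J'(1) by blast
    show ?thesis
    proof (cases "dim Z = i")
      case True
      then have "J = J'" using J J' by (metis card_subset_eq finite)
      have "hausdorff_outer i E \<le> ennreal (omega i) * emeasure lborel (cyl u J)"
        unfolding omega_def
      proof (rule hausdorff_outer_le[OF uu cJ i(1) compact_imp_bounded[OF E] sub compact_cyl])
        fix v :: "real^('m wo)" and x
        assume x: "x \<in> E" and v: "\<forall>a\<in>?J. v $ a = u (Rep_wo a) \<bullet> x" "\<forall>a. a \<notin> ?J \<longrightarrow> \<bar>v $ a\<bar> \<le> 1"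
        obtain y where y: "y \<in> A" "x = \<pi> y" using x by (auto simp: E_def)
        show "v \<in> cyl u J"
          by (rule in_cylI[OF y(1)]) (use v \<open>J = J'\<close> in \<open>auto simp: y(2) u\<pi>\<close>)
      qed
      also have "\<dots> \<le> ennreal (omega i) * ennreal (volB i)"
        using True J(1) i(2) by (intro mult_left_mono cyl_volume u) auto
      finally show ?thesis using volB_nonneg[OF i(2)] by (simp add: ennreal_mult'')
    next
      case False
      then have "J \<noteq> J'" using J J' by auto
      \<comment> \<open>For a plane of smaller dimension, \<open>E\<close> has no component along
        \<open>u a0\<close>; the cylinder over it lies in a bounded part of a hyperplane and has
        volume 0.\<close>
      then obtain a0 where a0: "a0 \<in> J'" "a0 \<notin> J" using J' by blast
      obtain M where M: "\<And>x. x \<in> E \<Longrightarrow> norm x \<le> M" using compact_imp_bounded[OF E] bounded_iff by metis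
      let ?M = "max 1 M"
      define Eh where "Eh = cbox (\<chi> a. - ?M) (\<chi> a. ?M) \<inter> {v :: real^('m wo). v $ Abs_wo a0 = 0}"
      have cl: "closed {v :: real^('m wo). v $ Abs_wo a0 = 0}"
        by (intro closed_Collect_eq continuous_intros)
      have comp: "compact Eh" unfolding Eh_def using cl by (intro compact_Int_closed) auto
      have neg: "negligible {v :: real^('m wo). v $ Abs_wo a0 = 0}"
        by (rule negligible_standard_hyperplane_cart)
      have null: "emeasure lborel Eh = 0"
      proof -
        have "negligible Eh" unfolding Eh_def by (rule negligible_subset[OF neg]) auto
        then have "emeasure lebesgue Eh = 0" using negligible_iff_emeasure0 negligible_imp_sets by blast
        then show ?thesis using borel_compact[OF comp] by simp
      qed
      have "hausdorff_outer i E \<le> ennreal (omega i) * emeasure lborel Eh"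
        unfolding omega_def
      proof (rule hausdorff_outer_le[OF uu cJ i(1) compact_imp_bounded[OF E] sub comp])
        fix v :: "real^('m wo)" and x
        assume x: "x \<in> E" and v: "\<forall>a\<in>?J. v $ a = u (Rep_wo a) \<bullet> x" "\<forall>a. a \<notin> ?J \<longrightarrow> \<bar>v $ a\<bar> \<le> 1"
        obtain y where y: "y \<in> A" "x = \<pi> y" using x by (auto simp: E_def)
        have "v $ Abs_wo a0 = 0" using v(1) a0 by (auto simp: Abs_wo_inverse y(2) u\<pi>)
        moreover have "\<bar>v $ a\<bar> \<le> ?M" for a
        proof (cases "a \<in> ?J")
          case True
          have "\<bar>u (Rep_wo a) \<bullet> x\<bar> \<le> norm x"
            using Cauchy_Schwarz_ineq2[of "u (Rep_wo a)" x] u by (simp add: norm_eq_sqrt_inner)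
          then show ?thesis using v(1) True M[OF x] by auto
        next
          case False
          then show ?thesis using v(2) by (metis max.coboundedI1)
        qed
        then have "- ?M \<le> v $ a" "v $ a \<le> ?M" for a unfolding abs_le_iff by (simp_all add: minus_le_iff)
        ultimately show "v \<in> Eh" by (simp add: Eh_def mem_box_cart)
      qed
      then show ?thesis by (simp add: null)
    qed
  qed
  have Em: "E \<in> sets (hausdorff_measure i)" using E by (simp add: sets_hausdorff borel_compact)
  have "(\<integral>\<^sup>+ x. indicator Z x * b0 (A \<inter> proj_fibre Z x) \<partial>hausdorff_measure i) \<le>
    (\<integral>\<^sup>+ x. of_nat ((4 * d + 4) ^ card V) * indicator E x \<partial>hausdorff_measure i)"
    by (intro nn_integral_mono pt)
  also have "\<dots> = of_nat ((4 * d + 4) ^ card V) * emeasure (hausdorff_measure i) E"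
    using Em by (rule nn_integral_cmult_indicator)
  also have "\<dots> \<le> of_nat ((4 * d + 4) ^ card V) * ennreal (omega i * volB i)"
    by (intro mult_left_mono order_trans[OF emeasure_hausdorff_le haus]) auto
  also have "\<dots> = ennreal (real ((4 * d + 4) ^ card V) * (omega i * volB i))"
    using omega_nonneg volB_nonneg[OF i(2)] by (simp add: ennreal_of_nat_eq_real_of_nat ennreal_mult' del: of_nat_power)
  finally show ?thesis .
qed

lemma vitushkin_0: "vitushkin 0 A \<le> ennreal (real ((4 * d + 4) ^ card V))"
  using b0_slice[of "{}" _ "\<lambda>_. 0"] by (simp add: vitushkin_def ennreal_of_nat_eq_real_of_nat del: of_nat_power)

lemma vitushkin_pos:
  assumes i: "1 \<le> i" "i \<le> CARD('m)"
  shows "vitushkin i A \<le> ennreal (cNi CARD('m) i * (real ((4 * d + 4) ^ card V) * (omega i * volB i)))"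
proof -
  have "grass_integral i (\<lambda>Z. \<integral>\<^sup>+ x. indicator Z x * b0 (A \<inter> proj_fibre Z x) \<partial>hausdorff_measure i)
    \<le> ennreal (real ((4 * d + 4) ^ card V) * (omega i * volB i))"
  proof (rule grass_integral_le, rule slice_integral_le)
    fix v :: "nat \<Rightarrow> real^'m"
    show "subspace (span (v ` {..<i}))" by simp
    have "dim (span (v ` {..<i})) \<le> card (v ` {..<i})" by (simp add: dim_le_card')
    also have "\<dots> \<le> i" using card_image_le[of "{..<i}" v] by simp
    finally show "dim (span (v ` {..<i})) \<le> i" .
  qed (use i in auto)
  then show ?thesis
    using i cNi_nonneg[OF i(2)] by (simp add: vitushkin_def ennreal_mult' mult_left_mono)
qed

end

text \<open>The factor 3 comes from the at most \<open>n + 2 * m\<close>, hence at most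
  \<open>3 * n\<close>, coordinates available to minors. The sum over \<open>i\<close> dominates
  each of its terms, and the summand 1 covers dimension 0.\<close>

definition cstG :: "nat \<Rightarrow> real \<Rightarrow> real" where
  "cstG m r = 1 + (\<Sum>i\<le>m. cNi m i * omega i) * (3 ^ m * (2 * (1 + \<bar>r\<bar>)) ^ m)"

text \<open>The base is twice \<open>4 * d + 4\<close>. With error variables there are at most
  \<open>n + m * m + 4 * m + 1\<close> unknowns, which for \<open>1 \<le> n\<close> is at most
  \<open>(m * m + 4 * m + 2) * n\<close>. The exponent is doubled because component count and
  multiplicity are multiplied.\<close>

definition betaG :: "nat \<Rightarrow> nat \<Rightarrow> real" where
  "betaG m d = real (8 * d + 8) ^ (2 * (m * m + 4 * m + 2))"

lemma cstG_ge_1: "1 \<le> cstG m r"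
  unfolding cstG_def le_add_same_cancel1
  by (intro mult_nonneg_nonneg sum_nonneg zero_le_power cNi_nonneg omega_nonneg) auto

lemma cstG_ge:
  assumes "i \<le> m"
  shows "cNi m i * omega i * (3 ^ m * (2 * (1 + \<bar>r\<bar>)) ^ m) \<le> cstG m r"
proof -
  have "cNi m i * omega i \<le> (\<Sum>i\<le>m. cNi m i * omega i)"
    using assms by (intro member_le_sum mult_nonneg_nonneg cNi_nonneg omega_nonneg) auto
  then have "cNi m i * omega i * (3 ^ m * (2 * (1 + \<bar>r\<bar>)) ^ m) \<le> (\<Sum>i\<le>m. cNi m i * omega i) * (3 ^ m * (2 * (1 + \<bar>r\<bar>)) ^ m)"
    by (rule mult_right_mono) auto
  then show ?thesis unfolding cstG_def by linarith
qed

lemma betaG_gt_1: "1 < betaG m d"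
  unfolding betaG_def by (rule one_less_power) auto

context lifted
begin

lemma card_V_le: 
  assumes "CARD('m) \<le> n"
  shows "card V + CARD('m) \<le> (CARD('m) * CARD('m) + 4 * CARD('m) + 2) * n"
proof -
  have n: "1 \<le> n" using assms m_pos by linarith
  have "card V + CARD('m) \<le> n + (CARD('m) * CARD('m) + 4 * CARD('m) + 1) * 1"
    using card_liftV[where 'm = 'm, of n] by simp
  also have "\<dots> \<le> n + (CARD('m) * CARD('m) + 4 * CARD('m) + 1) * n"
    using n by (intro add_left_mono mult_left_mono) auto
  finally show ?thesis by (simp add: algebra_simps)
qed

lemma powers_le_betaG:
  assumes "CARD('m) \<le> n"
  shows "real ((4 * d + 4) ^ card V) * real ((2 * (4 * d + 4)) ^ (card V + CARD('m))) \<le> betaG CARD('m) d ^ n"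
proof -
  define K where "K = CARD('m) * CARD('m) + 4 * CARD('m) + 2"
  define q where "q = real (8 * d + 8)"
  have q: "real (4 * d + 4) \<le> q" "real (2 * (4 * d + 4)) = q" "1 \<le> q" by (simp_all add: q_def)
  have K: "card V \<le> K * n" "card V + CARD('m) \<le> K * n"
    using card_V_le[OF assms] by (simp_all add: K_def)
  have "real (4 * d + 4) ^ card V \<le> q ^ card V" by (rule power_mono[OF q(1)]) simp
  also have "\<dots> \<le> q ^ (K * n)" by (rule power_increasing[OF K(1) q(3)])
  finally have "real (4 * d + 4) ^ card V * real (2 * (4 * d + 4)) ^ (card V + CARD('m)) \<le> q ^ (K * n) * q ^ (K * n)"
    unfolding q(2) using q(3) by (intro mult_mono power_increasing K(2)) auto
  also have "\<dots> = betaG CARD('m) d ^ n"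
    unfolding betaG_def q_def[symmetric] K_def[symmetric]
    by (simp add: power_mult[symmetric] power_add[symmetric] mult_2 add_mult_distrib)
  finally show ?thesis by (simp only: of_nat_power)
qed

lemma vitushkin_le:
  assumes n: "CARD('m) \<le> n" and i: "i \<le> CARD('m)"
  shows "vitushkin i A \<le> ennreal (cstG CARD('m) r * real n ^ CARD('m) * betaG CARD('m) d ^ n * (\<Prod>k\<in>{1..i}. \<Lambda> k))"
proof -
  let ?m = "CARD('m)" and ?P = "\<Prod>k\<in>{1..i}. \<Lambda> k"
  let ?v = "real ((4 * d + 4) ^ card V)" and ?w = "real ((2 * (4 * d + 4)) ^ (card V + CARD('m)))"
  have vw: "?v * ?w \<le> betaG ?m d ^ n" by (rule powers_le_betaG[OF n])
  have P: "0 \<le> ?P" by (rule prod_\<Lambda>_nonneg[OF i])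
  have n1: "1 \<le> real n" using n m_pos by linarith
  have "?v \<le> cstG ?m r * real n ^ ?m * betaG ?m d ^ n"
  proof -
    have "1 \<le> cstG ?m r * real n ^ ?m"
      using mult_mono[OF cstG_ge_1[of ?m r] one_le_power[OF n1, of ?m]] cstG_ge_1[of ?m r] by simp
    moreover have "?v \<le> betaG ?m d ^ n"
    proof -
      have "1 \<le> ?w" unfolding of_nat_power by (rule one_le_power) simp
      then have "?v * 1 \<le> ?v * ?w" by (intro mult_left_mono) auto
      then show ?thesis using vw by linarith
    qed
    ultimately have "1 * ?v \<le> cstG ?m r * real n ^ ?m * betaG ?m d ^ n"
      by (intro mult_mono) auto
    then show ?thesis by simp
  qed
  then have zero: ?thesis if "i = 0"
    using that order_trans[OF vitushkin_0 ennreal_leI] by simp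
  have pos: ?thesis if i1: "1 \<le> i"
  proof -
    have "card cylC \<le> n + ?m"
      using card_Un_le[of "Xc ` {..<n}" "range (Wc :: 'm \<Rightarrow> _)"]
        card_image_le[of "{..<n}" "Xc :: _ \<Rightarrow> 'm idx"] card_image_le[of UNIV "Wc :: 'm \<Rightarrow> _"] by simp
    then have "real (card cylC + ?m) ^ ?m \<le> (3 * real n) ^ ?m"
      using n by (intro power_mono) auto
    then have C: "real (card cylC + ?m) ^ ?m \<le> 3 ^ ?m * real n ^ ?m" by (simp add: power_mult_distrib)
    let ?R = "(2 * (1 + \<bar>r\<bar>)) ^ ?m"
    have "cNi ?m i * (?v * (omega i * volB i)) =
      (cNi ?m i * omega i * ?R * real (card cylC + ?m) ^ ?m) * (?v * ?w) * ?P"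
      unfolding volB_def by (simp only: mult_ac)
    also have "\<dots> \<le> (cNi ?m i * omega i * ?R * (3 ^ ?m * real n ^ ?m)) * betaG ?m d ^ n * ?P"
      by (intro mult_mono mult_right_mono mult_left_mono C vw P order_refl mult_nonneg_nonneg
        cNi_nonneg omega_nonneg i zero_le_power) auto
    also have "\<dots> = (cNi ?m i * omega i * (3 ^ ?m * ?R)) * (real n ^ ?m * betaG ?m d ^ n * ?P)"
      by (simp only: mult_ac)
    also have "\<dots> \<le> cstG ?m r * (real n ^ ?m * betaG ?m d ^ n * ?P)"
      using P betaG_gt_1[of ?m d] by (intro mult_right_mono cstG_ge i mult_nonneg_nonneg) auto
    finally show ?thesis
      by (intro order_trans[OF vitushkin_pos[OF i1 i] ennreal_leI]) (simp only: mult_ac)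
  qed
  show ?thesis using zero pos by (cases "i = 0") auto
qed

end

theorem theoremG:
  shows "\<exists>cst :: real \<Rightarrow> real. (\<forall>r>0. cst r > 0) \<and>
    (\<forall>d::nat. \<exists>\<beta>0::real. \<beta>0 > 1 \<and>
      (\<forall>r>0. \<forall>n::nat. n \<ge> CARD('m::finite) \<longrightarrow>
        (\<forall>(c :: 'm \<Rightarrow> (nat \<Rightarrow> nat) \<Rightarrow> real) (\<Lambda> :: nat \<Rightarrow> real).
          (\<forall>k\<in>{1..CARD('m)}. \<Lambda> k \<ge> 0) \<longrightarrow>
          (\<forall>i\<le>CARD('m).
             vitushkin i (pmap n d c ` (CLam n d c \<Lambda> \<inter> ballRn n r))
               \<le> ennreal (cst r * real n ^ CARD('m) * \<beta>0 ^ n * (\<Prod>k\<in>{1..i}. \<Lambda> k))))))"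
proof -
  obtain e :: "'m \<Rightarrow> nat" where e: "bij_betw e UNIV {1..CARD('m)}"
    using finite_same_card_bij[of "UNIV :: 'm set" "{1..CARD('m)}"] by auto
  have bound: "vitushkin i (pmap n d c ` (CLam n d c \<Lambda> \<inter> ballRn n r))
      \<le> ennreal (cstG CARD('m) r * real n ^ CARD('m) * betaG CARD('m) d ^ n * (\<Prod>k\<in>{1..i}. \<Lambda> k))"
    if "n \<ge> CARD('m)" "\<forall>k\<in>{1..CARD('m)}. \<Lambda> k \<ge> 0" "i \<le> CARD('m)"
    for d n i r and c :: "'m \<Rightarrow> (nat \<Rightarrow> nat) \<Rightarrow> real" and \<Lambda> :: "nat \<Rightarrow> real"
  proof -
    interpret lifted n d c \<Lambda> r e by standard (use that e in auto)
    show ?thesis by (rule vitushkin_le[OF that(1,3)])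
  qed
  have "\<forall>r>0. cstG CARD('m) r > 0" using cstG_ge_1[of "CARD('m)"] by (metis less_le_trans zero_less_one)
  \<comment> \<open>\<open>cstG\<close> is supplied before the degree is given; only
    \<open>betaG\<close> depends on \<open>d\<close>.\<close>
  then show ?thesis using betaG_gt_1 bound
    by (intro exI[of _ "cstG CARD('m)"] conjI allI exI[of _ "betaG CARD('m) _"] impI) auto
qed

end
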